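(* Let $0<b\le+\infty$, let $w,r\in L^1_{\mathrm{loc}}[0,b)$ be positive a.e., and let $W(x)=\int_0^x w\,dt$, $R(x)=\int_0^x r\,dt$. Assume that the endpoint $x=b$ is singular. Consider the inequality $$\Big(\int_0^b\frac{1}{r}|f'|^2dx\Big)^2\le K^2\int_0^b|f|^2\,w\,dx\,\int_0^b\frac1w\Big|\Big(\frac1r f'\Big)'\Big|^2dx,\qquad f\in\mathrm{dom}(A_+).\tag{H}$$ Then: (i) If $w\in L^1(0,b)$, then (H) is valid if and only if $R\circ W^{-1}$ is positively increasing at $0$. (ii) If $r\in L^1(0,b)$ and $w\notin L^1(0,b)$, then (H) is not valid. (iii) If $w,r\notin L^1(0,b)$, then (H) is valid if and only if $R\circ W^{-1}$ is positively increasing at both $0$ and $\infty$.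
   Context: The inequality (H) is said to be valid if there is $K>0$ such that it holds for all $f\in\mathrm{dom}(A_+)$. The endpoint $b$ is regular if $b<\infty$ and $w,r\in L^1(0,b)$, and singular otherwise. The endpoint $b$ is in the limit point case if $w\notin L^1(0,b)$ or $R\notin L^2_w(0,b)$, and otherwise in the limit circle case. $$\mathrm{dom}(A_+)=\{f\in L^2_w(0,b):\ f,\ r^{-1}f'\in AC_{\mathrm{loc}}[0,b),\ w^{-1}(r^{-1}f')'\in L^2_w(0,b)\};$$ in the limit circle case at $b$, functions in $\mathrm{dom}(A_+)$ are additionally required to satisfy $\lim_{x\uparrow b}(r^{-1}f')(x)=0$. $W^{-1}$ is the inverse function of $W$. A nondecreasing function $f$ is called positively increasing at $\infty$ (at $0$) if there is $t\in(0,1)$ such that $\limsup_{x\to\infty}f(xt)/f(x)\neq1$ (respectively $\limsup_{x\to0}f(xt)/f(x)\neq1$). *)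

theory Defs
  imports "HOL-Analysis.Analysis"
begin

text \<open>The epsilon-delta notion of absolute continuity: the finite families of non-overlapping
  intervals are the divisions of subsets of \<open>S\<close>, an interval \<open>k\<close> being \<open>{Inf k..Sup k}\<close>.\<close>

definition abs_continuous_on :: "real set \<Rightarrow> (real \<Rightarrow> 'a::real_normed_vector) \<Rightarrow> bool" where
  "abs_continuous_on S f \<longleftrightarrow>
     (\<forall>\<epsilon>>0. \<exists>\<delta>>0. \<forall>D T. D division_of T \<and> T \<subseteq> S \<and> (\<Sum>k\<in>D. Sup k - Inf k) < \<delta>
        \<longrightarrow> (\<Sum>k\<in>D. norm (f (Sup k) - f (Inf k))) < \<epsilon>)"

text \<open>The interval is \<open>(0, b)\<close> or \<open>[0, b)\<close>, with \<open>b\<close> in the extended reals.\<close>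

definition AC_loc :: "ereal \<Rightarrow> (real \<Rightarrow> 'a::real_normed_vector) \<Rightarrow> bool" where
  "AC_loc b f \<longleftrightarrow> (\<forall>c>0. ereal c < b \<longrightarrow> abs_continuous_on {0..c} f)"

definition L1 :: "ereal \<Rightarrow> (real \<Rightarrow> real) \<Rightarrow> bool" where
  "L1 b u \<longleftrightarrow> u absolutely_integrable_on einterval 0 b"

definition L1_loc :: "ereal \<Rightarrow> (real \<Rightarrow> real) \<Rightarrow> bool" where
  "L1_loc b u \<longleftrightarrow> (\<forall>c>0. ereal c < b \<longrightarrow> u absolutely_integrable_on {0..c})"

definition L2 :: "ereal \<Rightarrow> (real \<Rightarrow> real) \<Rightarrow> (real \<Rightarrow> 'a::real_normed_vector) \<Rightarrow> bool" where
  "L2 b w f \<longleftrightarrow> f \<in> borel_measurable (lebesgue_on (einterval 0 b)) \<and>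
     (\<lambda>x. (norm (f x))\<^sup>2 * w x) absolutely_integrable_on einterval 0 b"

definition primitive :: "(real \<Rightarrow> real) \<Rightarrow> real \<Rightarrow> real" where
  "primitive u x = (LINT t:{0..x}|lebesgue. u t)"

definition regular_endpoint :: "ereal \<Rightarrow> (real \<Rightarrow> real) \<Rightarrow> (real \<Rightarrow> real) \<Rightarrow> bool" where
  "regular_endpoint b w r \<longleftrightarrow> b < \<infinity> \<and> L1 b w \<and> L1 b r"

definition limit_point :: "ereal \<Rightarrow> (real \<Rightarrow> real) \<Rightarrow> (real \<Rightarrow> real) \<Rightarrow> bool" where
  "limit_point b w r \<longleftrightarrow> \<not> L1 b w \<or> \<not> L2 b w (primitive r)"

text \<open>For \<open>f\<close> in \<open>AC_loc\<close> the quotient \<open>f'/r\<close> is only defined almost everywhere; saying that it is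
  locally absolutely continuous means that it has a locally absolutely continuous
  representative. That representative is unique on \<open>[0, b)\<close>, so the choice in \<open>quasi_deriv\<close> is
  immaterial. At points of non-differentiability \<^const>\<open>vector_derivative\<close> is arbitrary, but
  these form a null set.\<close>

definition is_quasi_deriv ::
  "ereal \<Rightarrow> (real \<Rightarrow> real) \<Rightarrow> (real \<Rightarrow> complex) \<Rightarrow> (real \<Rightarrow> complex) \<Rightarrow> bool" where
  "is_quasi_deriv b r f g \<longleftrightarrow> AC_loc b g \<and>
     (AE x in lebesgue. x \<in> einterval 0 b \<longrightarrow> g x = vector_derivative f (at x) /\<^sub>R r x)"

definition quasi_deriv :: "ereal \<Rightarrow> (real \<Rightarrow> real) \<Rightarrow> (real \<Rightarrow> complex) \<Rightarrow> real \<Rightarrow> complex" where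
  "quasi_deriv b r f = (SOME g. is_quasi_deriv b r f g)"

definition dom_A :: "ereal \<Rightarrow> (real \<Rightarrow> real) \<Rightarrow> (real \<Rightarrow> real) \<Rightarrow> (real \<Rightarrow> complex) set" where
  "dom_A b w r = {f. L2 b w f \<and> AC_loc b f \<and> (\<exists>g. is_quasi_deriv b r f g) \<and>
     L2 b w (\<lambda>x. vector_derivative (quasi_deriv b r f) (at x) /\<^sub>R w x) \<and>
     (\<not> limit_point b w r \<longrightarrow>
        ((\<lambda>y. quasi_deriv b r f (real_of_ereal y)) \<longlongrightarrow> 0) (at_left b))}"

text \<open>The integrals are taken in \<^typ>\<open>ennreal\<close>, so that an infinite left-hand side
  counts as a violation of the inequality.\<close>

definition H_valid :: "ereal \<Rightarrow> (real \<Rightarrow> real) \<Rightarrow> (real \<Rightarrow> real) \<Rightarrow> bool" where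
  "H_valid b w r \<longleftrightarrow> (\<exists>K>0. \<forall>f\<in>dom_A b w r.
     (\<integral>\<^sup>+x\<in>einterval 0 b. ennreal (1 / r x * (norm (vector_derivative f (at x)))\<^sup>2) \<partial>lebesgue)\<^sup>2
     \<le> ennreal (K\<^sup>2)
       * (\<integral>\<^sup>+x\<in>einterval 0 b. ennreal ((norm (f x))\<^sup>2 * w x) \<partial>lebesgue)
       * (\<integral>\<^sup>+x\<in>einterval 0 b.
            ennreal (1 / w x * (norm (vector_derivative (quasi_deriv b r f) (at x)))\<^sup>2) \<partial>lebesgue))"

text \<open>A property of nondecreasing functions, stated for a filter: \<open>at_right 0\<close> for \<open>0\<close> and
  \<open>at_top\<close> for infinity. \<open>Limsup\<close> is taken in the extended reals.\<close>

definition positively_increasing :: "real filter \<Rightarrow> (real \<Rightarrow> real) \<Rightarrow> bool" where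
  "positively_increasing F f \<longleftrightarrow>
     (\<exists>t. 0 < t \<and> t < 1 \<and> Limsup F (\<lambda>x. ereal (f (x * t) / f x)) \<noteq> 1)"

text \<open>\<open>R \<circ> W\<^sup>-\<^sup>1\<close>, meaningful on \<open>[0, W(b))\<close>: \<open>W\<close> is strictly increasing on \<open>[0, b)\<close>. When
  \<open>w\<close> is not integrable, \<open>W(b)\<close> is infinite.\<close>

definition R_comp_W_inv :: "ereal \<Rightarrow> (real \<Rightarrow> real) \<Rightarrow> (real \<Rightarrow> real) \<Rightarrow> real \<Rightarrow> real" where
  "R_comp_W_inv b w r = primitive r \<circ> the_inv_into {x. 0 \<le> x \<and> ereal x < b} (primitive w)"

end

theory Submission
  imports Defs
begin

text \<open>Write an element \<open>f\<close> of the domain as a solution \<open>u = f\<close> of the first-order system \<open>u' = r v\<close>,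
  \<open>v' = w h\<close>. The left-hand side of the inequality is the square of the energy \<open>\<integral> r \<bar>v\<bar>\<^sup>2\<close>, and the
  right-hand side contains the norms of \<open>u\<close> and \<open>h\<close> in \<open>L\<^sup>2\<^sub>w(0, b)\<close>. The proof shows that the
  inequality is valid if and only if \<open>P = R \<circ> W\<^sup>-\<^sup>1\<close> has a scale gap: there are \<open>t, d \<in> (0, 1)\<close> with
  \<open>P(t s) \<le> (1 - d) P(s)\<close> for all \<open>s\<close> in the range \<open>[0, W(b))\<close> of \<open>W\<close>.

  For the scale gap to imply the inequality, integrate by parts. The energy up to \<open>x\<close> equals
  \<open>u \<bullet> v\<close> at \<open>x\<close> minus \<open>u \<bullet> v\<close> at \<open>0\<close> minus \<open>\<integral> w (u \<bullet> h)\<close>, and the last term is bounded by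
  the product of the norms. The boundary term at \<open>x\<close> is at most \<open>\<epsilon>\<close> for \<open>x\<close> arbitrarily close to \<open>b\<close>
  (\<open>boundary_term_not_L1\<close>, \<open>boundary_term_L1\<close>). The product \<open>\<bar>u 0\<bar> \<bar>v 0\<bar>\<close> is controlled by a scaling
  argument (\<open>initial_value_le\<close>): \<open>v\<close> stays within \<open>\<bar>v 0\<bar> / 2\<close> of \<open>v 0\<close> up to the point \<open>X\<close> at which
  \<open>W X\<close> times the squared norm of \<open>h\<close> is \<open>\<bar>v 0\<bar>\<^sup>2 / 4\<close>, and on \<open>[0, X]\<close> the function \<open>u\<close> behaves like
  \<open>u 0 + v 0 R\<close>. By the scale gap such a function cannot be small, compared with \<open>u 0\<close>, on most of
  \<open>[0, X]\<close>, so that the squared norm of \<open>u\<close> is at least a multiple of \<open>\<bar>u 0\<bar>\<^sup>2 W X\<close>. For integrable \<open>w\<close>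
  the point \<open>X\<close> exists because \<open>v\<close> vanishes at \<open>b\<close> (\<open>v_decay\<close>); this is where the distinction of
  the limit point and limit circle cases enters.

  Conversely, if \<open>P(t s)\<close> is close to \<open>P(s)\<close> for a small \<open>t\<close>, then the function with quasi-derivative
  \<open>1 - W / s\<close> up to the point \<open>x\<close> with \<open>W x = s\<close>, and \<open>0\<close> from there on, has energy about \<open>P(s)\<close>, but is
  small except where \<open>W \<le> t s\<close> (\<open>energy_inequality_test_function\<close>).

  Finally, the scale gap is compared with positive increase. The ratio \<open>P(t s) / P(s)\<close> is less than
  \<open>1\<close> everywhere and continuous, so only its behaviour at the ends of the range of \<open>W\<close> matters. If
  \<open>w\<close> is integrable, then the right end is harmless; if \<open>w\<close> is not integrable but \<open>r\<close> is, then \<open>P\<close> is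
  bounded on an infinite range and there is no scale gap.

  The analysis rests on the fundamental theorem of calculus for absolutely continuous functions
  (\<open>abs_continuous_FTC\<close>). A function with the epsilon-delta property is the difference of two monotone
  ones, its positive variation and the rest; these generate Stieltjes measures that are absolutely
  continuous with respect to Lebesgue measure, so that the Radon-Nikodym theorem represents the
  function as an indefinite integral. Indefinite integrals are differentiable almost everywhere by
  \<open>Lebesgue_differentiation\<close>.\<close>

section \<open>Differentiation of indefinite integrals\<close>

text \<open>The set where the difference quotients of the indefinite integral deviate from \<open>f x\<close> by more
  than \<open>e\<close> at arbitrarily small scales is negligible: the intervals with endpoints \<open>x\<close> and \<open>y\<close> that
  witness the deviation form a Vitali cover, and Henstock's lemma bounds the total length of any
  finite disjoint subfamily by a multiple of an arbitrarily small number.\<close>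

lemma Lebesgue_differentiation_negligible:
  fixes f :: "real \<Rightarrow> 'a::euclidean_space"
  assumes f: "f integrable_on {a..b}" and e: "e > 0"
  shows "negligible {x \<in> {a<..<b}. \<forall>d>0. \<exists>y\<in>{a<..<b}. y \<noteq> x \<and> \<bar>y - x\<bar> < d \<and>
    norm (integral {min x y..max x y} f - \<bar>y - x\<bar> *\<^sub>R f x) > e * \<bar>y - x\<bar>}" (is "negligible ?E")
  unfolding negligible_outer
proof (intro allI impI)
  fix \<eta> :: real assume \<eta>: "\<eta> > 0"
  have f': "f integrable_on cbox a b" using f by simp
  have "e * \<eta> / 2 > 0" using e \<eta> by simp
  obtain \<gamma> where \<gamma>: "gauge \<gamma>"
    and hen: "\<And>p. p tagged_partial_division_of (cbox a b) \<Longrightarrow> \<gamma> fine p \<Longrightarrow>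
             (\<Sum>(x,k)\<in>p. norm (measure lborel k *\<^sub>R f x - integral k f)) < e * \<eta> / 2"
    using Henstock_lemma[OF f' \<open>e * \<eta> / 2 > 0\<close>] by blast
  define I where "I = (\<lambda>(x::real, y). {min x y..max x y})"
  define K where "K = {(x, y). x \<in> ?E \<and> y \<in> {a<..<b} \<and> y \<noteq> x \<and> I (x, y) \<subseteq> \<gamma> x \<and>
      norm (integral (I (x, y)) f - \<bar>y - x\<bar> *\<^sub>R f x) > e * \<bar>y - x\<bar>}"
  define m where "m = (\<lambda>(x::real, y). (x + y) / 2)"
  define h where "h = (\<lambda>(x::real, y). \<bar>y - x\<bar> / 2)"
  \<comment> \<open>Vitali's covering theorem is stated for balls; on the line they are intervals.\<close>
  have cb: "cball (m i) (h i) = I i" for i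
    by (cases i) (auto simp: m_def h_def I_def dist_real_def abs_if min_def max_def field_simps split: if_splits)
  have 1: "0 < h i" if "i \<in> K" for i
    using that by (auto simp: K_def h_def)
  have 2: "\<exists>i. i \<in> K \<and> x \<in> cball (m i) (h i) \<and> h i < d" if "x \<in> ?E" "d > 0" for x d
  proof -
    from \<gamma> have "open (\<gamma> x)" "x \<in> \<gamma> x" by (auto simp: gauge_def)
    then obtain \<rho> where \<rho>: "\<rho> > 0" "ball x \<rho> \<subseteq> \<gamma> x" by (meson openE)
    have "0 < min d \<rho>" using \<rho>(1) that(2) by simp
    with that(1) obtain y where y: "y \<in> {a<..<b}" "y \<noteq> x" "\<bar>y - x\<bar> < min d \<rho>"
       "norm (integral {min x y..max x y} f - \<bar>y - x\<bar> *\<^sub>R f x) > e * \<bar>y - x\<bar>" by blast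
    have "I (x, y) \<subseteq> ball x \<rho>" using y(3) by (auto simp: I_def dist_real_def)
    then have "(x, y) \<in> K" using y that \<rho> unfolding K_def by (auto simp: I_def)
    moreover have "x \<in> I (x, y)" by (auto simp: I_def)
    moreover have "h (x, y) < d" using y(3) that(2) by (auto simp: h_def)
    ultimately show ?thesis using cb by blast
  qed
  obtain C where C: "countable C" "C \<subseteq> K"
    "pairwise (\<lambda>i j. disjnt (cball (m i) (h i)) (cball (m j) (h j))) C"
    "negligible (?E - (\<Union>i\<in>C. cball (m i) (h i)))"
    using Vitali_covering_theorem_cballs[of K h ?E m, OF 1 2] by blast
  have dj: "I i \<inter> I j = {}" if "i \<in> C" "j \<in> C" "i \<noteq> j" for i j
    using C(3) that by (auto simp: pairwise_def disjnt_def cb)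
  have fin_le: "(\<Sum>i\<in>G. measure lebesgue (I i)) \<le> \<eta> / 2" if G: "G \<subseteq> C" "finite G" for G
  proof -
    define p where "p = (\<lambda>i. (fst i, I i)) ` G"
    have inj: "inj_on (\<lambda>i. (fst i, I i)) G"
    proof (rule inj_onI)
      fix i j assume ij: "i \<in> G" "j \<in> G" "(fst i, I i) = (fst j, I j)"
      have "I i \<noteq> {}" by (cases i) (auto simp: I_def)
      with ij have "I i \<inter> I j \<noteq> {}" by simp
      then show "i = j" using dj[of i j] G ij by blast
    qed
    have "p tagged_partial_division_of (cbox a b)"
      unfolding tagged_partial_division_of_def
    proof (intro conjI allI impI)
      show "finite p" using G by (simp add: p_def)
      fix x k assume xk: "(x, k) \<in> p"
      then obtain i where i: "i \<in> G" "x = fst i" "k = I i" by (auto simp: p_def)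
      then have iK: "i \<in> K" using G C by auto
      show "x \<in> k" using i by (cases i) (auto simp: I_def)
      show "k \<subseteq> cbox a b" using iK i by (cases i) (auto simp: I_def K_def)
      show "\<exists>a b. k = cbox a b" using i by (cases i) (auto simp: I_def)
    next
      fix x1 k1 x2 k2
      assume *: "(x1, k1) \<in> p \<and> (x2, k2) \<in> p \<and> (x1, k1) \<noteq> (x2, k2)"
      then obtain i j where ij: "i \<in> G" "j \<in> G" "(x1, k1) = (fst i, I i)" "(x2, k2) = (fst j, I j)"
        by (auto simp: p_def)
      with * have "i \<noteq> j" by auto
      then have "k1 \<inter> k2 = {}" using dj[of i j] ij G by auto
      then show "interior k1 \<inter> interior k2 = {}"
        using interior_subset by fast
    qed
    moreover have "I i \<subseteq> \<gamma> (fst i)" if "i \<in> G" for i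
      using that G C(2) by (cases i) (auto simp: K_def)
    then have "\<gamma> fine p" unfolding fine_def p_def by auto
    ultimately have "(\<Sum>(x,k)\<in>p. norm (measure lborel k *\<^sub>R f x - integral k f)) < e * \<eta> / 2"
      by (rule hen)
    then have *: "(\<Sum>i\<in>G. norm (measure lborel (I i) *\<^sub>R f (fst i) - integral (I i) f)) < e * \<eta> / 2"
      unfolding p_def by (subst (asm) sum.reindex[OF inj]) simp
    have "(\<Sum>i\<in>G. e * measure lebesgue (I i)) \<le> (\<Sum>i\<in>G. norm (measure lborel (I i) *\<^sub>R f (fst i) - integral (I i) f))"
    proof (rule sum_mono)
      fix i assume "i \<in> G"
      then have iK: "i \<in> K" using G C by auto
      obtain x y where xy: "i = (x, y)" by (cases i)
      have c: "measure lebesgue (I (x, y)) = \<bar>y - x\<bar>" by (auto simp: I_def xy)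
      have c': "measure lborel (I (x, y)) = \<bar>y - x\<bar>" by (auto simp: I_def xy)
      show "e * measure lebesgue (I i) \<le> norm (measure lborel (I i) *\<^sub>R f (fst i) - integral (I i) f)"
        using iK unfolding xy fst_conv c c' by (auto simp: K_def norm_minus_commute)
    qed
    with * have "e * (\<Sum>i\<in>G. measure lebesgue (I i)) < e * (\<eta> / 2)" by (simp add: sum_distrib_left)
    then show ?thesis using e by simp
  qed
  have Im: "I i \<in> lmeasurable" for i by (cases i) (auto simp: I_def)
  have ble: "measure lebesgue (\<Union>i\<in>G. I i) \<le> \<eta> / 2" if "G \<subseteq> C" "finite G" for G
    using measure_UNION_le[of G I lebesgue] Im fin_le[OF that] that(2) by (force simp: fmeasurable_def)
  have U: "(\<Union>i\<in>C. I i) \<in> lmeasurable" "measure lebesgue (\<Union>i\<in>C. I i) \<le> \<eta> / 2"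
    using fmeasurable_UN_bound[OF C(1) Im ble] measure_UN_bound[OF C(1) Im ble] by auto
  let ?N = "?E - (\<Union>i\<in>C. I i)"
  have N: "?N \<in> null_sets lebesgue" using C(4) by (simp add: cb negligible_iff_null_sets)
  have "measure lebesgue (?N \<union> (\<Union>i\<in>C. I i)) \<le> \<eta>/2"
    using measure_Un_null_set[of "\<Union>i\<in>C. I i" lebesgue ?N] U N by (simp add: fmeasurableD Un_commute)
  moreover have "?N \<union> (\<Union>i\<in>C. I i) \<in> lmeasurable"
    using U N by (intro fmeasurable.Un) (auto intro: fmeasurableI_null_sets)
  ultimately show "\<exists>T. ?E \<subseteq> T \<and> T \<in> lmeasurable \<and> measure lebesgue T < \<eta>"
    using \<eta> by (intro exI[of _ "?N \<union> (\<Union>i\<in>C. I i)"]) auto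
qed

theorem Lebesgue_differentiation:
  fixes f :: "real \<Rightarrow> 'a::euclidean_space"
  assumes f: "f integrable_on {a..b}"
  shows "AE x\<in>{a<..<b} in lebesgue.
    ((\<lambda>x. integral {a..x} f) has_vector_derivative f x) (at x)"
proof -
  let ?E = "\<lambda>e. {x \<in> {a<..<b}. \<forall>d>0. \<exists>y\<in>{a<..<b}. y \<noteq> x \<and> \<bar>y - x\<bar> < d \<and>
    norm (integral {min x y..max x y} f - \<bar>y - x\<bar> *\<^sub>R f x) > e * \<bar>y - x\<bar>}"
  have neg: "negligible (\<Union>n. ?E (1 / Suc n))"
  proof (intro negligible_countable_Union countable_image countableI_type, elim imageE)
    fix S n assume "S = ?E (1 / Suc n)"
    then show "negligible S"
      using Lebesgue_differentiation_negligible[OF f, of "1 / Suc n"] by simp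
  qed
  have "((\<lambda>x. integral {a..x} f) has_vector_derivative f x) (at x)"
    if x: "x \<in> {a<..<b}" and nx: "x \<notin> (\<Union>n. ?E (1 / Suc n))" for x
    unfolding has_vector_derivative_def has_derivative_within_alt
  proof (intro conjI allI impI bounded_linear_scaleR_left)
    fix e :: real assume "e > 0"
    then obtain n where n: "1 / Suc n < e" using nat_approx_posE by blast
    from nx x have "\<not> (\<forall>d>0. \<exists>y\<in>{a<..<b}. y \<noteq> x \<and> \<bar>y - x\<bar> < d \<and>
      norm (integral {min x y..max x y} f - \<bar>y - x\<bar> *\<^sub>R f x) > 1 / Suc n * \<bar>y - x\<bar>)" by blast
    then obtain d where d: "d > 0" and D: "\<And>y. y \<in> {a<..<b} \<Longrightarrow> y \<noteq> x \<Longrightarrow> \<bar>y - x\<bar> < d \<Longrightarrow>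
      norm (integral {min x y..max x y} f - \<bar>y - x\<bar> *\<^sub>R f x) \<le> 1 / Suc n * \<bar>y - x\<bar>"
      unfolding not_all not_imp bex_simps not_less by (metis not_less)
    define d' where "d' = min d (min (x - a) (b - x))"
    have "d' > 0" using d x by (auto simp: d'_def)
    moreover have "norm (integral {a..y} f - integral {a..x} f - (y - x) *\<^sub>R f x) \<le> e * norm (y - x)"
      if y: "norm (y - x) < d'" for y
    proof (cases "y = x")
      case False
      have yab: "y \<in> {a<..<b}" "\<bar>y - x\<bar> < d" using y by (auto simp: d'_def)
      have s: "integral {a..s} f + integral {s..t} f = integral {a..t} f" if "a \<le> s" "s \<le> t" "t \<le> b" for s t
        using that f by (intro Henstock_Kurzweil_Integration.integral_combine) 
            (auto intro: integrable_subinterval_real)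
      have "norm (integral {a..y} f - integral {a..x} f - (y - x) *\<^sub>R f x) =
        norm (integral {min x y..max x y} f - \<bar>y - x\<bar> *\<^sub>R f x)"
      proof (cases "x < y")
        case True
        then have "integral {a..y} f - integral {a..x} f = integral {x..y} f"
          using s[of x y] x yab by (simp add: algebra_simps)
        then show ?thesis using True by (simp add: min_def max_def)
      next
        case F: False
        then have "integral {a..y} f - integral {a..x} f = - integral {y..x} f"
          using s[of y x] x yab by (simp add: algebra_simps)
        then have "integral {a..y} f - integral {a..x} f - (y - x) *\<^sub>R f x
           = - (integral {y..x} f - (x - y) *\<^sub>R f x)" by (simp add: algebra_simps)
        then show ?thesis using F False by (simp add: min_def max_def norm_minus_commute)
      qed
      also have "\<dots> \<le> 1 / Suc n * \<bar>y - x\<bar>" using D yab False by blast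
      also have "\<dots> \<le> e * norm (y - x)" using n \<open>e > 0\<close> by (intro mult_mono) auto
      finally show ?thesis .
    qed simp
    ultimately show "\<exists>d>0. \<forall>y\<in>UNIV. norm (y - x) < d \<longrightarrow>
        norm (integral {a..y} f - integral {a..x} f - (y - x) *\<^sub>R f x) \<le> e * norm (y - x)" by blast
  qed
  then show ?thesis
    unfolding eventually_ae_filter_negligible
    by (intro exI[of _ "\<Union>n. ?E (1 / Suc n)"] conjI neg) blast
qed

section \<open>Finite families of non-overlapping intervals and the positive variation\<close>

text \<open>A finite family of closed intervals is a set \<open>D\<close> of sets, the endpoints of \<open>k \<in> D\<close> being \<open>Inf k\<close>
  and \<open>Sup k\<close>. The increments of \<open>f\<close> over the members are added up with their signs.\<close>

definition increment_sum :: "(real \<Rightarrow> real) \<Rightarrow> real set set \<Rightarrow> real" where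
  "increment_sum f D = (\<Sum>k\<in>D. f (Sup k) - f (Inf k))"

abbreviation total_length :: "real set set \<Rightarrow> real" where
  "total_length \<equiv> increment_sum (\<lambda>x. x)"

text \<open>The finite families of non-overlapping closed intervals contained in \<open>S\<close>.\<close>

definition divisions_in :: "real set \<Rightarrow> real set set set" where
  "divisions_in S = {D. D division_of \<Union>D \<and> \<Union>D \<subseteq> S}"

lemma divisions_in_mono: "S \<subseteq> T \<Longrightarrow> divisions_in S \<subseteq> divisions_in T"
  by (auto simp: divisions_in_def)

lemma empty_in_divisions_in: "{} \<in> divisions_in S"
  by (simp add: divisions_in_def)

lemma divisions_in_interval:
  assumes "D \<in> divisions_in S" "k \<in> D"
  obtains l u where "k = {l..u}" "l \<le> u" "Inf k = l" "Sup k = u" "{l..u} \<subseteq> S"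
proof -
  have d: "D division_of \<Union>D" "\<Union>D \<subseteq> S" using assms by (auto simp: divisions_in_def)
  obtain l u where k: "k = cbox l u" using division_ofD(4)[OF d(1) assms(2)] by blast
  have "k \<noteq> {}" using division_ofD(3)[OF d(1) assms(2)] .
  with k have "l \<le> u" by auto
  then show ?thesis using that[of l u] k d assms(2) by (auto simp: cbox_interval)
qed

lemma divisions_in_finite: "D \<in> divisions_in S \<Longrightarrow> finite D"
  by (auto simp: divisions_in_def)

lemma divisions_in_subset:
  assumes "D \<in> divisions_in S" "E \<subseteq> D" "\<Union>E \<subseteq> T"
  shows "E \<in> divisions_in T"
  using assms division_of_subset[of D E] by (auto simp: divisions_in_def)

lemma abs_continuous_on_alt:
  "abs_continuous_on S f \<longleftrightarrow> (\<forall>\<epsilon>>0. \<exists>\<delta>>0. \<forall>D\<in>divisions_in S. total_length D < \<delta> \<longrightarrow>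
     (\<Sum>k\<in>D. norm (f (Sup k) - f (Inf k))) < \<epsilon>)"
proof -
  have "(\<forall>D T. D division_of T \<and> T \<subseteq> S \<and> (\<Sum>k\<in>D. Sup k - Inf k) < \<delta> \<longrightarrow> P D) \<longleftrightarrow>
     (\<forall>D\<in>divisions_in S. total_length D < \<delta> \<longrightarrow> P D)" for \<delta> :: real and P
    by (auto simp: divisions_in_def increment_sum_def division_ofD(6) dest: division_ofD(6))
  then show ?thesis unfolding abs_continuous_on_def by simp
qed

lemma increment_sum_Un:
  assumes D: "D \<in> divisions_in S" and E: "E \<in> divisions_in T"
    and disj: "interior (\<Union>D) \<inter> interior (\<Union>E) = {}"
  shows "D \<union> E \<in> divisions_in (S \<union> T)"
    and "increment_sum f (D \<union> E) = increment_sum f D + increment_sum f E"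
proof -
  show "D \<union> E \<in> divisions_in (S \<union> T)"
    using division_disjoint_union[OF _ _ disj] D E by (auto simp: divisions_in_def)
  have "(\<Sum>k\<in>D \<inter> E. f (Sup k) - f (Inf k)) = 0"
  proof (intro sum.neutral ballI)
    fix k assume k: "k \<in> D \<inter> E"
    then obtain l u where lu: "k = {l..u}" "l \<le> u" "Inf k = l" "Sup k = u"
      using divisions_in_interval[OF D] by blast
    have "interior k \<subseteq> interior (\<Union>D)" "interior k \<subseteq> interior (\<Union>E)" using k by (auto intro!: interior_mono)
    with disj have "interior k = {}" by blast
    then have "l = u" using lu by (auto simp: interior_atLeastAtMost_real)
    then show "f (Sup k) - f (Inf k) = 0" using lu by simp
  qed
  then show "increment_sum f (D \<union> E) = increment_sum f D + increment_sum f E"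
    unfolding increment_sum_def
    using sum.union_inter[OF divisions_in_finite[OF D] divisions_in_finite[OF E], of "\<lambda>k. f (Sup k) - f (Inf k)"]
    by simp
qed

lemma single_in_divisions_in: "l \<le> u \<Longrightarrow> {l..u} \<subseteq> S \<Longrightarrow> {{l..u}} \<in> divisions_in S"
  using division_of_self[of l u] by (auto simp: divisions_in_def)

lemma increment_sum_single: "l \<le> u \<Longrightarrow> increment_sum f {{l..u}} = f u - f l"
  by (simp add: increment_sum_def)

lemma disjoint_interiors_separated:
  fixes x :: real
  assumes "A \<subseteq> {..x}" "B \<subseteq> {x..}"
  shows "interior A \<inter> interior B = {}"
proof -
  have "interior A \<subseteq> {..<x}" "interior B \<subseteq> {x<..}"
    using interior_mono[OF assms(1)] interior_mono[OF assms(2)] by auto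
  then show ?thesis by fastforce
qed

text \<open>A division of a subset of \<open>[a, c]\<close> can be cut at \<open>x\<close>: at most one member has \<open>x\<close> in its
  interior, and it is replaced by its two halves. The pieces do not depend on the function whose
  increments are added up.\<close>

lemma cut_division:
  assumes D: "D \<in> divisions_in {a..c}"
  obtains D1 D2 where "D1 \<in> divisions_in {a..x}" "D2 \<in> divisions_in {x..c}"
    "\<And>f. increment_sum f D = increment_sum f D1 + increment_sum f D2"
proof -
  define L where "L = {k\<in>D. Sup k \<le> x}"
  define R where "R = {k\<in>D. \<not> Sup k \<le> x \<and> x \<le> Inf k}"
  define M where "M = {k\<in>D. \<not> Sup k \<le> x \<and> \<not> x \<le> Inf k}"
  have fin: "finite D" using D by (rule divisions_in_finite)
  have LRM: "increment_sum f D = increment_sum f L + increment_sum f R + increment_sum f M" for f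
  proof -
    have D_eq: "D = (L \<union> R) \<union> M" by (auto simp: L_def R_def M_def)
    show ?thesis unfolding increment_sum_def
      by (subst D_eq, subst sum.union_disjoint, use fin in \<open>auto simp: L_def R_def M_def\<close>)
         (subst sum.union_disjoint, auto)
  qed
  have Lsub: "\<Union>L \<subseteq> {a..x}"
  proof
    fix y assume "y \<in> \<Union>L"
    then obtain k where k: "y \<in> k" "k \<in> D" "Sup k \<le> x" by (auto simp: L_def)
    then show "y \<in> {a..x}" by (elim divisions_in_interval[OF D]) auto
  qed
  have Rsub: "\<Union>R \<subseteq> {x..c}"
  proof
    fix y assume "y \<in> \<Union>R"
    then obtain k where k: "y \<in> k" "k \<in> D" "x \<le> Inf k" by (auto simp: R_def)
    then show "y \<in> {x..c}" by (elim divisions_in_interval[OF D]) auto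
  qed
  have L: "L \<in> divisions_in {a..x}" using D Lsub by (intro divisions_in_subset[OF D]) (auto simp: L_def)
  have R: "R \<in> divisions_in {x..c}" using D Rsub by (intro divisions_in_subset[OF D]) (auto simp: R_def)
  show ?thesis
  proof (cases "M = {}")
    case True
    then show ?thesis using that[OF L R] LRM by (simp add: increment_sum_def)
  next
    case False
    then obtain k where k: "k \<in> M" by blast
    then have kD: "k \<in> D" by (simp add: M_def)
    then obtain l u where lu: "k = {l..u}" "l \<le> u" "Inf k = l" "Sup k = u" "{l..u} \<subseteq> {a..c}"
      by (rule divisions_in_interval[OF D])
    have lxu: "l < x" "x < u" using k lu by (auto simp: M_def)
    have int: "interior k \<inter> interior k' = {}" if "k' \<in> D" "k' \<noteq> k" for k'
      using division_ofD(5)[of D "\<Union>D" k k'] D that kD by (auto simp: divisions_in_def)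
    have Mk: "M = {k}"
    proof -
      have "k' = k" if "k' \<in> M" for k'
      proof (rule ccontr)
        assume ne: "k' \<noteq> k"
        have k'D: "k' \<in> D" using that by (simp add: M_def)
        then obtain l' u' where lu': "k' = {l'..u'}" "Inf k' = l'" "Sup k' = u'"
          by (rule divisions_in_interval[OF D])
        then have "x \<in> interior k'" using that by (auto simp: M_def)
        moreover have "x \<in> interior k" using lu lxu by auto
        ultimately show False using int[OF k'D ne] by blast
      qed
      then show ?thesis using k by blast
    qed
    have Lint: "interior (\<Union>S) \<inter> interior k = {}" if "S \<subseteq> D - {k}" for S
    proof -
      have "interior k \<inter> interior (\<Union>S) = {}"
      proof (rule Int_interior_Union_intervals)
        show "finite S" using that fin by (auto intro: finite_subset)
        show "open (interior k)" by simp
        show "\<And>T. T \<in> S \<Longrightarrow> \<exists>a b. T = cbox a b"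
          using that D division_ofD(4)[of D "\<Union>D"] unfolding divisions_in_def by blast
        show "\<And>T. T \<in> S \<Longrightarrow> interior k \<inter> interior T = {}" using that int by blast
      qed
      then show ?thesis by blast
    qed
    have kL: "interior (\<Union>{{l..x}}) \<inter> interior (\<Union>L) = {}"
    proof -
      have "interior {l..x} \<subseteq> interior k" using lu lxu by (intro interior_mono) auto
      moreover have "L \<subseteq> D - {k}" using k by (auto simp: L_def M_def)
      ultimately show ?thesis using Lint[of L] by auto
    qed
    have kR: "interior (\<Union>{{x..u}}) \<inter> interior (\<Union>R) = {}"
    proof -
      have "interior {x..u} \<subseteq> interior k" using lu lxu by (intro interior_mono) auto
      moreover have "R \<subseteq> D - {k}" using k by (auto simp: R_def M_def)
      ultimately show ?thesis using Lint[of R] by auto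
    qed
    have 1: "{{l..x}} \<in> divisions_in {a..x}" "{{x..u}} \<in> divisions_in {x..c}"
      using lu lxu by (auto intro!: single_in_divisions_in)
    show ?thesis
    proof (rule that)
      show "{{l..x}} \<union> L \<in> divisions_in {a..x}"
        using increment_sum_Un(1)[OF 1(1) L kL] by simp
      show "{{x..u}} \<union> R \<in> divisions_in {x..c}"
        using increment_sum_Un(1)[OF 1(2) R kR] by simp
      show "increment_sum f D = increment_sum f ({{l..x}} \<union> L) + increment_sum f ({{x..u}} \<union> R)" for f
        unfolding increment_sum_Un(2)[OF 1(1) L kL] increment_sum_Un(2)[OF 1(2) R kR] LRM Mk
        using lu lxu by (simp add: increment_sum_def)
    qed
  qed
qed

text \<open>Divisions of the members of a division are combined into one. Two of them can share only
  degenerate intervals, which contribute nothing.\<close>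

lemma refine_division:
  assumes "finite D" "D \<in> divisions_in S" "\<And>k. k \<in> D \<Longrightarrow> E k \<in> divisions_in k"
  shows "\<exists>E'. E' \<in> divisions_in S \<and> \<Union>E' \<subseteq> \<Union>D \<and> (\<forall>f. increment_sum f E' = (\<Sum>k\<in>D. increment_sum f (E k)))"
  using assms
proof (induction D rule: finite_induct)
  case empty
  then show ?case by (intro exI[of _ "{}"]) (simp add: empty_in_divisions_in increment_sum_def)
next
  case (insert k D)
  have D: "D \<in> divisions_in S" using insert.prems by (intro divisions_in_subset[OF insert.prems(1)]) (auto simp: divisions_in_def)
  with insert obtain E' where E': "E' \<in> divisions_in S" "\<Union>E' \<subseteq> \<Union>D"
    "\<And>f. increment_sum f E' = (\<Sum>k\<in>D. increment_sum f (E k))" by auto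
  have Ek: "E k \<in> divisions_in k" using insert by auto
  have kS: "k \<subseteq> S" using insert.prems by (auto simp: divisions_in_def)
  have "interior k \<inter> interior (\<Union>D) = {}"
  proof (rule Int_interior_Union_intervals)
    have d: "insert k D division_of \<Union>(insert k D)" using insert.prems(1) by (simp add: divisions_in_def)
    show "finite D" "open (interior k)" using insert by auto
    show "\<And>T. T \<in> D \<Longrightarrow> \<exists>a b. T = cbox a b" using division_ofD(4)[OF d] by blast
    show "\<And>T. T \<in> D \<Longrightarrow> interior k \<inter> interior T = {}"
      using division_ofD(5)[OF d, of k] insert.hyps(2) by auto
  qed
  moreover have "\<Union>(E k) \<subseteq> k" using Ek by (auto simp: divisions_in_def)
  ultimately have disj: "interior (\<Union>(E k)) \<inter> interior (\<Union>E') = {}"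
    using interior_mono[of "\<Union>(E k)" k] interior_mono[OF E'(2)] by blast
  have "E k \<union> E' \<in> divisions_in S"
    using increment_sum_Un(1)[OF Ek E'(1) disj] kS by (simp add: Un_absorb1)
  moreover have "\<Union>(E k \<union> E') \<subseteq> \<Union>(insert k D)" using E'(2) \<open>\<Union>(E k) \<subseteq> k\<close> by auto
  moreover have "\<forall>f. increment_sum f (E k \<union> E') = (\<Sum>k\<in>insert k D. increment_sum f (E k))"
    using increment_sum_Un(2)[OF Ek E'(1) disj] E'(3) insert.hyps by simp
  ultimately show ?case by blast
qed

lemma length_division_le:
  assumes "D \<in> divisions_in {a..b}" "a \<le> b"
  shows "total_length D \<le> b - a"
proof -
  have "(\<Sum>k\<in>D. Sup k - Inf k) = (\<Sum>k\<in>D. measure lborel k)"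
    by (intro sum.cong refl) (use divisions_in_interval[OF assms(1)] in \<open>force\<close>)
  also have "\<dots> \<le> measure lborel (cbox a b)"
    using assms(1) by (intro subadditive_content_division[of D "\<Union>D"]) (auto simp: divisions_in_def)
  finally show ?thesis using assms(2) by (simp add: increment_sum_def)
qed

text \<open>A function whose increments are controlled by those of two absolutely continuous functions is
  absolutely continuous. This covers differences, components and products.\<close>

lemma abs_continuous_on_dominated:
  assumes f: "abs_continuous_on {a..b} f" and g: "abs_continuous_on {a..b} g" and AB: "0 < A" "0 < B"
    and le: "\<And>x y. x \<in> {a..b} \<Longrightarrow> y \<in> {a..b} \<Longrightarrow>
      norm (h y - h x) \<le> A * norm (f y - f x) + B * norm (g y - g x)"
  shows "abs_continuous_on {a..b} h"
  unfolding abs_continuous_on_alt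
proof (intro allI impI)
  fix \<epsilon> :: real assume "\<epsilon> > 0"
  then have e: "\<epsilon> / 2 / A > 0" "\<epsilon> / 2 / B > 0" using AB by auto
  obtain \<delta> where \<delta>: "\<delta> > 0" "\<And>D. D \<in> divisions_in {a..b} \<Longrightarrow> total_length D < \<delta> \<Longrightarrow>
      (\<Sum>k\<in>D. norm (f (Sup k) - f (Inf k))) < \<epsilon> / 2 / A"
    using f e unfolding abs_continuous_on_alt by meson
  obtain \<delta>' where \<delta>': "\<delta>' > 0" "\<And>D. D \<in> divisions_in {a..b} \<Longrightarrow> total_length D < \<delta>' \<Longrightarrow>
      (\<Sum>k\<in>D. norm (g (Sup k) - g (Inf k))) < \<epsilon> / 2 / B"
    using g e unfolding abs_continuous_on_alt by meson
  have "(\<Sum>k\<in>D. norm (h (Sup k) - h (Inf k))) < \<epsilon>"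
    if D: "D \<in> divisions_in {a..b}" "total_length D < min \<delta> \<delta>'" for D
  proof -
    have "(\<Sum>k\<in>D. norm (h (Sup k) - h (Inf k))) \<le>
      (\<Sum>k\<in>D. A * norm (f (Sup k) - f (Inf k)) + B * norm (g (Sup k) - g (Inf k)))"
    proof (intro sum_mono)
      fix k assume "k \<in> D"
      then obtain l u where "l \<le> u" "Inf k = l" "Sup k = u" "{l..u} \<subseteq> {a..b}"
        using divisions_in_interval[OF D(1)] by metis
      then show "norm (h (Sup k) - h (Inf k)) \<le>
          A * norm (f (Sup k) - f (Inf k)) + B * norm (g (Sup k) - g (Inf k))"
        using le[of l u] by auto
    qed
    also have "\<dots> < \<epsilon> / 2 + \<epsilon> / 2"
      using \<delta>(2)[OF D(1)] \<delta>'(2)[OF D(1)] D(2) AB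
      unfolding sum.distrib sum_distrib_left[symmetric]
      by (intro add_strict_mono) (auto simp: field_simps)
    finally show ?thesis by simp
  qed
  then show "\<exists>\<delta>>0. \<forall>D\<in>divisions_in {a..b}. total_length D < \<delta> \<longrightarrow>
    (\<Sum>k\<in>D. norm (h (Sup k) - h (Inf k))) < \<epsilon>"
    using \<delta>(1) \<delta>'(1) by (intro exI[of _ "min \<delta> \<delta>'"]) auto
qed

lemma abs_continuous_on_cong:
  assumes eq: "\<And>x. x \<in> {a..b} \<Longrightarrow> f x = g x" and g: "abs_continuous_on {a..b} g"
  shows "abs_continuous_on {a..b} f"
  by (rule abs_continuous_on_dominated[OF g g, of 1 1]) (use eq in auto)

lemma abs_continuous_on_diff:
  assumes f: "abs_continuous_on {a..b} f" and g: "abs_continuous_on {a..b} g"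
  shows "abs_continuous_on {a..b} (\<lambda>x. f x - g x)"
proof (rule abs_continuous_on_dominated[OF f g, of 1 1])
  fix x y
  have *: "f y - g y - (f x - g x) = (f y - f x) - (g y - g x)" by simp
  show "norm (f y - g y - (f x - g x)) \<le> 1 * norm (f y - f x) + 1 * norm (g y - g x)"
    unfolding * mult_1_left by (rule norm_triangle_ineq4)
qed auto

lemma abs_continuous_on_inner_left:
  assumes f: "abs_continuous_on {a..b} f"
  shows "abs_continuous_on {a..b} (\<lambda>x. f x \<bullet> i)"
proof (rule abs_continuous_on_dominated[OF f f, of "norm i + 1" 1])
  fix x y
  have "\<bar>f y \<bullet> i - f x \<bullet> i\<bar> \<le> norm (f y - f x) * norm i"
    by (simp add: inner_diff_left[symmetric] Cauchy_Schwarz_ineq2)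
  also have "\<dots> \<le> (norm i + 1) * norm (f y - f x) + 1 * norm (f y - f x)" by (simp add: algebra_simps)
  finally show "norm (f y \<bullet> i - f x \<bullet> i) \<le> (norm i + 1) * norm (f y - f x) + 1 * norm (f y - f x)"
    by simp
qed (auto simp: add_nonneg_pos)

lemma abs_continuous_on_complex_of_real:
  assumes f: "abs_continuous_on {a..b} f"
  shows "abs_continuous_on {a..b} (\<lambda>x. complex_of_real (f x))"
  by (rule abs_continuous_on_dominated[OF f f, of 1 1]) (auto simp flip: of_real_diff)

text \<open>The positive variation on \<open>[a, b]\<close>: the supremum of the increments over finite families of
  non-overlapping subintervals.\<close>

definition pos_var :: "(real \<Rightarrow> real) \<Rightarrow> real \<Rightarrow> real \<Rightarrow> real" where
  "pos_var f a b = (SUP D\<in>divisions_in {a..b}. increment_sum f D)"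

text \<open>On an interval shorter than the \<open>\<delta>\<close> that belongs to \<open>\<epsilon> = 1\<close> the sums are at most \<open>1\<close>; cutting
  \<open>[a, b]\<close> into steps of length \<open>\<delta> / 2\<close> bounds them in general.\<close>

lemma abs_continuous_increment_sums_bounded:
  assumes ac: "abs_continuous_on {a..b} f"
  shows "bdd_above (increment_sum f ` divisions_in {a..b})"
proof -
  obtain \<delta> where \<delta>: "\<delta> > 0" "\<And>D. D \<in> divisions_in {a..b} \<Longrightarrow> total_length D < \<delta> \<Longrightarrow>
      (\<Sum>k\<in>D. norm (f (Sup k) - f (Inf k))) < 1"
    using ac unfolding abs_continuous_on_alt by (meson zero_less_one)
  have bd: "increment_sum f D \<le> real n" if "D \<in> divisions_in {a..c}" "c \<le> b" "c \<le> a + n * (\<delta> / 2)" for n c D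
    using that
  proof (induction n arbitrary: c D)
    case 0
    have "increment_sum f D = 0" unfolding increment_sum_def
    proof (intro sum.neutral ballI)
      fix k assume "k \<in> D"
      then obtain l u where lu: "l \<le> u" "Inf k = l" "Sup k = u" "{l..u} \<subseteq> {a..c}"
        using divisions_in_interval[OF 0(1)] by metis
      then have "l = u" using 0(3) by simp
      then show "f (Sup k) - f (Inf k) = 0" using lu by simp
    qed
    then show ?case by simp
  next
    case (Suc n)
    define x where "x = a + n * (\<delta> / 2)"
    show ?case
    proof (cases "c \<le> x")
      case True
      then show ?thesis using Suc.IH[of D c] Suc.prems by (simp add: x_def)
    next
      case False
      obtain D1 D2 where D12: "D1 \<in> divisions_in {a..x}" "D2 \<in> divisions_in {x..c}"
        "\<And>f. increment_sum f D = increment_sum f D1 + increment_sum f D2"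
        using cut_division[OF Suc.prems(1)] by blast
      have "increment_sum f D1 \<le> n" using D12(1) False Suc.prems by (intro Suc.IH[of D1 x]) (auto simp: x_def)
      moreover have "increment_sum f D2 \<le> 1"
      proof -
        have "a \<le> x" using \<delta>(1) by (simp add: x_def)
        then have "D2 \<in> divisions_in {a..b}"
          using D12(2) divisions_in_mono[of "{x..c}" "{a..b}"] Suc.prems by auto
        moreover have "total_length D2 \<le> c - x" using length_division_le[OF D12(2)] False by simp
        moreover have "c - x < \<delta>" using Suc.prems(3) \<delta>(1) by (simp add: x_def field_simps)
        ultimately have "(\<Sum>k\<in>D2. norm (f (Sup k) - f (Inf k))) < 1" by (intro \<delta>(2)) auto
        moreover have "increment_sum f D2 \<le> (\<Sum>k\<in>D2. norm (f (Sup k) - f (Inf k)))"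
          unfolding increment_sum_def by (intro sum_mono) auto
        ultimately show ?thesis by simp
      qed
      ultimately show ?thesis using D12(3) by simp
    qed
  qed
  obtain n :: nat where n: "(b - a) / (\<delta> / 2) \<le> n" using real_arch_simple by blast
  then have "b \<le> a + n * (\<delta> / 2)" using \<delta>(1) by (simp add: field_simps)
  then have "increment_sum f D \<le> n" if "D \<in> divisions_in {a..b}" for D
    using bd[OF that] by simp
  then show ?thesis by (intro bdd_aboveI[of _ "real n"]) auto
qed

lemma abs_continuous_on_subset: "abs_continuous_on S f \<Longrightarrow> T \<subseteq> S \<Longrightarrow> abs_continuous_on T f"
  unfolding abs_continuous_on_def by (meson order_trans)

lemma increment_sum_le_pos_var:
  assumes "abs_continuous_on {a..b} f" "D \<in> divisions_in {a..b}"
  shows "increment_sum f D \<le> pos_var f a b"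
  unfolding pos_var_def using assms(2) abs_continuous_increment_sums_bounded[OF assms(1)]
  by (intro cSUP_upper)

lemma pos_var_mono:
  assumes ac: "abs_continuous_on {a..b} f" and "x \<le> y" "y \<le> b"
  shows "pos_var f a x \<le> pos_var f a y"
  unfolding pos_var_def
proof (rule cSUP_subset_mono)
  show "bdd_above (increment_sum f ` divisions_in {a..y})"
    using assms by (intro abs_continuous_increment_sums_bounded abs_continuous_on_subset[OF ac]) auto
  show "divisions_in {a..x} \<subseteq> divisions_in {a..y}" using assms by (intro divisions_in_mono) auto
qed (use empty_in_divisions_in in auto)

lemma pos_var_increment:
  assumes ac: "abs_continuous_on {a..b} f" and "a \<le> x" "x \<le> y" "y \<le> b"
  shows "f y - f x \<le> pos_var f a y - pos_var f a x"
proof -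
  have "increment_sum f D \<le> pos_var f a y - (f y - f x)" if D: "D \<in> divisions_in {a..x}" for D
  proof -
    have s: "{{x..y}} \<in> divisions_in {x..y}" using assms by (intro single_in_divisions_in) auto
    have dj: "interior (\<Union>D) \<inter> interior (\<Union>{{x..y}}) = {}"
      using D by (intro disjoint_interiors_separated[of _ x]) (auto simp: divisions_in_def)
    have "D \<union> {{x..y}} \<in> divisions_in {a..y}"
      using increment_sum_Un(1)[OF D s dj] assms by (simp add: ivl_disj_un)
    then have "increment_sum f (D \<union> {{x..y}}) \<le> pos_var f a y"
      using assms by (intro increment_sum_le_pos_var abs_continuous_on_subset[OF ac]) auto
    then show ?thesis using increment_sum_Un(2)[OF D s dj, of f] increment_sum_single[of x y f] assms by simp
  qed
  then have "pos_var f a x \<le> pos_var f a y - (f y - f x)"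
    unfolding pos_var_def[of f a x] using empty_in_divisions_in by (intro cSUP_least) auto
  then show ?thesis by simp
qed

lemma pos_var_subadditive:
  assumes ac: "abs_continuous_on {a..b} f" and "a \<le> x" "x \<le> y" "y \<le> b"
  shows "pos_var f a y - pos_var f a x \<le> pos_var f x y"
proof -
  have "increment_sum f D \<le> pos_var f a x + pos_var f x y" if D: "D \<in> divisions_in {a..y}" for D
  proof -
    obtain D1 D2 where D12: "D1 \<in> divisions_in {a..x}" "D2 \<in> divisions_in {x..y}"
        "\<And>f. increment_sum f D = increment_sum f D1 + increment_sum f D2"
      using cut_division[OF D] by blast
    have "increment_sum f D1 \<le> pos_var f a x" "increment_sum f D2 \<le> pos_var f x y"
      using assms D12 by (auto intro!: increment_sum_le_pos_var abs_continuous_on_subset[OF ac])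
    then show ?thesis using D12(3) by simp
  qed
  then have "pos_var f a y \<le> pos_var f a x + pos_var f x y"
    unfolding pos_var_def[of f a y] using empty_in_divisions_in by (intro cSUP_least) auto
  then show ?thesis by simp
qed

text \<open>The increment of the positive variation over an interval \<open>k\<close> is nearly attained by a division of
  \<open>k\<close>. These divisions together have at most the total length of the original family.\<close>

lemma abs_continuous_on_pos_var:
  assumes ac: "abs_continuous_on {a..b} f"
  shows "abs_continuous_on {a..b} (pos_var f a)"
  unfolding abs_continuous_on_alt
proof (intro allI impI)
  fix \<epsilon> :: real assume "\<epsilon> > 0"
  then obtain \<delta> where \<delta>: "\<delta> > 0" "\<And>D. D \<in> divisions_in {a..b} \<Longrightarrow> total_length D < \<delta> \<Longrightarrow>
      (\<Sum>k\<in>D. norm (f (Sup k) - f (Inf k))) < \<epsilon> / 2"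
    using ac unfolding abs_continuous_on_alt by (meson half_gt_zero)
  have "(\<Sum>k\<in>D. norm (pos_var f a (Sup k) - pos_var f a (Inf k))) < \<epsilon>"
    if D: "D \<in> divisions_in {a..b}" and len: "total_length D < \<delta>" for D
  proof -
    have fin: "finite D" using D by (rule divisions_in_finite)
    define \<eta> where "\<eta> = \<epsilon> / 2 / (card D + 1)"
    have \<eta>: "\<eta> > 0" using \<open>\<epsilon> > 0\<close> by (simp add: \<eta>_def)
    have "\<exists>E. E \<in> divisions_in k \<and> pos_var f (Inf k) (Sup k) - \<eta> < increment_sum f E" if kD: "k \<in> D" for k
    proof -
      obtain l u where lu: "k = {l..u}" "l \<le> u" "Inf k = l" "Sup k = u" "{l..u} \<subseteq> {a..b}"
        using divisions_in_interval[OF D kD] by metis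
      have "bdd_above (increment_sum f ` divisions_in {l..u})"
        using lu by (intro abs_continuous_increment_sums_bounded abs_continuous_on_subset[OF ac])
      then have "\<exists>E\<in>divisions_in {l..u}. pos_var f l u - \<eta> < increment_sum f E"
        using \<eta> empty_in_divisions_in
          less_cSUP_iff[of "divisions_in {l..u}" "increment_sum f" "pos_var f l u - \<eta>"]
        by (fastforce simp: pos_var_def)
      then show ?thesis using lu by auto
    qed
    then obtain E where E: "\<And>k. k \<in> D \<Longrightarrow> E k \<in> divisions_in k"
       "\<And>k. k \<in> D \<Longrightarrow> pos_var f (Inf k) (Sup k) - \<eta> < increment_sum f (E k)" by metis
    obtain E' where E': "E' \<in> divisions_in {a..b}" "\<Union>E' \<subseteq> \<Union>D"
      "\<And>f. increment_sum f E' = (\<Sum>k\<in>D. increment_sum f (E k))"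
      using refine_division[OF fin D E(1)] by blast
    have "total_length E' \<le> total_length D"
      unfolding E'(3) increment_sum_def[of _ D]
    proof (intro sum_mono)
      fix k assume k: "k \<in> D"
      then obtain l u where lu: "k = {l..u}" "l \<le> u" "Inf k = l" "Sup k = u"
        using divisions_in_interval[OF D] by metis
      then show "total_length (E k) \<le> Sup k - Inf k"
        using length_division_le[of "E k" l u] E(1)[OF k] by simp
    qed
    then have "(\<Sum>k\<in>E'. norm (f (Sup k) - f (Inf k))) < \<epsilon> / 2"
      using \<delta>(2)[OF E'(1)] len by simp
    moreover have "increment_sum f E' \<le> (\<Sum>k\<in>E'. norm (f (Sup k) - f (Inf k)))"
      unfolding increment_sum_def by (intro sum_mono) auto
    ultimately have 1: "(\<Sum>k\<in>D. increment_sum f (E k)) < \<epsilon> / 2" using E'(3) by simp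
    have "(\<Sum>k\<in>D. norm (pos_var f a (Sup k) - pos_var f a (Inf k))) \<le> (\<Sum>k\<in>D. increment_sum f (E k) + \<eta>)"
    proof (intro sum_mono)
      fix k assume k: "k \<in> D"
      then obtain l u where lu: "k = {l..u}" "l \<le> u" "Inf k = l" "Sup k = u" "{l..u} \<subseteq> {a..b}"
        using divisions_in_interval[OF D] by metis
      then have *: "a \<le> l" "u \<le> b" by auto
      show "norm (pos_var f a (Sup k) - pos_var f a (Inf k)) \<le> increment_sum f (E k) + \<eta>"
        using pos_var_mono[OF ac lu(2) *(2)] pos_var_subadditive[OF ac *(1) lu(2) *(2)] E(2)[OF k] lu by auto
    qed
    also have "\<dots> = (\<Sum>k\<in>D. increment_sum f (E k)) + card D * \<eta>" by (simp add: sum.distrib)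
    also have "card D * \<eta> < \<epsilon> / 2" using \<open>\<epsilon> > 0\<close> by (simp add: \<eta>_def field_simps)
    finally show ?thesis using 1 by simp
  qed
  then show "\<exists>\<delta>>0. \<forall>D\<in>divisions_in {a..b}. total_length D < \<delta> \<longrightarrow>
    (\<Sum>k\<in>D. norm (pos_var f a (Sup k) - pos_var f a (Inf k))) < \<epsilon>" using \<delta>(1) by blast
qed

section \<open>Absolutely continuous functions are indefinite integrals\<close>

lemma abs_continuous_on_imp_continuous_on:
  assumes ac: "abs_continuous_on {a..b} f"
  shows "continuous_on {a..b} f"
  unfolding continuous_on_iff
proof (intro ballI allI impI)
  fix x \<epsilon> :: real assume x: "x \<in> {a..b}" and "\<epsilon> > 0"
  then obtain \<delta> where \<delta>: "\<delta> > 0" "\<And>D. D \<in> divisions_in {a..b} \<Longrightarrow> total_length D < \<delta> \<Longrightarrow>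
      (\<Sum>k\<in>D. norm (f (Sup k) - f (Inf k))) < \<epsilon>"
    using ac unfolding abs_continuous_on_alt by meson
  have *: "norm (f v - f u) < \<epsilon>" if "u \<le> v" "u \<in> {a..b}" "v \<in> {a..b}" "v - u < \<delta>" for u v
    using \<delta>(2)[OF single_in_divisions_in, of u v] that by (simp add: increment_sum_single)
  have "dist (f y) (f x) < \<epsilon>" if "y \<in> {a..b}" "dist y x < \<delta>" for y
    using *[of x y] *[of y x] that x
    by (cases "x \<le> y") (auto simp: dist_real_def dist_norm norm_minus_commute)
  with \<delta>(1) show "\<exists>d>0. \<forall>y\<in>{a..b}. dist y x < d \<longrightarrow> dist (f y) (f x) < \<epsilon>" by blast
qed

lemma length_division_le_emeasure:
  assumes D: "D \<in> divisions_in S" and U: "\<Union>D \<subseteq> U" "U \<in> sets lborel"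
  shows "ennreal (total_length D) \<le> emeasure lborel U"
proof -
  have fin: "finite D" using D by (rule divisions_in_finite)
  have nn: "Sup k - Inf k \<ge> 0" "emeasure lborel (interior k) = ennreal (Sup k - Inf k)" "interior k \<subseteq> U" if kD: "k \<in> D" for k
  proof -
    obtain l u where lu: "k = {l..u}" "l \<le> u" "Inf k = l" "Sup k = u"
      using divisions_in_interval[OF D kD] by metis
    then show "Sup k - Inf k \<ge> 0" "emeasure lborel (interior k) = ennreal (Sup k - Inf k)" by auto
    show "interior k \<subseteq> U" using kD U(1) interior_subset by blast
  qed
  have "ennreal (total_length D) = (\<Sum>k\<in>D. ennreal (Sup k - Inf k))"
    unfolding increment_sum_def using nn(1) by (simp add: sum_ennreal)
  also have "\<dots> = (\<Sum>k\<in>D. emeasure lborel (interior k))" using nn(2) by simp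
  also have "\<dots> = emeasure lborel (\<Union>k\<in>D. interior k)"
  proof (rule sum_emeasure)
    show "disjoint_family_on interior D"
      using D division_ofD(5)[of D "\<Union>D"] unfolding disjoint_family_on_def divisions_in_def by blast
  qed (use fin in auto)
  also have "\<dots> \<le> emeasure lborel U" using nn(3) U(2) by (intro emeasure_mono) auto
  finally show ?thesis .
qed

text \<open>A monotone absolutely continuous function generates a Stieltjes measure that is absolutely
  continuous with respect to Lebesgue measure.\<close>

lemma interval_measure_null:
  fixes F :: "real \<Rightarrow> real"
  assumes mono: "\<And>x y. x \<le> y \<Longrightarrow> F x \<le> F y" and cont: "continuous_on UNIV F"
    and ac: "abs_continuous_on {a..b} F"
    and A: "A \<in> null_sets lborel" "A \<subseteq> {a<..<b}"
  shows "emeasure (interval_measure F) A = 0"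
proof -
  let ?N = "interval_measure F"
  have As: "A \<in> sets borel" using A by auto
  have "emeasure ?N A \<le> 0 + ennreal \<epsilon>" if "\<epsilon> > 0" for \<epsilon>
  proof -
    obtain \<delta> where \<delta>: "\<delta> > 0" "\<And>D. D \<in> divisions_in {a..b} \<Longrightarrow> total_length D < \<delta> \<Longrightarrow>
        (\<Sum>k\<in>D. norm (F (Sup k) - F (Inf k))) < \<epsilon>"
      using ac \<open>\<epsilon> > 0\<close> unfolding abs_continuous_on_alt by meson
    obtain U where U: "open U" "A \<subseteq> U" "emeasure lborel (U - A) < ennreal \<delta>"
      using outer_regular_lborel[OF As \<delta>(1)] by blast
    define V where "V = U \<inter> {a<..<b}"
    have V: "open V" "A \<subseteq> V" "V \<subseteq> {a<..<b}" using U A by (auto simp: V_def)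
    have Vm: "V \<in> sets borel" using V(1) by simp
    have "emeasure lborel V \<le> emeasure lborel ((U - A) \<union> A)"
      using U As by (intro emeasure_mono) (auto simp: V_def)
    also have "\<dots> = emeasure lborel (U - A)"
      using U A As by (intro emeasure_Un_null_set) auto
    finally have V\<delta>: "emeasure lborel V < ennreal \<delta>" using U(3) by simp
    have fin: "emeasure ?N (\<Union>\<F>) \<le> \<epsilon>"
      if F: "finite \<F>" "\<And>k. k \<in> \<F> \<Longrightarrow> \<exists>l u. k = cbox l u" "\<Union>\<F> \<subseteq> V" for \<F>
    proof -
      obtain D where "D division_of (\<Union>\<F>)" using elementary_unions_intervals[OF F(1,2)] by blast
      then have "\<Union>D = \<Union>\<F>" "D division_of (\<Union>D)" by (auto simp: division_ofD(6))
      moreover have "\<Union>\<F> \<subseteq> {a..b}" using F(3) V(3) by force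
      ultimately have D: "D \<in> divisions_in {a..b}" "\<Union>D = \<Union>\<F>"
        by (auto simp: divisions_in_def)
      have "ennreal (total_length D) < ennreal \<delta>"
        using length_division_le_emeasure[OF D(1), of V] D(2) F(3) Vm V\<delta> by (auto intro: le_less_trans)
      then have "total_length D < \<delta>" by (metis ennreal_leI leD not_le)
      then have *: "(\<Sum>k\<in>D. norm (F (Sup k) - F (Inf k))) < \<epsilon>" by (intro \<delta>(2) D)
      have k: "k \<in> sets ?N" "emeasure ?N k = ennreal (norm (F (Sup k) - F (Inf k)))" if kD: "k \<in> D" for k
      proof -
        obtain l u where lu: "k = {l..u}" "l \<le> u" "Inf k = l" "Sup k = u"
          using divisions_in_interval[OF D(1) kD] by metis
        then show "k \<in> sets ?N" by simp
        show "emeasure ?N k = ennreal (norm (F (Sup k) - F (Inf k)))"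
          using emeasure_interval_measure_Icc[of l u F] lu mono cont mono[OF lu(2)] by simp
      qed
      have "emeasure ?N (\<Union>\<F>) = emeasure ?N (\<Union>k\<in>D. k)" using D(2) by simp
      also have "\<dots> \<le> (\<Sum>k\<in>D. emeasure ?N k)"
        using divisions_in_finite[OF D(1)] k(1) by (intro emeasure_subadditive_finite) auto
      also have "\<dots> = ennreal (\<Sum>k\<in>D. norm (F (Sup k) - F (Inf k)))"
        using k(2) by (simp add: sum_ennreal)
      also have "\<dots> \<le> ennreal \<epsilon>" using * by (intro ennreal_leI) simp
      finally show ?thesis .
    qed
    obtain \<D> where \<D>: "countable \<D>" "\<D> \<subseteq> Pow V" "\<And>X. X \<in> \<D> \<Longrightarrow> \<exists>l u. X = cbox l u" "\<Union>\<D> = V"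
      using open_countable_Union_open_cbox[OF V(1)] by blast
    have "emeasure ?N V \<le> \<epsilon>"
    proof (cases "\<D> = {}")
      case True
      then show ?thesis using \<D>(4) by simp
    next
      case False
      define d where "d = from_nat_into \<D>"
      have rd: "range d = \<D>" using False \<D>(1) by (simp add: d_def range_from_nat_into)
      have dD: "d i \<in> \<D>" for i using rd by auto
      have ds: "d i \<in> sets borel" for i using \<D>(3)[OF dD[of i]] by auto
      have "emeasure ?N V = emeasure ?N (\<Union>n. \<Union>i\<le>n. d i)"
        using \<D>(4) rd by (intro arg_cong[of _ _ "emeasure ?N"]) auto
      also have "\<dots> = (SUP n. emeasure ?N (\<Union>i\<le>n. d i))"
      proof (intro SUP_emeasure_incseq[symmetric])
        show "range (\<lambda>n. \<Union>i\<le>n. d i) \<subseteq> sets ?N" using ds by auto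
        show "incseq (\<lambda>n. \<Union>i\<le>n. d i)" by (intro monoI UN_mono) auto
      qed
      also have "\<dots> \<le> \<epsilon>"
      proof (rule SUP_least)
        fix n
        have "d ` {..n} \<subseteq> \<D>" using dD by auto
        then show "emeasure ?N (\<Union>i\<le>n. d i) \<le> ennreal \<epsilon>" using \<D>(2,3) by (intro fin) auto
      qed
      finally show ?thesis .
    qed
    moreover have "emeasure ?N A \<le> emeasure ?N V" using V Vm by (intro emeasure_mono) auto
    ultimately show ?thesis by simp
  qed
  then have "emeasure ?N A \<le> 0" by (rule ennreal_le_epsilon)
  then show ?thesis by simp
qed

text \<open>By the Radon-Nikodym theorem the Stieltjes measure of a monotone absolutely continuous function
  has a density with respect to Lebesgue measure.\<close>

lemma mono_abs_continuous_is_integral: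
  fixes G :: "real \<Rightarrow> real"
  assumes ab: "a \<le> b" and mono: "\<And>x y. a \<le> x \<Longrightarrow> x \<le> y \<Longrightarrow> y \<le> b \<Longrightarrow> G x \<le> G y"
    and ac: "abs_continuous_on {a..b} G"
  shows "\<exists>g. g absolutely_integrable_on {a..b} \<and> (\<forall>x\<in>{a..b}. integral {a..x} g = G x - G a)"
proof -
  define F where "F x = G (max a (min x b))" for x
  have F_mono: "F x \<le> F y" if "x \<le> y" for x y using that ab by (auto simp: F_def intro!: mono)
  have FG: "F x = G x" if "x \<in> {a..b}" for x using that by (simp add: F_def)
  have F_cont: "continuous_on UNIV F"
    unfolding F_def
    by (rule continuous_on_compose2[OF abs_continuous_on_imp_continuous_on[OF ac]])
       (use ab in \<open>auto intro!: continuous_intros\<close>)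
  have F_ac: "abs_continuous_on {a..b} F" by (rule abs_continuous_on_cong[OF FG ac])
  define N where "N = interval_measure F"
  have setsN: "sets N = sets borel" by (simp add: N_def)
  \<comment> \<open>Null sets are covered from outside by open sets, which have to stay inside \<open>[a, b]\<close>; the
    endpoints carry no mass.\<close>
  define N' where "N' = density N (indicator {a<..<b})"
  have N': "emeasure N' X = emeasure N ({a<..<b} \<inter> X)" if "X \<in> sets borel" for X
    unfolding N'_def using that by (intro emeasure_restricted) (auto simp: setsN)
  have "absolutely_continuous lborel N'"
    unfolding absolutely_continuous_def
  proof
    fix A assume A: "A \<in> null_sets (lborel :: real measure)"
    then have "A \<inter> {a<..<b} \<in> null_sets lborel" by (intro null_set_Int2) auto
    then have "emeasure N (A \<inter> {a<..<b}) = 0"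
      unfolding N_def by (intro interval_measure_null[OF F_mono F_cont F_ac]) auto
    then have "emeasure N' A = 0" using A by (subst N') (auto simp: Int_commute)
    then show "A \<in> null_sets N'" using A by (auto simp: null_sets_def N'_def setsN)
  qed
  moreover have "sets N' = sets lborel" by (simp add: N'_def setsN)
  ultimately obtain g' :: "real \<Rightarrow> ennreal" where g': "g' \<in> borel_measurable lborel" "density lborel g' = N'"
    using sigma_finite_measure.Radon_Nikodym[OF sigma_finite_lborel] by blast
  have N_Icc: "emeasure N {x..y} = F y - F x" if "x \<le> y" for x y
    unfolding N_def using that F_mono F_cont by (intro emeasure_interval_measure_Icc) auto
  have pt: "{x} \<in> null_sets N" for x
    using N_Icc[of x x] by (auto simp: null_sets_def setsN)
  have g'_int: "(\<integral>\<^sup>+t. g' t * indicator {a..x} t \<partial>lborel) = ennreal (G x - G a)" if x: "x \<in> {a..b}" for x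
  proof -
    have "(\<integral>\<^sup>+t. g' t * indicator {a..x} t \<partial>lborel) = emeasure N' {a..x}"
      using g' by (subst g'(2)[symmetric], subst emeasure_density) auto
    also have "\<dots> = emeasure N ({a<..<b} \<inter> {a..x})" by (rule N') simp
    also have "\<dots> = emeasure N (({a<..<b} \<inter> {a..x}) \<union> ({a} \<union> {b}))"
      by (intro emeasure_Un_null_set[symmetric] null_sets.Un pt) (auto simp: setsN)
    also have "\<dots> = emeasure N ({a..x} \<union> {b})"
      using x by (intro arg_cong[of _ _ "emeasure N"]) auto
    also have "\<dots> = emeasure N {a..x}"
      by (intro emeasure_Un_null_set pt) (auto simp: setsN)
    also have "\<dots> = ennreal (G x - G a)" using N_Icc[of a x] x ab FG[of a] FG[of x] by simp
    finally show ?thesis .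
  qed
  define g where "g t = enn2real (g' t) * indicator {a..b} t" for t
  have g_meas: "g \<in> borel_measurable borel" using g'(1) unfolding g_def by simp
  have "AE t in lborel. g' t * indicator {a..b} t \<noteq> \<infinity>"
    using g'_int[of b] ab g'(1) by (intro nn_integral_noteq_infinite) auto
  then have fin: "AE t in lborel. t \<in> {a..b} \<longrightarrow> g' t < \<infinity>"
    by eventually_elim (auto simp: indicator_def less_top[symmetric])
  have g_int: "((\<lambda>t. g t * indicator {a..x} t) has_integral (G x - G a)) UNIV" if x: "x \<in> {a..b}" for x
  proof (rule nn_integral_has_integral)
    show "(\<lambda>t. g t * indicator {a..x} t) \<in> borel_measurable borel" using g_meas by simp
    show "0 \<le> g t * indicator {a..x} t" for t by (simp add: g_def)
    show "0 \<le> G x - G a" using mono[of a x] x by simp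
    have "(\<integral>\<^sup>+t. ennreal (g t * indicator {a..x} t) \<partial>lborel) = (\<integral>\<^sup>+t. g' t * indicator {a..x} t \<partial>lborel)"
      by (intro nn_integral_cong_AE, use fin in eventually_elim)
         (use x in \<open>auto simp: g_def indicator_def\<close>)
    then show "(\<integral>\<^sup>+t. ennreal (g t * indicator {a..x} t) \<partial>lborel) = ennreal (G x - G a)"
      using g'_int[OF x] by simp
  qed
  have g_int': "(g has_integral (G x - G a)) {a..x}" if x: "x \<in> {a..b}" for x
  proof -
    have "(\<lambda>t. g t * indicator {a..x} t) = (\<lambda>t. if t \<in> {a..x} then g t else 0)" by (auto simp: indicator_def)
    then show ?thesis using g_int[OF x] has_integral_restrict_UNIV[of "{a..x}" g] by simp
  qed
  have "g absolutely_integrable_on {a..b}"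
    using g_int'[of b] ab by (intro nonnegative_absolutely_integrable_1) (auto simp: g_def)
  then show ?thesis using g_int' by (intro exI[of _ g]) auto
qed

lemma abs_continuous_is_integral_real:
  fixes f :: "real \<Rightarrow> real"
  assumes ab: "a \<le> b" and ac: "abs_continuous_on {a..b} f"
  shows "\<exists>g. g absolutely_integrable_on {a..b} \<and> (\<forall>x\<in>{a..b}. integral {a..x} g = f x - f a)"
proof -
  \<comment> \<open>\<open>f\<close> is the difference of the monotone functions \<open>P\<close> and \<open>P - f\<close>.\<close>
  let ?P = "pos_var f a"
  have acP: "abs_continuous_on {a..b} ?P" by (rule abs_continuous_on_pos_var[OF ac])
  obtain p where p: "p absolutely_integrable_on {a..b}" "\<And>x. x \<in> {a..b} \<Longrightarrow> integral {a..x} p = ?P x - ?P a"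
    using mono_abs_continuous_is_integral[OF ab _ acP] pos_var_mono[OF ac] by blast
  have "\<exists>q. q absolutely_integrable_on {a..b} \<and> (\<forall>x\<in>{a..b}. integral {a..x} q = (?P x - f x) - (?P a - f a))"
    using pos_var_increment[OF ac]
    by (intro mono_abs_continuous_is_integral ab abs_continuous_on_diff acP ac) (force simp: algebra_simps)
  then obtain q where q: "q absolutely_integrable_on {a..b}"
    "\<And>x. x \<in> {a..b} \<Longrightarrow> integral {a..x} q = (?P x - f x) - (?P a - f a)" by blast
  have "integral {a..x} (\<lambda>t. p t - q t) = f x - f a" if x: "x \<in> {a..b}" for x
  proof -
    have "p integrable_on {a..x}" "q integrable_on {a..x}"
      using p(1) q(1) x by (auto intro: integrable_subinterval_real dest!: set_lebesgue_integral_eq_integral(1))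
    then show ?thesis using p(2)[OF x] q(2)[OF x] by (simp add: Henstock_Kurzweil_Integration.integral_diff)
  qed
  moreover have "(\<lambda>t. p t - q t) absolutely_integrable_on {a..b}"
    using p(1) q(1) by (intro set_integral_diff) auto
  ultimately show ?thesis by blast
qed

theorem abs_continuous_is_integral:
  fixes f :: "real \<Rightarrow> 'a::euclidean_space"
  assumes ab: "a \<le> b" and ac: "abs_continuous_on {a..b} f"
  shows "\<exists>g. g absolutely_integrable_on {a..b} \<and> (\<forall>x\<in>{a..b}. integral {a..x} g = f x - f a)"
proof -
  have "\<forall>i. \<exists>g. g absolutely_integrable_on {a..b} \<and> (\<forall>x\<in>{a..b}. integral {a..x} g = f x \<bullet> i - f a \<bullet> i)"
    using abs_continuous_is_integral_real[OF ab abs_continuous_on_inner_left[OF ac]] by blast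
  then obtain G where G: "\<And>i. G i absolutely_integrable_on {a..b}"
    "\<And>i x. x \<in> {a..b} \<Longrightarrow> integral {a..x} (G i) = f x \<bullet> i - f a \<bullet> i" by metis
  define g where "g t = (\<Sum>i\<in>Basis. G i t *\<^sub>R i)" for t
  have "(\<lambda>t. G i t *\<^sub>R i) absolutely_integrable_on {a..b}" for i :: 'a
    by (rule absolutely_integrable_scaleR_right[OF G(1)])
  then have "g absolutely_integrable_on {a..b}"
    unfolding g_def by (intro absolutely_integrable_sum) auto
  moreover have "integral {a..x} g = f x - f a" if x: "x \<in> {a..b}" for x
  proof -
    have Gi: "G i integrable_on {a..x}" for i
      using x by (intro integrable_subinterval_real[OF set_lebesgue_integral_eq_integral(1)[OF G(1)]]) auto
    have "((\<lambda>t. \<Sum>i\<in>Basis. G i t *\<^sub>R i) has_integral (\<Sum>i\<in>Basis. (f x \<bullet> i - f a \<bullet> i) *\<^sub>R i)) {a..x}"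
      using Gi G(2)[OF x] by (intro has_integral_sum has_integral_scaleR_left) (auto simp: has_integral_iff)
    then show ?thesis unfolding g_def
      by (simp add: integral_unique inner_diff_left[symmetric] euclidean_representation)
  qed
  ultimately show ?thesis by blast
qed

section \<open>The fundamental theorem of calculus\<close>

lemma absolutely_integrable_spike_AE:
  fixes f g :: "real \<Rightarrow> 'a::euclidean_space"
  assumes "AE x\<in>{a<..<b} in lebesgue. g x = f x" "f absolutely_integrable_on {a..b}"
  shows "g absolutely_integrable_on {a..b}"
proof -
  obtain N where N: "negligible N" "{x. \<not> (x \<in> {a<..<b} \<longrightarrow> g x = f x)} \<subseteq> N"
    using assms(1) unfolding eventually_ae_filter_negligible by blast
  show ?thesis
    using assms(2)
  proof (rule absolutely_integrable_spike)
    show "negligible (N \<union> {a, b})" using N by simp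
    fix x assume x: "x \<in> {a..b} - (N \<union> {a, b})"
    then have "x \<notin> {x. \<not> (x \<in> {a<..<b} \<longrightarrow> g x = f x)}" using N(2) by blast
    then show "g x = f x" using x by auto
  qed
qed

lemma integral_spike_AE:
  fixes f g :: "real \<Rightarrow> 'a::euclidean_space"
  assumes "AE x\<in>{a<..<b} in lebesgue. g x = f x"
  shows "integral {a..b} f = integral {a..b} g"
proof -
  obtain N where N: "negligible N" "{x. \<not> (x \<in> {a<..<b} \<longrightarrow> g x = f x)} \<subseteq> N"
    using assms(1) unfolding eventually_ae_filter_negligible by blast
  show ?thesis
  proof (rule integral_spike)
    show "negligible (N \<union> {a, b})" using N by simp
    fix x assume x: "x \<in> {a..b} - (N \<union> {a, b})"
    then have "x \<notin> {x. \<not> (x \<in> {a<..<b} \<longrightarrow> g x = f x)}" using N(2) by blast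
    then show "g x = f x" using x by auto
  qed
qed

lemma has_vector_derivative_integral_AE:
  fixes g :: "real \<Rightarrow> 'a::euclidean_space"
  assumes g: "g integrable_on {a..b}" and f: "\<And>x. x \<in> {a..b} \<Longrightarrow> f x = f a + integral {a..x} g"
  shows "AE x\<in>{a<..<b} in lebesgue. (f has_vector_derivative g x) (at x)"
  using Lebesgue_differentiation[OF g]
proof eventually_elim
  case (elim x)
  show ?case
  proof
    assume x: "x \<in> {a<..<b}"
    with elim have "((\<lambda>x. f a + integral {a..x} g) has_vector_derivative 0 + g x) (at x)"
      by (intro has_vector_derivative_add has_vector_derivative_const) auto
    then have "((\<lambda>x. f a + integral {a..x} g) has_vector_derivative g x) (at x)" by simp
    then show "(f has_vector_derivative g x) (at x)"
      by (rule has_vector_derivative_transform_within_open[of _ _ _ "{a<..<b}"])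
         (use x in \<open>auto simp: f[symmetric]\<close>)
  qed
qed

text \<open>The fundamental theorem of calculus for absolutely continuous functions.\<close>

theorem abs_continuous_FTC:
  fixes f :: "real \<Rightarrow> 'a::euclidean_space"
  assumes ab: "a \<le> b" and ac: "abs_continuous_on {a..b} f"
  shows "AE x\<in>{a<..<b} in lebesgue. (f has_vector_derivative vector_derivative f (at x)) (at x)"
    and "(\<lambda>x. vector_derivative f (at x)) absolutely_integrable_on {a..b}"
    and "\<And>x y. a \<le> x \<Longrightarrow> x \<le> y \<Longrightarrow> y \<le> b \<Longrightarrow> integral {x..y} (\<lambda>x. vector_derivative f (at x)) = f y - f x"
proof -
  obtain g where g: "g absolutely_integrable_on {a..b}" "\<And>x. x \<in> {a..b} \<Longrightarrow> integral {a..x} g = f x - f a"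
    using abs_continuous_is_integral[OF ab ac] by blast
  have gi: "g integrable_on {a..b}" using g(1) by (rule set_lebesgue_integral_eq_integral(1))
  have der: "AE x\<in>{a<..<b} in lebesgue. (f has_vector_derivative g x) (at x)"
    by (rule has_vector_derivative_integral_AE[OF gi]) (simp add: g(2))
  then have eq: "AE x\<in>{a<..<b} in lebesgue. vector_derivative f (at x) = g x"
    by eventually_elim (auto simp: vector_derivative_at)
  show "AE x\<in>{a<..<b} in lebesgue. (f has_vector_derivative vector_derivative f (at x)) (at x)"
    using der by eventually_elim (auto simp: vector_derivative_at)
  show "(\<lambda>x. vector_derivative f (at x)) absolutely_integrable_on {a..b}"
    using absolutely_integrable_spike_AE[OF eq g(1)] .
  fix x y assume xy: "a \<le> x" "x \<le> y" "y \<le> b"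
  have "integral {x..y} (\<lambda>x. vector_derivative f (at x)) = integral {x..y} g"
    by (rule integral_spike_AE, use eq in eventually_elim) (use xy in auto)
  also have "\<dots> = integral {a..y} g - integral {a..x} g"
    using Henstock_Kurzweil_Integration.integral_combine[of a x y g] xy integrable_subinterval_real[OF gi, of a y]
    by (simp add: algebra_simps)
  also have "\<dots> = f y - f x" using g(2)[of x] g(2)[of y] xy by simp
  finally show "integral {x..y} (\<lambda>x. vector_derivative f (at x)) = f y - f x" .
qed

text \<open>The absolute continuity of the integral: truncate \<open>norm g\<close> at a level \<open>n\<close> beyond which its
  integral is small.\<close>

lemma abs_continuous_on_integral:
  fixes g :: "real \<Rightarrow> 'a::euclidean_space"
  assumes g: "g absolutely_integrable_on {a..b}"
  shows "abs_continuous_on {a..b} (\<lambda>x. c + integral {a..x} g)"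
  unfolding abs_continuous_on_alt
proof (intro allI impI)
  fix \<epsilon> :: real assume \<epsilon>: "\<epsilon> > 0"
  define p where "p x = norm (g x)" for x
  have gi: "g integrable_on {a..b}" and pi: "p integrable_on {a..b}"
    using g unfolding p_def absolutely_integrable_on_def by auto
  have p0: "p x \<ge> 0" for x by (simp add: p_def)
  have pa: "p absolutely_integrable_on {a..b}" unfolding p_def by (rule set_integrable_norm[OF g])
  define q where "q n x = p x - min (p x) (real n)" for n x
  have mi: "(\<lambda>x. min (p x) (real n)) absolutely_integrable_on {a..b}" for n
    by (intro absolutely_integrable_min_1 pa) (auto intro: absolutely_integrable_on_const)
  have mi': "(\<lambda>x. min (p x) (real n)) integrable_on {a..b}" for n
    using mi by (rule set_lebesgue_integral_eq_integral(1))
  have qi: "q n integrable_on {a..b}" for n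
    unfolding q_def by (intro integrable_diff pi mi')
  have "(\<lambda>n. integral {a..b} (q n)) \<longlonglongrightarrow> integral {a..b} (\<lambda>x. 0)"
  proof (rule dominated_convergence(2)[OF qi pi])
    show "norm (q n x) \<le> p x" for n x using p0[of x] by (auto simp: q_def)
    show "(\<lambda>n. q n x) \<longlonglongrightarrow> 0" for x
    proof (rule tendsto_eventually)
      obtain m :: nat where "p x \<le> m" using real_arch_simple by blast
      then show "\<forall>\<^sub>F n in sequentially. q n x = 0"
        by (intro eventually_sequentiallyI[of m]) (auto simp: q_def)
    qed
  qed
  then have "\<forall>\<^sub>F n in sequentially. integral {a..b} (q n) < \<epsilon> / 2"
    using \<epsilon> by (intro order_tendstoD(2)) auto
  then obtain n where n: "integral {a..b} (q n) < \<epsilon> / 2" by (auto simp: eventually_sequentially)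
  define \<delta> where "\<delta> = \<epsilon> / 2 / (real n + 1)"
  have "\<delta> > 0" using \<epsilon> by (simp add: \<delta>_def)
  moreover have "(\<Sum>k\<in>D. norm ((c + integral {a..Sup k} g) - (c + integral {a..Inf k} g))) < \<epsilon>"
    if D: "D \<in> divisions_in {a..b}" and len: "total_length D < \<delta>" for D
  proof -
    have "(\<Sum>k\<in>D. norm ((c + integral {a..Sup k} g) - (c + integral {a..Inf k} g)))
      \<le> (\<Sum>k\<in>D. n * (Sup k - Inf k) + integral k (q n))"
    proof (intro sum_mono)
      fix k assume "k \<in> D"
      then obtain l u where lu: "k = {l..u}" "l \<le> u" "Inf k = l" "Sup k = u" "{l..u} \<subseteq> {a..b}"
        using divisions_in_interval[OF D] by metis
      have sub: "h integrable_on {l..u}" if "h integrable_on {a..b}" for h :: "real \<Rightarrow> 'b::euclidean_space"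
        using that lu(5) by (rule integrable_subinterval_real)
      have "integral {a..u} g - integral {a..l} g = integral {l..u} g"
        using Henstock_Kurzweil_Integration.integral_combine[of a l u g] lu integrable_subinterval_real[OF gi, of a u]
        by (simp add: algebra_simps)
      then have "norm ((c + integral {a..Sup k} g) - (c + integral {a..Inf k} g)) = norm (integral {l..u} g)"
        using lu by simp
      also have "\<dots> \<le> integral {l..u} p"
        by (rule integral_norm_bound_integral) (auto intro: sub gi pi simp: p_def)
      also have "\<dots> = integral {l..u} (\<lambda>x. min (p x) (real n)) + integral {l..u} (q n)"
        unfolding q_def using sub[OF pi] sub[OF mi'] by (simp add: Henstock_Kurzweil_Integration.integral_diff)
      also have "integral {l..u} (\<lambda>x. min (p x) (real n)) \<le> integral {l..u} (\<lambda>x. real n)"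
        by (intro integral_le sub[OF mi']) auto
      finally show "norm ((c + integral {a..Sup k} g) - (c + integral {a..Inf k} g))
        \<le> n * (Sup k - Inf k) + integral k (q n)" using lu by (simp add: mult.commute)
    qed
    also have "\<dots> = n * total_length D + (\<Sum>k\<in>D. integral k (q n))"
      by (simp add: increment_sum_def sum.distrib sum_distrib_left)
    also have "(\<Sum>k\<in>D. integral k (q n)) = integral (\<Union>D) (q n)"
    proof (rule integral_combine_division_topdown[symmetric])
      show "D division_of \<Union>D" using D by (simp add: divisions_in_def)
      then show "q n integrable_on \<Union>D"
        using qi D by (intro integrable_on_subdivision[of D "\<Union>D" "q n" "{a..b}"]) (auto simp: divisions_in_def)
    qed
    also have "\<dots> \<le> integral {a..b} (q n)"
    proof (rule integral_subset_le)
      show "\<Union>D \<subseteq> {a..b}" using D by (simp add: divisions_in_def)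
      show "q n integrable_on \<Union>D"
        using qi D by (intro integrable_on_subdivision[of D "\<Union>D" "q n" "{a..b}"]) (auto simp: divisions_in_def)
    qed (use qi in \<open>auto simp: q_def\<close>)
    also have "n * total_length D \<le> n * \<delta>" using len by (intro mult_left_mono) auto
    also have "n * \<delta> \<le> \<epsilon> / 2" using \<epsilon> by (simp add: \<delta>_def field_simps)
    finally show ?thesis using n by simp
  qed
  ultimately show "\<exists>\<delta>>0. \<forall>D\<in>divisions_in {a..b}. total_length D < \<delta> \<longrightarrow>
      (\<Sum>k\<in>D. norm ((c + integral {a..Sup k} g) - (c + integral {a..Inf k} g))) < \<epsilon>" by blast
qed

lemma abs_continuous_on_inner:
  fixes f g :: "real \<Rightarrow> 'a::euclidean_space"
  assumes f: "abs_continuous_on {a..b} f" and g: "abs_continuous_on {a..b} g"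
  shows "abs_continuous_on {a..b} (\<lambda>x. f x \<bullet> g x)"
proof -
  have "bounded (f ` {a..b})" "bounded (g ` {a..b})"
    using assms by (auto intro!: compact_imp_bounded compact_continuous_image abs_continuous_on_imp_continuous_on)
  then obtain A B where A: "A > 0" "\<And>x. x \<in> {a..b} \<Longrightarrow> norm (f x) \<le> A"
    and B: "B > 0" "\<And>x. x \<in> {a..b} \<Longrightarrow> norm (g x) \<le> B"
    unfolding bounded_pos by auto
  show ?thesis
  proof (rule abs_continuous_on_dominated[OF f g B(1) A(1)])
    fix x y assume xy: "x \<in> {a..b}" "y \<in> {a..b}"
    have "f y \<bullet> g y - f x \<bullet> g x = (f y - f x) \<bullet> g y + f x \<bullet> (g y - g x)"
      by (simp add: inner_diff_left inner_diff_right)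
    then have "norm (f y \<bullet> g y - f x \<bullet> g x) \<le> norm ((f y - f x) \<bullet> g y) + norm (f x \<bullet> (g y - g x))"
      by (metis norm_triangle_ineq)
    also have "\<dots> \<le> norm (f y - f x) * norm (g y) + norm (f x) * norm (g y - g x)"
      by (intro add_mono) (auto simp: Cauchy_Schwarz_ineq2)
    also have "\<dots> \<le> norm (f y - f x) * B + A * norm (g y - g x)"
      using A(2)[OF xy(1)] B(2)[OF xy(2)] by (intro add_mono mult_left_mono mult_right_mono) auto
    finally show "norm (f y \<bullet> g y - f x \<bullet> g x) \<le> B * norm (f y - f x) + A * norm (g y - g x)"
      by (simp add: mult.commute)
  qed
qed

section \<open>Integrals over \<open>[0, b)\<close>\<close>

lemma AE_subset:
  assumes "AE x\<in>S in lebesgue. P x" "T \<subseteq> S"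
  shows "AE x\<in>T in lebesgue. P x"
  using assms(1) by eventually_elim (use assms(2) in auto)

lemma integral_mono_AE_interval:
  fixes f g :: "real \<Rightarrow> real"
  assumes "f integrable_on {a..b}" "g integrable_on {a..b}"
    and "AE x\<in>{a<..<b} in lebesgue. f x \<le> g x"
  shows "integral {a..b} f \<le> integral {a..b} g"
proof -
  define f' where "f' x = min (f x) (g x)" for x
  have eq: "AE x\<in>{a<..<b} in lebesgue. f' x = f x"
    using assms(3) by eventually_elim (auto simp: f'_def)
  have eq2: "integral {a..b} f = integral {a..b} f'" by (rule integral_spike_AE[OF eq])
  obtain N where N: "negligible N" "{x. \<not> (x \<in> {a<..<b} \<longrightarrow> f' x = f x)} \<subseteq> N"
    using eq unfolding eventually_ae_filter_negligible by blast
  have "f' integrable_on {a..b}"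
    using assms(1)
  proof (rule integrable_spike)
    show "negligible (N \<union> {a, b})" using N by simp
    fix x assume x: "x \<in> {a..b} - (N \<union> {a, b})"
    then have "x \<notin> {x. \<not> (x \<in> {a<..<b} \<longrightarrow> f' x = f x)}" using N(2) by blast
    then show "f' x = f x" using x by auto
  qed
  then have "integral {a..b} f' \<le> integral {a..b} g"
    using assms(2) by (rule integral_le) (simp add: f'_def)
  with eq2 show ?thesis by simp
qed

lemma integral_nonneg_AE_interval:
  fixes f :: "real \<Rightarrow> real"
  assumes "f integrable_on {a..b}" "AE x\<in>{a<..<b} in lebesgue. 0 \<le> f x"
  shows "0 \<le> integral {a..b} f"
  using integral_mono_AE_interval[OF integrable_0 assms(1), of] assms(2) by simp

text \<open>The half-open interval \<open>[0, b)\<close>.\<close>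

definition half_open :: "ereal \<Rightarrow> real set" where
  "half_open b = {x. 0 \<le> x \<and> ereal x < b}"

lemma half_open_0: "0 < b \<Longrightarrow> 0 \<in> half_open b"
  by (simp add: half_open_def zero_ereal_def)

lemma half_open_le: "x \<in> half_open b \<Longrightarrow> 0 \<le> y \<Longrightarrow> y \<le> x \<Longrightarrow> y \<in> half_open b"
  by (auto simp: half_open_def) (meson ereal_less_eq(3) le_less_trans)

lemma half_open_bound:
  assumes "0 < b" "x \<in> half_open b"
  obtains c where "0 < c" "x < c" "ereal c < b"
proof -
  obtain c where "ereal x < ereal c" "ereal c < b"
    using assms ereal_dense2[of "ereal x" b] by (auto simp: half_open_def)
  then show ?thesis using that[of c] assms by (auto simp: half_open_def)
qed

lemma einterval_subset_half_open: "einterval 0 b \<subseteq> half_open b"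
  by (auto simp: half_open_def einterval_iff)

lemma Ioo_subset_einterval: "0 \<le> x \<Longrightarrow> y \<in> half_open b \<Longrightarrow> {x<..<y} \<subseteq> einterval 0 b"
  by (auto simp: half_open_def einterval_iff intro: less_trans)
     (meson ereal_less_eq(3) le_less_trans less_imp_le)

lemma AE_einterval_Ioo:
  assumes "AE x\<in>einterval 0 b in lebesgue. P x" "0 \<le> x" "y \<in> half_open b"
  shows "AE t\<in>{x<..<y} in lebesgue. P t"
  using AE_subset[OF assms(1) Ioo_subset_einterval[OF assms(2,3)]] .

lemma einterval_0_approx:
  assumes "0 < b"
  obtains l u :: "nat \<Rightarrow> real" where "einterval 0 b = (\<Union>i. {l i..u i})"
    "incseq u" "decseq l" "\<And>i. l i < u i" "\<And>i. 0 < l i" "\<And>i. u i \<in> half_open b"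
proof -
  obtain u l :: "nat \<Rightarrow> real" where *: "einterval 0 b = (\<Union>i. {l i..u i})"
    "incseq u" "decseq l" "\<And>i. l i < u i" "\<And>i. 0 < ereal (l i)" "\<And>i. ereal (u i) < b"
    by (rule einterval_Icc_approximation[OF assms]) (rule that)
  have "0 < l i" "0 \<le> u i" for i
    using *(4,5)[of i] by (auto simp: zero_ereal_def)
  with * show ?thesis by (intro that[of l u]) (auto simp: half_open_def)
qed

text \<open>A property that holds almost everywhere on each \<open>(0, c)\<close> with \<open>c < b\<close> does so on \<open>(0, b)\<close>, which is
  a countable union of such intervals.\<close>

lemma AE_einterval_if_local:
  assumes b: "0 < b" and "\<And>c. 0 < c \<Longrightarrow> ereal c < b \<Longrightarrow> AE x\<in>{0<..<c} in lebesgue. P x"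
  shows "AE x\<in>einterval 0 b in lebesgue. P x"
proof -
  obtain l u :: "nat \<Rightarrow> real" where lu: "einterval 0 b = (\<Union>i. {l i..u i})"
    "incseq u" "decseq l" "\<And>i. l i < u i" "\<And>i. 0 < l i" "\<And>i. u i \<in> half_open b"
    using einterval_0_approx[OF b] by blast
  have "AE x\<in>{l i..u i} in lebesgue. P x" for i
  proof -
    obtain c where c: "0 < c" "u i < c" "ereal c < b" using half_open_bound[OF b lu(6)] by metis
    show ?thesis using assms(2)[OF c(1,3)]
      by (rule AE_subset) (use c lu(5)[of i] in auto)
  qed
  then have "AE x in lebesgue. \<forall>i. x \<in> {l i..u i} \<longrightarrow> P x" by (simp only: AE_all_countable) simp
  then show ?thesis by eventually_elim (auto simp: lu(1))
qed

lemma L1_loc_imp_absolutely_integrable: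
  assumes "0 < b" "L1_loc b \<phi>" "0 \<le> x" "y \<in> half_open b"
  shows "\<phi> absolutely_integrable_on {x..y}"
proof -
  obtain c where c: "0 < c" "y < c" "ereal c < b" using half_open_bound[OF assms(1,4)] by metis
  then have "\<phi> absolutely_integrable_on {0..c}" using assms(2) by (simp add: L1_loc_def)
  then show ?thesis by (rule absolutely_integrable_on_subinterval) (use c assms in auto)
qed

lemma L1_loc_imp_integrable:
  assumes "0 < b" "L1_loc b \<phi>" "0 \<le> x" "y \<in> half_open b"
  shows "\<phi> integrable_on {x..y}"
  using L1_loc_imp_absolutely_integrable[OF assms] by (rule set_lebesgue_integral_eq_integral(1))

lemma L1_imp_L1_loc:
  assumes "L1 b \<phi>"
  shows "L1_loc b \<phi>"
  unfolding L1_loc_def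
proof (intro allI impI)
  fix c :: real assume c: "0 < c" "ereal c < b"
  have "\<phi> absolutely_integrable_on {0<..<c}"
    using assms unfolding L1_def
    by (rule set_integrable_subset) (use c Ioo_subset_einterval[of 0 c b] in \<open>auto simp: half_open_def\<close>)
  then show "\<phi> absolutely_integrable_on {0..c}" by (simp add: absolutely_integrable_on_Icc_iff_Ioo)
qed

lemma L1_loc_measurable:
  assumes b: "0 < b" and "L1_loc b \<phi>"
  shows "(\<lambda>x. indicator (einterval 0 b) x *\<^sub>R \<phi> x) \<in> borel_measurable lebesgue"
proof -
  obtain l u :: "nat \<Rightarrow> real" where lu: "einterval 0 b = (\<Union>i. {l i..u i})"
    "incseq u" "decseq l" "\<And>i. l i < u i" "\<And>i. 0 < l i" "\<And>i. u i \<in> half_open b"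
    using einterval_0_approx[OF b] by blast
  have m: "(\<lambda>x. indicator {l i..u i} x *\<^sub>R \<phi> x) \<in> borel_measurable lebesgue" for i
    using L1_loc_imp_absolutely_integrable[OF assms, of "l i" "u i"] lu(5)[of i] lu(6)[of i]
    by (auto simp: set_integrable_def)
  show ?thesis
  proof (rule borel_measurable_LIMSEQ_real[OF _ m])
    fix x
    show "(\<lambda>i. indicat_real {l i..u i} x *\<^sub>R \<phi> x) \<longlonglongrightarrow> indicat_real (einterval 0 b) x *\<^sub>R \<phi> x"
    proof (cases "x \<in> einterval 0 b")
      case True
      then obtain n where n: "x \<in> {l n..u n}" using lu(1) by auto
      have "x \<in> {l i..u i}" if "n \<le> i" for i
        using n incseqD[OF lu(2) that] decseqD[OF lu(3) that] by auto
      then show ?thesis using True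
        by (intro tendsto_eventually eventually_sequentiallyI[of n]) (auto simp: indicator_def)
    next
      case False
      then have "x \<notin> {l i..u i}" for i using lu(1) by blast
      then have "indicat_real {l i..u i} x = 0" for i using indicator_simps(2) by metis
      then show ?thesis using False by simp
    qed
  qed
qed

lemma set_nn_integral_Icc:
  fixes \<phi> :: "real \<Rightarrow> real"
  assumes "\<phi> absolutely_integrable_on {x..y}" "AE t\<in>{x<..<y} in lebesgue. 0 \<le> \<phi> t"
  shows "(\<integral>\<^sup>+t\<in>{x..y}. ennreal (\<phi> t) \<partial>lebesgue) = ennreal (integral {x..y} \<phi>)"
proof -
  have xy: "AE t in lebesgue. t \<noteq> x \<and> t \<noteq> y"
    by (auto simp: eventually_ae_filter_negligible intro!: exI[of _ "{x, y}"])
  have "(\<integral>\<^sup>+t\<in>{x..y}. ennreal (\<phi> t) \<partial>lebesgue) = (\<integral>\<^sup>+t. ennreal (indicator {x..y} t *\<^sub>R \<phi> t) \<partial>lebesgue)"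
    by (intro nn_integral_cong) (auto simp: indicator_def)
  also have "\<dots> = ennreal (LINT t|lebesgue. indicator {x..y} t *\<^sub>R \<phi> t)"
  proof (rule nn_integral_eq_integral)
    show "integrable lebesgue (\<lambda>t. indicator {x..y} t *\<^sub>R \<phi> t)" using assms(1) by (simp add: set_integrable_def)
    show "AE t in lebesgue. 0 \<le> indicator {x..y} t *\<^sub>R \<phi> t"
      using assms(2) xy by eventually_elim (auto simp: indicator_def)
  qed
  also have "(LINT t|lebesgue. indicator {x..y} t *\<^sub>R \<phi> t) = integral {x..y} \<phi>"
    using set_lebesgue_integral_eq_integral(2)[OF assms(1)] by (simp add: set_lebesgue_integral_def)
  finally show ?thesis .
qed

text \<open>Monotone convergence along an exhaustion of \<open>(0, b)\<close> by compact intervals.\<close>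

lemma set_nn_integral_einterval_le:
  fixes \<phi> :: "real \<Rightarrow> real"
  assumes b: "0 < b" and loc: "L1_loc b \<phi>"
    and nn: "AE x\<in>einterval 0 b in lebesgue. 0 \<le> \<phi> x"
    and M: "\<And>x. x \<in> half_open b \<Longrightarrow> integral {0..x} \<phi> \<le> M"
  shows "(\<integral>\<^sup>+x\<in>einterval 0 b. ennreal (\<phi> x) \<partial>lebesgue) \<le> ennreal M"
proof -
  obtain l u :: "nat \<Rightarrow> real" where lu: "einterval 0 b = (\<Union>i. {l i..u i})"
    "incseq u" "decseq l" "\<And>i. l i < u i" "\<And>i. 0 < l i" "\<And>i. u i \<in> half_open b"
    using einterval_0_approx[OF b] by blast
  define f where "f i t = ennreal (\<phi> t) * indicator {l i..u i} t" for i t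
  have lu_mono: "{l i..u i} \<subseteq> {l j..u j}" if "i \<le> j" for i j
    using incseqD[OF lu(2) that] decseqD[OF lu(3) that] by auto
  have inc: "incseq f"
    unfolding incseq_def le_fun_def
  proof (intro allI impI)
    fix i j :: nat and t assume "i \<le> j"
    then show "f i t \<le> f j t" using lu_mono[of i j] by (auto simp: f_def indicator_def)
  qed
  have m: "f i \<in> borel_measurable lebesgue" for i
  proof -
    have "(\<lambda>t. ennreal (indicator {l i..u i} t *\<^sub>R \<phi> t)) \<in> borel_measurable lebesgue"
      using L1_loc_imp_absolutely_integrable[OF b loc, of "l i" "u i"] lu(5)[of i] lu(6)[of i]
      by (auto simp: set_integrable_def)
    also have "(\<lambda>t. ennreal (indicator {l i..u i} t *\<^sub>R \<phi> t)) = f i"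
      by (auto simp: f_def indicator_def)
    finally show ?thesis .
  qed
  have "(\<integral>\<^sup>+x\<in>einterval 0 b. ennreal (\<phi> x) \<partial>lebesgue) = (\<integral>\<^sup>+x. (SUP i. f i x) \<partial>lebesgue)"
  proof (intro nn_integral_cong)
    fix x
    show "ennreal (\<phi> x) * indicator (einterval 0 b) x = (SUP i. f i x)"
    proof (rule antisym)
      show "ennreal (\<phi> x) * indicator (einterval 0 b) x \<le> (SUP i. f i x)"
      proof (cases "x \<in> einterval 0 b")
        case True
        then obtain n where n: "x \<in> {l n..u n}" using lu(1) by auto
        then have "ennreal (\<phi> x) * indicator (einterval 0 b) x = f n x"
          using True by (simp add: f_def)
        then show ?thesis by (auto intro: SUP_upper)
      qed simp
      show "(SUP i. f i x) \<le> ennreal (\<phi> x) * indicator (einterval 0 b) x"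
        by (rule SUP_least) (auto simp: f_def lu(1) indicator_def)
    qed
  qed
  also have "\<dots> = (SUP i. integral\<^sup>N lebesgue (f i))"
    by (rule nn_integral_monotone_convergence_SUP[OF inc m])
  also have "\<dots> \<le> ennreal M"
  proof (rule SUP_least)
    fix i
    have ai: "\<phi> absolutely_integrable_on {l i..u i}"
      using L1_loc_imp_absolutely_integrable[OF b loc, of "l i" "u i"] lu(5)[of i] lu(6)[of i] by auto
    have "integral\<^sup>N lebesgue (f i) = ennreal (integral {l i..u i} \<phi>)"
      unfolding f_def
      by (rule set_nn_integral_Icc[OF ai AE_einterval_Ioo[OF nn]])
         (use lu(5)[of i] lu(6)[of i] in auto)
    also have "integral {l i..u i} \<phi> \<le> integral {0..u i} \<phi>"
    proof -
      have "integral {0..l i} \<phi> + integral {l i..u i} \<phi> = integral {0..u i} \<phi>"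
        using lu(4)[of i] lu(5)[of i] L1_loc_imp_integrable[OF b loc _ lu(6)[of i], of 0]
        by (intro Henstock_Kurzweil_Integration.integral_combine) auto
      moreover have "0 \<le> integral {0..l i} \<phi>"
      proof -
        have "l i \<in> half_open b" using half_open_le[OF lu(6)[of i]] lu(4)[of i] lu(5)[of i] by auto
        then show ?thesis
          by (intro integral_nonneg_AE_interval L1_loc_imp_integrable[OF b loc] AE_einterval_Ioo[OF nn]) auto
      qed
      ultimately show ?thesis by simp
    qed
    also have "\<dots> \<le> M" by (rule M[OF lu(6)])
    finally show "integral\<^sup>N lebesgue (f i) \<le> ennreal M" by (simp add: ennreal_leI)
  qed
  finally show ?thesis .
qed

lemma L1_if_bounded:
  fixes \<phi> :: "real \<Rightarrow> real"
  assumes b: "0 < b" and loc: "L1_loc b \<phi>"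
    and nn: "AE x\<in>einterval 0 b in lebesgue. 0 \<le> \<phi> x"
    and M: "\<And>x. x \<in> half_open b \<Longrightarrow> integral {0..x} \<phi> \<le> M"
  shows "L1 b \<phi>"
  unfolding L1_def set_integrable_def
proof (rule integrableI_bounded[OF L1_loc_measurable[OF b loc]])
  have "(\<integral>\<^sup>+x. ennreal (norm (indicat_real (einterval 0 b) x *\<^sub>R \<phi> x)) \<partial>lebesgue)
     = (\<integral>\<^sup>+x\<in>einterval 0 b. ennreal (\<phi> x) \<partial>lebesgue)"
    by (intro nn_integral_cong_AE, use nn in eventually_elim) (auto simp: indicator_def)
  also have "\<dots> \<le> ennreal M" by (rule set_nn_integral_einterval_le[OF assms])
  also have "\<dots> < \<infinity>" by simp
  finally show "(\<integral>\<^sup>+x. ennreal (norm (indicat_real (einterval 0 b) x *\<^sub>R \<phi> x)) \<partial>lebesgue) < \<infinity>" .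
qed

lemma L1_integral_le:
  fixes \<phi> :: "real \<Rightarrow> real"
  assumes b: "0 < b" and "L1 b \<phi>"
    and nn: "AE x\<in>einterval 0 b in lebesgue. 0 \<le> \<phi> x"
    and x: "0 \<le> x" "y \<in> half_open b"
  shows "integral {x..y} \<phi> \<le> (LINT t:einterval 0 b|lebesgue. \<phi> t)"
proof -
  have ai: "\<phi> absolutely_integrable_on {x<..<y}"
    using L1_loc_imp_absolutely_integrable[OF b L1_imp_L1_loc[OF assms(2)] x]
    by (simp add: absolutely_integrable_on_Icc_iff_Ioo)
  have "integral {x..y} \<phi> = (LINT t:{x<..<y}|lebesgue. \<phi> t)"
    using set_lebesgue_integral_eq_integral(2)[OF ai] by (simp add: integral_open_interval_real)
  also have "\<dots> \<le> (LINT t:einterval 0 b|lebesgue. \<phi> t)"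
    unfolding set_lebesgue_integral_def
  proof (rule integral_mono_AE)
    show "integrable lebesgue (\<lambda>t. indicat_real {x<..<y} t *\<^sub>R \<phi> t)" using ai by (simp add: set_integrable_def)
    show "integrable lebesgue (\<lambda>t. indicat_real (einterval 0 b) t *\<^sub>R \<phi> t)"
      using assms(2) by (simp add: L1_def set_integrable_def)
    show "AE t in lebesgue. indicat_real {x<..<y} t *\<^sub>R \<phi> t \<le> indicat_real (einterval 0 b) t *\<^sub>R \<phi> t"
      using nn by eventually_elim (use Ioo_subset_einterval[OF x] in \<open>auto simp: indicator_def\<close>)
  qed
  finally show ?thesis .
qed

lemma L1_set_nn_integral:
  fixes \<phi> :: "real \<Rightarrow> real"
  assumes "L1 b \<phi>"
    and nn: "AE x\<in>einterval 0 b in lebesgue. 0 \<le> \<phi> x"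
  shows "(\<integral>\<^sup>+x\<in>einterval 0 b. ennreal (\<phi> x) \<partial>lebesgue) = ennreal (LINT t:einterval 0 b|lebesgue. \<phi> t)"
    and "0 \<le> (LINT t:einterval 0 b|lebesgue. \<phi> t)"
proof -
  have *: "AE t in lebesgue. 0 \<le> indicat_real (einterval 0 b) t *\<^sub>R \<phi> t"
    using nn by eventually_elim (auto simp: indicator_def)
  have "(\<integral>\<^sup>+x\<in>einterval 0 b. ennreal (\<phi> x) \<partial>lebesgue)
    = (\<integral>\<^sup>+t. ennreal (indicator (einterval 0 b) t *\<^sub>R \<phi> t) \<partial>lebesgue)"
    by (intro nn_integral_cong) (auto simp: indicator_def)
  then show "(\<integral>\<^sup>+x\<in>einterval 0 b. ennreal (\<phi> x) \<partial>lebesgue) = ennreal (LINT t:einterval 0 b|lebesgue. \<phi> t)"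
    using nn_integral_eq_integral[OF _ *] assms(1)
    by (simp add: L1_def set_integrable_def set_lebesgue_integral_def)
  show "0 \<le> (LINT t:einterval 0 b|lebesgue. \<phi> t)"
    unfolding set_lebesgue_integral_def by (rule integral_nonneg_AE[OF *])
qed

lemma L1_tail:
  fixes \<phi> :: "real \<Rightarrow> real"
  assumes b: "0 < b" and L1: "L1 b \<phi>"
    and nn: "AE x\<in>einterval 0 b in lebesgue. 0 \<le> \<phi> x" and \<eta>: "\<eta> > 0"
  obtains x0 where "x0 \<in> half_open b" "\<And>x y. x0 \<le> x \<Longrightarrow> x \<le> y \<Longrightarrow> y \<in> half_open b \<Longrightarrow> integral {x..y} \<phi> < \<eta>"
proof -
  note loc = L1_imp_L1_loc[OF L1]
  let ?S = "SUP x\<in>half_open b. integral {0..x} \<phi>"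
  have bdd: "bdd_above ((\<lambda>x. integral {0..x} \<phi>) ` half_open b)"
    using L1_integral_le[OF b L1 nn, of 0] by (intro bdd_aboveI2) auto
  have "\<exists>x0\<in>half_open b. ?S - \<eta> < integral {0..x0} \<phi>"
    using less_cSUP_iff[of "half_open b" "\<lambda>x. integral {0..x} \<phi>" "?S - \<eta>"] bdd half_open_0[OF b] \<eta> by force
  then obtain x0 where x0: "x0 \<in> half_open b" "?S - \<eta> < integral {0..x0} \<phi>" by blast
  show ?thesis
  proof (rule that[OF x0(1)])
    fix x y assume xy: "x0 \<le> x" "x \<le> y" "y \<in> half_open b"
    have x00: "0 \<le> x0" using x0(1) by (simp add: half_open_def)
    have i: "\<phi> integrable_on {0..y}" using L1_loc_imp_integrable[OF b loc _ xy(3)] by simp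
    have "integral {0..x} \<phi> + integral {x..y} \<phi> = integral {0..y} \<phi>"
      using xy x00 i by (intro Henstock_Kurzweil_Integration.integral_combine) auto
    moreover have "integral {0..x0} \<phi> + integral {x0..x} \<phi> = integral {0..x} \<phi>"
      using xy x00 i by (intro Henstock_Kurzweil_Integration.integral_combine)
         (auto intro: integrable_subinterval_real)
    moreover have "0 \<le> integral {x0..x} \<phi>"
      using xy x00 half_open_le[OF xy(3), of x]
      by (intro integral_nonneg_AE_interval L1_loc_imp_integrable[OF b loc] AE_einterval_Ioo[OF nn]) auto
    moreover have "integral {0..y} \<phi> \<le> ?S" using bdd xy(3) by (intro cSUP_upper)
    ultimately show "integral {x..y} \<phi> < \<eta>" using x0(2) by simp
  qed
qed

text \<open>The Cauchy-Schwarz inequality in the form that \<open>f\<^sup>2 \<le> p q\<close> almost everywhere carries over to the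
  integrals: the quadratic polynomial \<open>s\<^sup>2 p + 2 s f + q\<close> is nonnegative for each \<open>s\<close>.\<close>

lemma integral_Cauchy_Schwarz:
  fixes f p q :: "real \<Rightarrow> real"
  assumes int: "f integrable_on {a..b}" "p integrable_on {a..b}" "q integrable_on {a..b}"
    and le: "AE x\<in>{a<..<b} in lebesgue. (f x)\<^sup>2 \<le> p x * q x \<and> 0 \<le> p x \<and> 0 \<le> q x"
  shows "(integral {a..b} f)\<^sup>2 \<le> integral {a..b} p * integral {a..b} q"
proof -
  let ?F = "integral {a..b} f" and ?P = "integral {a..b} p" and ?Q = "integral {a..b} q"
  have P0: "0 \<le> ?P" and Q0: "0 \<le> ?Q"
    using le by (auto intro!: integral_nonneg_AE_interval int elim: eventually_mono)
  have *: "0 \<le> s\<^sup>2 * ?P + 2 * s * ?F + ?Q" for s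
  proof -
    have "0 \<le> integral {a..b} (\<lambda>x. s\<^sup>2 * p x + 2 * s * f x + q x)"
    proof (rule integral_nonneg_AE_interval)
      show "(\<lambda>x. s\<^sup>2 * p x + 2 * s * f x + q x) integrable_on {a..b}"
        by (intro integrable_add integrable_on_mult_right int)
      show "AE x\<in>{a<..<b} in lebesgue. 0 \<le> s\<^sup>2 * p x + 2 * s * f x + q x"
        using le
      proof eventually_elim
        case (elim x)
        show ?case
        proof
          assume "x \<in> {a<..<b}"
          with elim have e: "(f x)\<^sup>2 \<le> p x * q x" "0 \<le> p x" "0 \<le> q x" by auto
          have "(2 * s * f x)\<^sup>2 \<le> (s\<^sup>2 * p x + q x)\<^sup>2"
          proof -
            have "(2 * s * f x)\<^sup>2 = 4 * s\<^sup>2 * (f x)\<^sup>2" by (simp add: power_mult_distrib)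
            also have "\<dots> \<le> 4 * s\<^sup>2 * (p x * q x)" using e by (intro mult_left_mono) auto
            also have "\<dots> \<le> 4 * s\<^sup>2 * (p x * q x) + (s\<^sup>2 * p x - q x)\<^sup>2" by simp
            also have "\<dots> = (s\<^sup>2 * p x + q x)\<^sup>2" by (simp add: power2_eq_square algebra_simps)
            finally show ?thesis .
          qed
          then have "\<bar>2 * s * f x\<bar> \<le> s\<^sup>2 * p x + q x"
            using e by (simp add: abs_le_square_iff[symmetric] del: power_mult_distrib)
          then show "0 \<le> s\<^sup>2 * p x + 2 * s * f x + q x" by simp
        qed
      qed
    qed
    also have "integral {a..b} (\<lambda>x. s\<^sup>2 * p x + 2 * s * f x + q x) = s\<^sup>2 * ?P + 2 * s * ?F + ?Q"
      using int by (simp add: Henstock_Kurzweil_Integration.integral_add integrable_add integrable_on_mult_right)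
    finally show ?thesis .
  qed
  show ?thesis
  proof (cases "?P = 0")
    case True
    have "?F = 0"
    proof (rule ccontr)
      assume F: "?F \<noteq> 0"
      show False using *[of "- (?Q + 1) / (2 * ?F)"] True F by (simp add: field_simps)
    qed
    then show ?thesis using True by simp
  next
    case False
    then show ?thesis using *[of "- ?F / ?P"] P0
      by (simp add: field_simps power2_eq_square)
  qed
qed

section \<open>The first-order system\<close>

lemma primitive_eq:
  assumes "0 < b" "L1_loc b \<phi>" "x \<in> half_open b"
  shows "primitive \<phi> x = integral {0..x} \<phi>"
  unfolding primitive_def
  by (rule set_lebesgue_integral_eq_integral(2)[OF L1_loc_imp_absolutely_integrable[OF assms(1,2) _ assms(3)]]) simp

lemma primitive_diff:
  assumes "0 < b" "L1_loc b \<phi>" "0 \<le> x" "x \<le> y" "y \<in> half_open b"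
  shows "primitive \<phi> y - primitive \<phi> x = integral {x..y} \<phi>"
proof -
  have "integral {0..x} \<phi> + integral {x..y} \<phi> = integral {0..y} \<phi>"
    using assms L1_loc_imp_integrable[OF assms(1,2) _ assms(5), of 0]
    by (intro Henstock_Kurzweil_Integration.integral_combine) auto
  then show ?thesis
    using primitive_eq[OF assms(1,2)] assms half_open_le[OF assms(5), of x] by simp
qed

lemma primitive_0: "0 < b \<Longrightarrow> L1_loc b \<phi> \<Longrightarrow> primitive \<phi> 0 = 0"
  using primitive_eq[of b \<phi> 0] half_open_0[of b] by simp

text \<open>Strict monotonicity needs the density to be positive only almost everywhere.\<close>

lemma primitive_strict_mono:
  assumes "0 < b" "L1_loc b \<phi>" and pos: "AE x\<in>einterval 0 b in lebesgue. 0 < \<phi> x"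
    and "0 \<le> x" "x < y" "y \<in> half_open b"
  shows "primitive \<phi> x < primitive \<phi> y"
proof -
  have ai: "\<phi> absolutely_integrable_on {x..y}"
    using L1_loc_imp_absolutely_integrable[OF assms(1,2,4,6)] .
  have pos': "AE t\<in>{x<..<y} in lebesgue. 0 < \<phi> t" by (rule AE_einterval_Ioo[OF pos assms(4,6)])
  then have nn: "AE t\<in>{x<..<y} in lebesgue. 0 \<le> \<phi> t" by eventually_elim auto
  have ge: "0 \<le> integral {x..y} \<phi>"
    by (rule integral_nonneg_AE_interval[OF set_lebesgue_integral_eq_integral(1)[OF ai] nn])
  have "integral {x..y} \<phi> \<noteq> 0"
  proof
    assume "integral {x..y} \<phi> = 0"
    then have "(\<integral>\<^sup>+t\<in>{x..y}. ennreal (\<phi> t) \<partial>lebesgue) = 0" using set_nn_integral_Icc[OF ai nn] by simp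
    moreover have "(\<lambda>t. ennreal (\<phi> t) * indicator {x..y} t) \<in> borel_measurable lebesgue"
    proof -
      have "(\<lambda>t. ennreal (indicator {x..y} t *\<^sub>R \<phi> t)) \<in> borel_measurable lebesgue"
        using ai by (auto simp: set_integrable_def)
      also have "(\<lambda>t. ennreal (indicator {x..y} t *\<^sub>R \<phi> t)) = (\<lambda>t. ennreal (\<phi> t) * indicator {x..y} t)"
        by (auto simp: indicator_def)
      finally show ?thesis .
    qed
    ultimately have "AE t in lebesgue. ennreal (\<phi> t) * indicator {x..y} t = 0"
      by (simp add: nn_integral_0_iff_AE)
    with pos' have "AE t in lebesgue. t \<notin> {x<..<y}"
      by eventually_elim (auto simp: indicator_def not_le[symmetric])
    then have "negligible {x<..<y}"
      by (auto simp: eventually_ae_filter_negligible greaterThanLessThan_eq greaterThan_def lessThan_def Int_def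
          elim: negligible_subset)
    then show False using open_not_negligible[of "{x<..<y}"] assms(5) by auto
  qed
  with ge show ?thesis using primitive_diff[OF assms(1,2,4) _ assms(6)] assms(5) by simp
qed

lemma primitive_continuous_on:
  assumes "0 < b" "L1_loc b \<phi>" "c \<in> half_open b"
  shows "continuous_on {0..c} (primitive \<phi>)"
proof -
  have "continuous_on {0..c} (\<lambda>x. integral {0..x} \<phi>)"
    using L1_loc_imp_integrable[OF assms(1,2) _ assms(3), of 0] by (intro indefinite_integral_continuous_1) simp
  moreover have "primitive \<phi> x = integral {0..x} \<phi>" if "x \<in> {0..c}" for x
    using primitive_eq[OF assms(1,2)] half_open_le[OF assms(3), of x] that by simp
  ultimately show ?thesis using continuous_on_cong by (metis (no_types, lifting))
qed

lemma continuous_on_einterval: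
  fixes f :: "real \<Rightarrow> 'a::topological_space"
  assumes "0 < b" "\<And>c. c \<in> half_open b \<Longrightarrow> continuous_on {0..c} f"
  shows "continuous_on (einterval 0 b) f"
proof (rule continuous_at_imp_continuous_on, rule ballI)
  fix x assume x: "x \<in> einterval 0 b"
  then have xJ: "x \<in> half_open b" using einterval_subset_half_open by blast
  obtain c where c: "0 < c" "x < c" "ereal c < b" using half_open_bound[OF assms(1) xJ] by metis
  then have "continuous_on {0..c} f" by (intro assms(2)) (simp add: half_open_def)
  then have "continuous_on {0<..<c} f" by (rule continuous_on_subset) auto
  moreover have "x \<in> {0<..<c}" using c x by (simp add: einterval_iff)
  ultimately show "isCont f x" by (simp add: continuous_on_eq_continuous_at)
qed

lemma AC_loc_abs_continuous:
  assumes "0 < b" "AC_loc b f" "c \<in> half_open b"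
  shows "abs_continuous_on {0..c} f"
proof -
  obtain d where d: "0 < d" "c < d" "ereal d < b" using half_open_bound[OF assms(1,3)] by metis
  then have "abs_continuous_on {0..d} f" using assms(2) by (simp add: AC_loc_def)
  then show ?thesis by (rule abs_continuous_on_subset) (use d in auto)
qed

lemma AC_loc_continuous_on:
  assumes "0 < b" "AC_loc b f" "c \<in> half_open b"
  shows "continuous_on {0..c} f"
  using AC_loc_abs_continuous[OF assms] by (rule abs_continuous_on_imp_continuous_on)

lemma AC_loc_FTC:
  fixes f :: "real \<Rightarrow> 'a::euclidean_space"
  assumes b: "0 < b" and ac: "AC_loc b f"
    and der: "AE x\<in>einterval 0 b in lebesgue. (f has_vector_derivative g x) (at x)"
    and x: "0 \<le> x" "y \<in> half_open b"
  shows "g absolutely_integrable_on {x..y}" "x \<le> y \<Longrightarrow> integral {x..y} g = f y - f x"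
proof -
  have y0: "0 \<le> y" using x(2) by (simp add: half_open_def)
  note ftc = abs_continuous_FTC[OF y0 AC_loc_abs_continuous[OF b ac x(2)]]
  have eq: "AE t\<in>{0<..<y} in lebesgue. g t = vector_derivative f (at t)"
    using AE_einterval_Ioo[OF der order_refl x(2)]
    by eventually_elim (auto simp: vector_derivative_at)
  have "g absolutely_integrable_on {0..y}" by (rule absolutely_integrable_spike_AE[OF eq ftc(2)])
  then show "g absolutely_integrable_on {x..y}"
    by (rule absolutely_integrable_on_subinterval) (use x in auto)
  assume xy: "x \<le> y"
  have "integral {x..y} g = integral {x..y} (\<lambda>x. vector_derivative f (at x))"
    by (rule integral_spike_AE[symmetric]) (rule AE_subset[OF eq], use x in auto)
  then show "integral {x..y} g = f y - f x" using ftc(3)[OF x(1) xy] by simp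
qed

lemma AC_loc_inner:
  fixes f g :: "real \<Rightarrow> 'a::euclidean_space"
  assumes "0 < b" "AC_loc b f" "AC_loc b g"
  shows "AC_loc b (\<lambda>x. f x \<bullet> g x)"
  using assms by (auto simp: AC_loc_def intro: abs_continuous_on_inner)

lemma abs_integrable_times_continuous:
  fixes f g :: "real \<Rightarrow> real"
  assumes "continuous_on {x..y} f" "g absolutely_integrable_on {x..y}"
  shows "(\<lambda>t. f t * g t) absolutely_integrable_on {x..y}"
proof (rule absolutely_integrable_bounded_measurable_product[of "(*)"])
  show "bilinear ((*) :: real \<Rightarrow> real \<Rightarrow> real)"
    by (simp add: bilinear_times)
  show "f \<in> borel_measurable (lebesgue_on {x..y})"
    using assms(1) by (rule continuous_imp_measurable_on_sets_lebesgue) simp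
  show "bounded (f ` {x..y})"
    using compact_continuous_image[OF assms(1)] by (auto intro: compact_imp_bounded)
qed (use assms in auto)

text \<open>The first-order system \<open>u' = r v\<close>, \<open>v' = w h\<close>, in which \<open>v\<close> is the quasi-derivative
  \<open>r\<^sup>-\<^sup>1 u'\<close> and \<open>h\<close> is \<open>w\<^sup>-\<^sup>1 (r\<^sup>-\<^sup>1 u')'\<close>.\<close>

definition quasi_system ::
  "ereal \<Rightarrow> (real \<Rightarrow> real) \<Rightarrow> (real \<Rightarrow> real) \<Rightarrow> (real \<Rightarrow> complex) \<Rightarrow> (real \<Rightarrow> complex) \<Rightarrow> (real \<Rightarrow> complex) \<Rightarrow> bool" where
  "quasi_system b w r u v h \<longleftrightarrow> AC_loc b u \<and> AC_loc b v \<and>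
     (AE x\<in>einterval 0 b in lebesgue. (u has_vector_derivative r x *\<^sub>R v x) (at x)) \<and>
     (AE x\<in>einterval 0 b in lebesgue. (v has_vector_derivative w x *\<^sub>R h x) (at x))"

text \<open>The squared norm in \<open>L\<^sup>2\<^sub>w(0, b)\<close>.\<close>

definition L2_norm_sq :: "ereal \<Rightarrow> (real \<Rightarrow> real) \<Rightarrow> (real \<Rightarrow> complex) \<Rightarrow> real" where
  "L2_norm_sq b w f = (LINT x:einterval 0 b|lebesgue. (norm (f x))\<^sup>2 * w x)"

text \<open>The data of the problem, without the assumption that \<open>b\<close> is singular. Below, \<open>W\<close> and \<open>R\<close> are the
  primitives of \<open>w\<close> and \<open>r\<close>, and \<open>J = [0, b)\<close>.\<close>

locale weights =
  fixes b :: ereal and w r :: "real \<Rightarrow> real"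
  assumes b_pos: "0 < b"
    and w_loc: "L1_loc b w" and r_loc: "L1_loc b r"
    and w_pos: "AE x\<in>einterval 0 b in lebesgue. 0 < w x"
    and r_pos: "AE x\<in>einterval 0 b in lebesgue. 0 < r x"
begin

abbreviation "W \<equiv> primitive w"
abbreviation "R \<equiv> primitive r"
abbreviation "J \<equiv> half_open b"

lemma w_nonneg: "AE x\<in>einterval 0 b in lebesgue. 0 \<le> w x"
  using w_pos by eventually_elim auto

lemma r_nonneg: "AE x\<in>einterval 0 b in lebesgue. 0 \<le> r x"
  using r_pos by eventually_elim auto

lemmas W_0 = primitive_0[OF b_pos w_loc] and R_0 = primitive_0[OF b_pos r_loc]
lemmas W_diff = primitive_diff[OF b_pos w_loc] and R_diff = primitive_diff[OF b_pos r_loc]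
lemmas W_less = primitive_strict_mono[OF b_pos w_loc w_pos]
  and R_less = primitive_strict_mono[OF b_pos r_loc r_pos]
lemmas w_int = L1_loc_imp_integrable[OF b_pos w_loc] and r_int = L1_loc_imp_integrable[OF b_pos r_loc]

lemma J_nonneg: "x \<in> J \<Longrightarrow> 0 \<le> x" by (simp add: half_open_def)

lemma W_le: "0 \<le> x \<Longrightarrow> x \<le> y \<Longrightarrow> y \<in> J \<Longrightarrow> W x \<le> W y"
  using W_less[of x y] by (cases "x = y") auto

lemma R_le: "0 \<le> x \<Longrightarrow> x \<le> y \<Longrightarrow> y \<in> J \<Longrightarrow> R x \<le> R y"
  using R_less[of x y] by (cases "x = y") auto

lemma W_pos: "0 < x \<Longrightarrow> x \<in> J \<Longrightarrow> 0 < W x" using W_less[of 0 x] W_0 by simp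
lemma R_pos: "0 < x \<Longrightarrow> x \<in> J \<Longrightarrow> 0 < R x" using R_less[of 0 x] R_0 by simp
lemma W_nonneg: "x \<in> J \<Longrightarrow> 0 \<le> W x" using W_le[of 0 x] W_0 J_nonneg by simp
lemma R_nonneg: "x \<in> J \<Longrightarrow> 0 \<le> R x" using R_le[of 0 x] R_0 J_nonneg by simp

lemma W_attains:
  assumes "x \<in> J" "0 \<le> s" "s \<le> W x"
  obtains y where "0 \<le> y" "y \<le> x" "W y = s"
proof -
  have "\<exists>y\<ge>0. y \<le> x \<and> W y = s"
    using assms W_0 J_nonneg primitive_continuous_on[OF b_pos w_loc assms(1)] by (intro IVT') auto
  then show ?thesis using that by blast
qed

lemma W_eq_iff: "x \<in> J \<Longrightarrow> y \<in> J \<Longrightarrow> W x = W y \<longleftrightarrow> x = y"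
  using W_less[of x y] W_less[of y x] J_nonneg by (metis less_irrefl linorder_neqE_linordered_idom)

lemma W_less_iff: "x \<in> J \<Longrightarrow> y \<in> J \<Longrightarrow> W x < W y \<longleftrightarrow> x < y"
  using W_less[of x y] W_le[of y x] J_nonneg by (meson not_le)

lemma W_unbounded:
  assumes "\<not> L1 b w"
  obtains x where "x \<in> J" "M < W x"
proof -
  have "\<exists>x\<in>J. M < W x"
  proof (rule ccontr)
    assume "\<not> ?thesis"
    then have "L1 b w"
      using primitive_eq[OF b_pos w_loc] by (intro L1_if_bounded[OF b_pos w_loc w_nonneg, of M]) (auto simp: not_less)
    with assms show False by simp
  qed
  then show ?thesis using that by blast
qed

lemma L2_imp_L1: "L2 b w f \<Longrightarrow> L1 b (\<lambda>x. (norm (f x))\<^sup>2 * w x)"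
  by (simp add: L2_def L1_def)

lemma weighted_nonneg:
  fixes f :: "real \<Rightarrow> 'a::real_normed_vector"
  shows "AE x\<in>einterval 0 b in lebesgue. 0 \<le> (norm (f x))\<^sup>2 * w x"
  using w_nonneg by eventually_elim auto

lemma L2_integrable:
  "L2 b w f \<Longrightarrow> 0 \<le> x \<Longrightarrow> y \<in> J \<Longrightarrow> (\<lambda>x. (norm (f x))\<^sup>2 * w x) integrable_on {x..y}"
  using L1_loc_imp_integrable[OF b_pos L1_imp_L1_loc[OF L2_imp_L1]] .

lemma L2_integral_le:
  "L2 b w f \<Longrightarrow> 0 \<le> x \<Longrightarrow> y \<in> J \<Longrightarrow> integral {x..y} (\<lambda>x. (norm (f x))\<^sup>2 * w x) \<le> L2_norm_sq b w f"
  unfolding L2_norm_sq_def by (rule L1_integral_le[OF b_pos L2_imp_L1 weighted_nonneg])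

lemma L2_norm_sq_nonneg: "L2 b w f \<Longrightarrow> 0 \<le> L2_norm_sq b w f"
  unfolding L2_norm_sq_def by (rule L1_set_nn_integral(2)[OF L2_imp_L1 weighted_nonneg])

lemma L2_nn_integral:
  "L2 b w f \<Longrightarrow> (\<integral>\<^sup>+x\<in>einterval 0 b. ennreal ((norm (f x))\<^sup>2 * w x) \<partial>lebesgue) = ennreal (L2_norm_sq b w f)"
  unfolding L2_norm_sq_def by (rule L1_set_nn_integral(1)[OF L2_imp_L1 weighted_nonneg])

end

text \<open>A solution of the system. Almost all of the analysis takes place here; the elements of the domain
  of \<open>A\<^sub>+\<close> give solutions with \<open>u\<close> and \<open>h\<close> in \<open>L\<^sup>2\<^sub>w(0, b)\<close>.\<close>

locale quasi_solution = weights +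
  fixes u v h :: "real \<Rightarrow> complex"
  assumes sys: "quasi_system b w r u v h"
begin

lemma u_AC: "AC_loc b u" and v_AC: "AC_loc b v"
  and u_der: "AE x\<in>einterval 0 b in lebesgue. (u has_vector_derivative r x *\<^sub>R v x) (at x)"
  and v_der: "AE x\<in>einterval 0 b in lebesgue. (v has_vector_derivative w x *\<^sub>R h x) (at x)"
  using sys by (auto simp: quasi_system_def)

lemmas u_int = AC_loc_FTC[OF b_pos u_AC u_der] and v_int = AC_loc_FTC[OF b_pos v_AC v_der]

lemma v_continuous: "0 \<le> x \<Longrightarrow> y \<in> J \<Longrightarrow> continuous_on {x..y} v"
  using AC_loc_continuous_on[OF b_pos v_AC, of y] by (rule continuous_on_subset) auto

lemma u_continuous: "0 \<le> x \<Longrightarrow> y \<in> J \<Longrightarrow> continuous_on {x..y} u"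
  using AC_loc_continuous_on[OF b_pos u_AC, of y] by (rule continuous_on_subset) auto

lemma energy_abs_int:
  assumes "0 \<le> x" "y \<in> J"
  shows "(\<lambda>t. r t * (norm (v t))\<^sup>2) absolutely_integrable_on {x..y}"
proof -
  have "(\<lambda>t. (norm (v t))\<^sup>2 * r t) absolutely_integrable_on {x..y}"
    by (intro abs_integrable_times_continuous L1_loc_imp_absolutely_integrable[OF b_pos r_loc] assms
         continuous_intros v_continuous)
  then show ?thesis by (simp add: mult.commute)
qed

lemma energy_int:
  assumes "0 \<le> x" "y \<in> J"
  shows "(\<lambda>t. r t * (norm (v t))\<^sup>2) integrable_on {x..y}"
  using energy_abs_int[OF assms] by (rule set_lebesgue_integral_eq_integral(1))

text \<open>Integration by parts.\<close>

lemma energy_identity: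
  assumes "0 \<le> x" "y \<in> J"
  shows "(\<lambda>t. w t * (u t \<bullet> h t)) integrable_on {x..y}"
    and "x \<le> y \<Longrightarrow> u y \<bullet> v y - u x \<bullet> v x =
      integral {x..y} (\<lambda>t. r t * (norm (v t))\<^sup>2) + integral {x..y} (\<lambda>t. w t * (u t \<bullet> h t))"
proof -
  have der: "AE t\<in>einterval 0 b in lebesgue.
     ((\<lambda>t. u t \<bullet> v t) has_vector_derivative (w t * (u t \<bullet> h t) + r t * (norm (v t))\<^sup>2)) (at t)"
    using u_der v_der
  proof eventually_elim
    case (elim t)
    show ?case
    proof
      assume "t \<in> einterval 0 b"
      then have "((\<lambda>t. u t \<bullet> v t) has_vector_derivative (u t \<bullet> (w t *\<^sub>R h t) + (r t *\<^sub>R v t) \<bullet> v t)) (at t)"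
        using elim by (intro bounded_bilinear.has_vector_derivative[OF bounded_bilinear_inner]) auto
      then show "((\<lambda>t. u t \<bullet> v t) has_vector_derivative (w t * (u t \<bullet> h t) + r t * (norm (v t))\<^sup>2)) (at t)"
        by (simp add: dot_square_norm)
    qed
  qed
  note ftc = AC_loc_FTC[OF b_pos AC_loc_inner[OF b_pos u_AC v_AC] der assms]
  have *: "(\<lambda>t. w t * (u t \<bullet> h t)) = (\<lambda>t. (w t * (u t \<bullet> h t) + r t * (norm (v t))\<^sup>2) - r t * (norm (v t))\<^sup>2)"
    by auto
  show i: "(\<lambda>t. w t * (u t \<bullet> h t)) integrable_on {x..y}"
    by (subst *) (intro integrable_diff set_lebesgue_integral_eq_integral(1)[OF ftc(1)] energy_int assms)
  assume "x \<le> y"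
  from ftc(2)[OF this] show "u y \<bullet> v y - u x \<bullet> v x =
      integral {x..y} (\<lambda>t. r t * (norm (v t))\<^sup>2) + integral {x..y} (\<lambda>t. w t * (u t \<bullet> h t))"
    using i energy_int[OF assms] by (simp add: Henstock_Kurzweil_Integration.integral_add)
qed

lemma norm_u_identity:
  assumes "0 \<le> x" "x \<le> y" "y \<in> J"
  shows "(\<lambda>t. r t * (2 * (u t \<bullet> v t))) integrable_on {x..y}"
    and "(norm (u y))\<^sup>2 - (norm (u x))\<^sup>2 = integral {x..y} (\<lambda>t. r t * (2 * (u t \<bullet> v t)))"
proof -
  have der: "AE t\<in>einterval 0 b in lebesgue.
     ((\<lambda>t. u t \<bullet> u t) has_vector_derivative (r t * (2 * (u t \<bullet> v t)))) (at t)"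
    using u_der
  proof eventually_elim
    case (elim t)
    show ?case
    proof
      assume "t \<in> einterval 0 b"
      then have "((\<lambda>t. u t \<bullet> u t) has_vector_derivative (u t \<bullet> (r t *\<^sub>R v t) + (r t *\<^sub>R v t) \<bullet> u t)) (at t)"
        using elim by (intro bounded_bilinear.has_vector_derivative[OF bounded_bilinear_inner]) auto
      then show "((\<lambda>t. u t \<bullet> u t) has_vector_derivative (r t * (2 * (u t \<bullet> v t)))) (at t)"
        by (simp add: inner_commute mult.left_commute)
    qed
  qed
  note ftc = AC_loc_FTC[OF b_pos AC_loc_inner[OF b_pos u_AC u_AC] der assms(1,3)]
  show "(\<lambda>t. r t * (2 * (u t \<bullet> v t))) integrable_on {x..y}"
    by (rule set_lebesgue_integral_eq_integral(1)[OF ftc(1)])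
  show "(norm (u y))\<^sup>2 - (norm (u x))\<^sup>2 = integral {x..y} (\<lambda>t. r t * (2 * (u t \<bullet> v t)))"
    using ftc(2)[OF assms(2)] by (simp add: dot_square_norm)
qed

lemma v_increment_le:
  assumes h: "L2 b w h" and x: "0 \<le> x" "x \<le> y" "y \<in> J"
  shows "(norm (v y - v x))\<^sup>2 \<le> L2_norm_sq b w h * (W y - W x)"
proof -
  have ai: "(\<lambda>t. w t *\<^sub>R h t) absolutely_integrable_on {x..y}" using v_int(1) x by blast
  then have ni: "(\<lambda>t. norm (w t *\<^sub>R h t)) integrable_on {x..y}"
    by (simp add: absolutely_integrable_on_def)
  have "norm (v y - v x) = norm (integral {x..y} (\<lambda>t. w t *\<^sub>R h t))" using v_int(2)[OF x(1,3,2)] by simp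
  also have "\<dots> \<le> integral {x..y} (\<lambda>t. norm (w t *\<^sub>R h t))"
    using ni by (intro integral_norm_bound_integral set_lebesgue_integral_eq_integral(1)[OF ai]) auto
  finally have "(norm (v y - v x))\<^sup>2 \<le> (integral {x..y} (\<lambda>t. norm (w t *\<^sub>R h t)))\<^sup>2" by (rule power_mono) simp
  also have "\<dots> \<le> integral {x..y} (\<lambda>t. (norm (h t))\<^sup>2 * w t) * integral {x..y} w"
  proof (rule integral_Cauchy_Schwarz[OF ni L2_integrable[OF h x(1,3)] w_int[OF x(1,3)]])
    show "AE t\<in>{x<..<y} in lebesgue. (norm (w t *\<^sub>R h t))\<^sup>2 \<le> (norm (h t))\<^sup>2 * w t * w t
       \<and> 0 \<le> (norm (h t))\<^sup>2 * w t \<and> 0 \<le> w t"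
      using AE_einterval_Ioo[OF w_nonneg x(1,3)]
      by eventually_elim (auto simp: power2_eq_square)
  qed
  also have "\<dots> \<le> L2_norm_sq b w h * (W y - W x)"
    using W_diff[OF x] W_le[OF x] L2_integral_le[OF h x(1,3)] by (intro mult_mono) (auto simp: L2_norm_sq_nonneg h)
  finally show ?thesis .
qed

lemma cross_term_le:
  assumes "L2 b w u" "L2 b w h" and x: "0 \<le> x" "y \<in> J"
  shows "(integral {x..y} (\<lambda>t. w t * (u t \<bullet> h t)))\<^sup>2 \<le> L2_norm_sq b w u * L2_norm_sq b w h"
proof -
  have "(integral {x..y} (\<lambda>t. w t * (u t \<bullet> h t)))\<^sup>2
     \<le> integral {x..y} (\<lambda>t. (norm (u t))\<^sup>2 * w t) * integral {x..y} (\<lambda>t. (norm (h t))\<^sup>2 * w t)"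
  proof (rule integral_Cauchy_Schwarz[OF energy_identity(1)[OF x] L2_integrable[OF assms(1) x] L2_integrable[OF assms(2) x]])
    show "AE t\<in>{x<..<y} in lebesgue.
      (w t * (u t \<bullet> h t))\<^sup>2 \<le> (norm (u t))\<^sup>2 * w t * ((norm (h t))\<^sup>2 * w t)
       \<and> 0 \<le> (norm (u t))\<^sup>2 * w t \<and> 0 \<le> (norm (h t))\<^sup>2 * w t"
      using AE_einterval_Ioo[OF w_nonneg x]
    proof eventually_elim
      case (elim t)
      have "(u t \<bullet> h t)\<^sup>2 \<le> (norm (u t))\<^sup>2 * (norm (h t))\<^sup>2"
        using Cauchy_Schwarz_ineq[of "u t" "h t"] by (simp add: dot_square_norm)
      then have "(w t)\<^sup>2 * (u t \<bullet> h t)\<^sup>2 \<le> (w t)\<^sup>2 * ((norm (u t))\<^sup>2 * (norm (h t))\<^sup>2)"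
        by (intro mult_left_mono) auto
      then show ?case using elim by (auto simp: power2_eq_square algebra_simps)
    qed
  qed
  also have "\<dots> \<le> L2_norm_sq b w u * L2_norm_sq b w h"
    using L2_integral_le[OF assms(1) x] L2_integral_le[OF assms(2) x]
      integral_nonneg_AE_interval[OF L2_integrable[OF assms(2) x] AE_einterval_Ioo[OF weighted_nonneg x]]
    by (intro mult_mono) (auto simp: L2_norm_sq_nonneg assms)
  finally show ?thesis .
qed

end

section \<open>The bound on the initial value\<close>

context weights
begin

text \<open>The condition on the weights that turns out to be equivalent to the validity of the inequality:
  shrinking \<open>W\<close> by the factor \<open>t\<close> shrinks \<open>R\<close> at least by the factor \<open>1 - d\<close>, uniformly on \<open>[0, b)\<close>.
  In terms of \<open>P = R \<circ> W\<^sup>-\<^sup>1\<close> it says \<open>P(t s) \<le> (1 - d) P(s)\<close>.\<close>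

definition scale_gap :: "real \<Rightarrow> real \<Rightarrow> bool" where
  "scale_gap t d \<longleftrightarrow> 0 < t \<and> t < 1 \<and> 0 < d \<and> d < 1 \<and>
     (\<forall>x\<in>J. \<forall>y\<in>J. W y = t * W x \<longrightarrow> R y \<le> (1 - d) * R x)"

lemma L2_norm_sq_ge:
  assumes f: "L2 b w f" and x: "0 \<le> x" "x \<le> y" "y \<in> J"
    and m: "\<And>s. x \<le> s \<Longrightarrow> s \<le> y \<Longrightarrow> m \<le> (norm (f s))\<^sup>2"
  shows "m * (W y - W x) \<le> integral {x..y} (\<lambda>x. (norm (f x))\<^sup>2 * w x)"
proof -
  have "m * (W y - W x) = integral {x..y} (\<lambda>s. m * w s)" using W_diff[OF x] by simp
  also have "\<dots> \<le> integral {x..y} (\<lambda>x. (norm (f x))\<^sup>2 * w x)"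
  proof (rule integral_mono_AE_interval)
    show "(\<lambda>s. m * w s) integrable_on {x..y}" by (intro integrable_on_mult_right w_int x)
    show "AE s\<in>{x<..<y} in lebesgue. m * w s \<le> (norm (f s))\<^sup>2 * w s"
      using AE_einterval_Ioo[OF w_nonneg x(1,3)] by eventually_elim (auto intro!: mult_right_mono m)
  qed (rule L2_integrable[OF f x(1,3)])
  finally show ?thesis .
qed

end

context quasi_solution
begin

lemma u_increment_ge:
  assumes x: "0 \<le> x" "x \<le> y" "y \<in> J" and k: "\<And>s. x \<le> s \<Longrightarrow> s \<le> y \<Longrightarrow> k \<le> v s \<bullet> c"
  shows "k * (R y - R x) \<le> u y \<bullet> c - u x \<bullet> c"
proof -
  have ai: "(\<lambda>s. r s *\<^sub>R v s) integrable_on {x..y}"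
    using u_int(1)[OF x(1,3)] by (rule set_lebesgue_integral_eq_integral(1))
  have bl: "bounded_linear (\<lambda>z::complex. z \<bullet> c)" by (rule bounded_linear_inner_left)
  have ai': "(\<lambda>s. r s * (v s \<bullet> c)) integrable_on {x..y}"
    using integrable_linear[OF ai bl] by (simp add: o_def)
  have "k * (R y - R x) = integral {x..y} (\<lambda>s. k * r s)" using R_diff[OF x] by simp
  also have "\<dots> \<le> integral {x..y} (\<lambda>s. r s * (v s \<bullet> c))"
  proof (rule integral_mono_AE_interval)
    show "(\<lambda>s. k * r s) integrable_on {x..y}" by (intro integrable_on_mult_right r_int x)
    show "AE s\<in>{x<..<y} in lebesgue. k * r s \<le> r s * (v s \<bullet> c)"
      using AE_einterval_Ioo[OF r_nonneg x(1,3)]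
      by eventually_elim (auto simp: mult.commute[of k] intro!: mult_left_mono k)
  qed (rule ai')
  also have "\<dots> = integral {x..y} (\<lambda>s. r s *\<^sub>R v s) \<bullet> c"
    using integral_linear[OF ai bl] by (simp add: o_def)
  also have "\<dots> = u y \<bullet> c - u x \<bullet> c" using u_int(2)[OF x(1,3,2)] by (simp add: inner_diff_left)
  finally show ?thesis .
qed

lemma u_increment_le:
  assumes x: "0 \<le> x" "x \<le> y" "y \<in> J" and k: "\<And>s. x \<le> s \<Longrightarrow> s \<le> y \<Longrightarrow> norm (v s) \<le> k"
  shows "norm (u y - u x) \<le> k * (R y - R x)"
proof -
  have ai: "(\<lambda>s. r s *\<^sub>R v s) absolutely_integrable_on {x..y}" using u_int(1)[OF x(1,3)] .
  then have ni: "(\<lambda>s. norm (r s *\<^sub>R v s)) integrable_on {x..y}" by (simp add: absolutely_integrable_on_def)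
  have "norm (u y - u x) = norm (integral {x..y} (\<lambda>s. r s *\<^sub>R v s))" using u_int(2)[OF x(1,3,2)] by simp
  also have "\<dots> \<le> integral {x..y} (\<lambda>s. norm (r s *\<^sub>R v s))"
    using ni by (intro integral_norm_bound_integral set_lebesgue_integral_eq_integral(1)[OF ai]) auto
  also have "\<dots> \<le> integral {x..y} (\<lambda>s. k * r s)"
  proof (rule integral_mono_AE_interval[OF ni])
    show "(\<lambda>s. k * r s) integrable_on {x..y}" by (intro integrable_on_mult_right r_int x)
    show "AE s\<in>{x<..<y} in lebesgue. norm (r s *\<^sub>R v s) \<le> k * r s"
      using AE_einterval_Ioo[OF r_nonneg x(1,3)]
      by eventually_elim (auto simp: mult.commute[of k] intro!: mult_left_mono k)
  qed
  also have "\<dots> = k * (R y - R x)" using R_diff[OF x] by simp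
  finally show ?thesis .
qed

text \<open>The key estimate. As long as the quasi-derivative stays close to \<open>v 0\<close>, the modulus of \<open>u\<close> is at
  least a fixed multiple of \<open>\<bar>u 0\<bar>\<close> on a set whose \<open>w\<close>-measure is a fixed fraction of \<open>W X\<close>. Either \<open>u\<close> changes
  little up to the point \<open>y1\<close> with \<open>W y1 = t W X\<close>. Or the monotone function \<open>u \<bullet> v 0\<close> increases, by the
  scale gap, by a definite amount \<open>D\<close> between \<open>y2\<close> and \<open>y1\<close>, where \<open>W y2 = t\<^sup>2 W X\<close>; then its modulus is
  at least \<open>D / 2\<close> on all of \<open>[y1, X]\<close> or on all of \<open>[0, y2]\<close>.\<close>

lemma initial_value_le:
  assumes gap: "scale_gap t d" and u: "L2 b w u" and X: "X \<in> J"
    and near: "\<And>s. 0 \<le> s \<Longrightarrow> s \<le> X \<Longrightarrow> norm (v s - v 0) \<le> norm (v 0) / 2"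
  shows "(d / 12)\<^sup>2 * t\<^sup>2 * (1 - t) * (norm (u 0))\<^sup>2 * W X \<le> L2_norm_sq b w u"
proof -
  define a where "a = norm (u 0)"
  define c where "c = norm (v 0)"
  define e where "e = (d / 12)\<^sup>2 * t\<^sup>2 * (1 - t)"
  have t: "0 < t" "t < 1" and d: "0 < d" "d < 1" using gap by (auto simp: scale_gap_def)
  have X0: "0 \<le> X" and WX: "0 \<le> W X" using X J_nonneg W_nonneg by auto
  have a0: "0 \<le> a" and c0: "0 \<le> c" by (auto simp: a_def c_def)
  have "0 \<le> t * W X" "t * W X \<le> W X" using t WX by (auto simp: mult_left_le_one_le)
  then obtain y1 where y1: "0 \<le> y1" "y1 \<le> X" "W y1 = t * W X"
    by (rule W_attains[OF X])
  have y1J: "y1 \<in> J" using half_open_le[OF X y1(1,2)] .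
  have "0 \<le> t * W y1" "t * W y1 \<le> W y1" using t W_nonneg[OF y1J] by (auto simp: mult_left_le_one_le)
  then obtain y2 where y2: "0 \<le> y2" "y2 \<le> y1" "W y2 = t * W y1"
    by (rule W_attains[OF y1J])
  have y2J: "y2 \<in> J" using half_open_le[OF y1J y2(1,2)] .
  have gap': "R y2 \<le> (1 - d) * R y1" using gap y1J y2J y2(3) by (simp add: scale_gap_def)
  have R0: "0 \<le> R y1" by (rule R_nonneg[OF y1J])
  have vle: "norm (v s) \<le> 3 / 2 * c" if "0 \<le> s" "s \<le> X" for s
    using near[OF that] norm_triangle_sub[of "v s" "v 0"] by (simp add: c_def)
  have vge: "c\<^sup>2 / 2 \<le> v s \<bullet> v 0" if "0 \<le> s" "s \<le> X" for s
  proof -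
    have "\<bar>(v s - v 0) \<bullet> v 0\<bar> \<le> norm (v s - v 0) * norm (v 0)" by (rule Cauchy_Schwarz_ineq2)
    also have "\<dots> \<le> c / 2 * c" unfolding c_def by (rule mult_right_mono[OF near[OF that]]) simp
    finally have "- (c\<^sup>2 / 2) \<le> (v s - v 0) \<bullet> v 0" by (simp add: power2_eq_square abs_le_iff)
    then show ?thesis by (simp add: inner_diff_left dot_square_norm c_def)
  qed
  have nu: "m * (W y - W x) \<le> L2_norm_sq b w u"
    if "0 \<le> x" "x \<le> y" "y \<le> X" "\<And>s. x \<le> s \<Longrightarrow> s \<le> y \<Longrightarrow> m \<le> (norm (u s))\<^sup>2" for m x y
  proof -
    have yJ: "y \<in> J" using half_open_le[OF X _ that(3)] that(1,2) by simp
    show ?thesis using L2_norm_sq_ge[OF u that(1,2) yJ that(4)] L2_integral_le[OF u that(1) yJ] by simp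
  qed
  have e_le: "e \<le> (d / 12)\<^sup>2 * q" if "t\<^sup>2 * (1 - t) \<le> q" for q
    using that by (auto simp: e_def mult.assoc intro: mult_left_mono)
  have "e * a\<^sup>2 * W X \<le> L2_norm_sq b w u"
  proof (cases "3 / 2 * c * R y1 \<le> a / 2")
    case True
    have "(a / 2)\<^sup>2 * (W y1 - W 0) \<le> L2_norm_sq b w u"
    proof (rule nu[OF order_refl y1(1,2)])
      fix s assume s: "0 \<le> s" "s \<le> y1"
      have sJ: "s \<in> J" using half_open_le[OF y1J s] .
      have "norm (u s - u 0) \<le> 3 / 2 * c * (R s - R 0)"
        using s y1(2) vle by (intro u_increment_le order_refl sJ) auto
      also have "\<dots> \<le> 3 / 2 * c * R y1" using R_le[OF s y1J] R_0 c0 by (intro mult_left_mono) auto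
      finally have "norm (u s - u 0) \<le> a / 2" using True by simp
      then have "a / 2 \<le> norm (u s)" using norm_triangle_sub[of "u 0" "u s"] by (simp add: a_def norm_minus_commute)
      then show "(a / 2)\<^sup>2 \<le> (norm (u s))\<^sup>2" using a0 by (intro power_mono) auto
    qed
    moreover have "e * a\<^sup>2 * W X \<le> (a / 2)\<^sup>2 * (W y1 - W 0)"
    proof -
      have "t\<^sup>2 * (1 - t) \<le> t"
      proof -
        have "t * (t * (1 - t)) \<le> t * 1" using t by (intro mult_left_mono) (auto intro: mult_le_one)
        then show ?thesis by (simp add: power2_eq_square mult.assoc)
      qed
      then have "e \<le> (d / 12)\<^sup>2 * t" by (rule e_le)
      also have "\<dots> \<le> (1 / 2)\<^sup>2 * t" using t d by (intro mult_right_mono power_mono) auto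
      finally have "e * (a\<^sup>2 * W X) \<le> (1 / 2)\<^sup>2 * t * (a\<^sup>2 * W X)" using WX by (intro mult_right_mono) auto
      then show ?thesis using y1(3) W_0 by (simp add: power_divide field_simps)
    qed
    ultimately show ?thesis by linarith
  next
    case False
    then have cpos: "0 < c" using c0 a0 by (cases "c = 0") auto
    define g where "g s = u s \<bullet> v 0" for s
    define D where "D = d * c * a / 6"
    have D0: "0 \<le> D" using d c0 a0 by (simp add: D_def)
    have g_mono: "g x \<le> g y" if "0 \<le> x" "x \<le> y" "y \<le> X" for x y
    proof -
      have yJ: "y \<in> J" using half_open_le[OF X _ that(3)] that(1,2) by simp
      have "c\<^sup>2 / 2 * (R y - R x) \<le> g y - g x"
        unfolding g_def using that by (intro u_increment_ge yJ vge) auto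
      moreover have "0 \<le> c\<^sup>2 / 2 * (R y - R x)" using R_le[OF that(1,2) yJ] by simp
      ultimately show ?thesis by simp
    qed
    have u_ge: "\<bar>g s\<bar> \<le> norm (u s) * c" for s
      using Cauchy_Schwarz_ineq2[of "u s" "v 0"] by (simp add: g_def c_def)
    have sq: "(d / 12)\<^sup>2 * a\<^sup>2 \<le> (norm (u s))\<^sup>2" if "D / 2 \<le> \<bar>g s\<bar>" for s
    proof -
      have "d / 12 * a * c \<le> norm (u s) * c" using that u_ge[of s] by (simp add: D_def mult_ac)
      then have "d / 12 * a \<le> norm (u s)" using cpos by (simp add: mult_le_cancel_right)
      then have "(d / 12 * a)\<^sup>2 \<le> (norm (u s))\<^sup>2" using d a0 by (intro power_mono) auto
      then show ?thesis by (simp only: power_mult_distrib)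
    qed
    have "c\<^sup>2 / 2 * (R y1 - R y2) \<le> g y1 - g y2"
      unfolding g_def using y2 y1 by (intro u_increment_ge y1J vge) auto
    moreover have "D \<le> c\<^sup>2 / 2 * (R y1 - R y2)"
    proof -
      have "D \<le> d * c * (3 * c * R y1) / 6"
        using False d c0 unfolding D_def by (intro divide_right_mono mult_left_mono) auto
      also have "\<dots> = c\<^sup>2 / 2 * (d * R y1)" by (simp add: power2_eq_square)
      also have "\<dots> \<le> c\<^sup>2 / 2 * (R y1 - R y2)" using gap' by (intro mult_left_mono) (auto simp: algebra_simps)
      finally show ?thesis .
    qed
    ultimately have gap_g: "D \<le> g y1 - g y2" by simp
    show ?thesis
    proof (cases "D / 2 \<le> g y1")
      case True
      have "(d / 12)\<^sup>2 * a\<^sup>2 * (W X - W y1) \<le> L2_norm_sq b w u"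
      proof (rule nu[OF y1(1,2) order_refl sq])
        fix s assume s: "y1 \<le> s" "s \<le> X"
        then show "D / 2 \<le> \<bar>g s\<bar>" using g_mono[OF y1(1) s] True by simp
      qed
      moreover have "e * a\<^sup>2 * W X \<le> (d / 12)\<^sup>2 * a\<^sup>2 * (W X - W y1)"
      proof -
        have "t\<^sup>2 * (1 - t) \<le> 1 - t" using t by (intro mult_left_le_one_le) (auto intro: power_le_one)
        then have "e \<le> (d / 12)\<^sup>2 * (1 - t)" by (rule e_le)
        then have "e * (a\<^sup>2 * W X) \<le> (d / 12)\<^sup>2 * (1 - t) * (a\<^sup>2 * W X)" using WX by (intro mult_right_mono) auto
        then show ?thesis using y1(3) by (simp add: algebra_simps)
      qed
      ultimately show ?thesis by linarith
    next
      case False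
      have "(d / 12)\<^sup>2 * a\<^sup>2 * (W y2 - W 0) \<le> L2_norm_sq b w u"
      proof (rule nu[OF order_refl y2(1) _ sq])
        show "y2 \<le> X" using y1 y2 by simp
        fix s assume s: "0 \<le> s" "s \<le> y2"
        have "g s \<le> g y2" using g_mono[OF s] y1 y2 by simp
        then show "D / 2 \<le> \<bar>g s\<bar>" using False gap_g by (simp add: field_simps)
      qed
      moreover have "e * a\<^sup>2 * W X \<le> (d / 12)\<^sup>2 * a\<^sup>2 * (W y2 - W 0)"
      proof -
        have "t\<^sup>2 * (1 - t) \<le> t\<^sup>2" using t by (intro mult_left_le) auto
        then have "e \<le> (d / 12)\<^sup>2 * t\<^sup>2" by (rule e_le)
        then have "e * (a\<^sup>2 * W X) \<le> (d / 12)\<^sup>2 * t\<^sup>2 * (a\<^sup>2 * W X)" using WX by (intro mult_right_mono) auto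
        then show ?thesis using y1(3) y2(3) W_0 by (simp add: algebra_simps power2_eq_square)
      qed
      ultimately show ?thesis by linarith
    qed
  qed
  then show ?thesis by (simp add: e_def a_def)
qed

end

section \<open>The initial product and the boundary term at \<open>b\<close>\<close>

context quasi_solution
begin

text \<open>If \<open>X\<close> is the point at which the Cauchy-Schwarz bound for \<open>\<bar>v - v 0\<bar>\<close> reaches \<open>\<bar>v 0\<bar> / 2\<close>, then the
  estimate of \<open>u 0\<close> on \<open>[0, X]\<close> becomes a bound for the product \<open>\<bar>u 0\<bar> \<bar>v 0\<bar>\<close>.\<close>

lemma initial_product_le_if_attained:
  assumes gap: "scale_gap t d" and u: "L2 b w u" and h: "L2 b w h" and X: "X \<in> J"
    and WX: "L2_norm_sq b w h * W X = (norm (v 0) / 2)\<^sup>2"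
  shows "(d / 12)\<^sup>2 * t\<^sup>2 * (1 - t) * ((norm (u 0))\<^sup>2 * (norm (v 0))\<^sup>2)
     \<le> 4 * (L2_norm_sq b w u * L2_norm_sq b w h)"
proof -
  let ?e = "(d / 12)\<^sup>2 * t\<^sup>2 * (1 - t)"
  have "?e * (norm (u 0))\<^sup>2 * W X \<le> L2_norm_sq b w u"
  proof (rule initial_value_le[OF gap u X])
    fix s assume s: "0 \<le> s" "s \<le> X"
    have sJ: "s \<in> J" using half_open_le[OF X s] .
    have "(norm (v s - v 0))\<^sup>2 \<le> L2_norm_sq b w h * (W s - W 0)"
      by (rule v_increment_le[OF h order_refl s(1) sJ])
    also have "\<dots> \<le> L2_norm_sq b w h * W X"
      using W_le[OF s X] W_0 L2_norm_sq_nonneg[OF h] by (intro mult_left_mono) auto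
    finally show "norm (v s - v 0) \<le> norm (v 0) / 2" unfolding WX by (rule power2_le_imp_le) simp
  qed
  then have "?e * (norm (u 0))\<^sup>2 * W X * (4 * L2_norm_sq b w h) \<le> L2_norm_sq b w u * (4 * L2_norm_sq b w h)"
    by (rule mult_right_mono) (simp add: L2_norm_sq_nonneg h)
  moreover have "?e * (norm (u 0))\<^sup>2 * W X * (4 * L2_norm_sq b w h) =
     ?e * (norm (u 0))\<^sup>2 * (4 * (L2_norm_sq b w h * W X))" by (simp only: mult_ac)
  moreover have *: "4 * (L2_norm_sq b w h * W X) = (norm (v 0))\<^sup>2" unfolding WX by (simp add: power_divide)
  ultimately have "?e * (norm (u 0))\<^sup>2 * (norm (v 0))\<^sup>2 \<le> L2_norm_sq b w u * (4 * L2_norm_sq b w h)"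
    unfolding * by simp
  then show ?thesis by (simp only: mult_ac)
qed

lemma initial_product_le_not_L1:
  assumes gap: "scale_gap t d" and u: "L2 b w u" and h: "L2 b w h" and w: "\<not> L1 b w"
  shows "(d / 12)\<^sup>2 * t\<^sup>2 * (1 - t) * ((norm (u 0))\<^sup>2 * (norm (v 0))\<^sup>2)
     \<le> 4 * (L2_norm_sq b w u * L2_norm_sq b w h)"
proof -
  let ?e = "(d / 12)\<^sup>2 * t\<^sup>2 * (1 - t)"
  have e: "?e > 0" using gap by (simp add: scale_gap_def)
  note nn = L2_norm_sq_nonneg[OF u] L2_norm_sq_nonneg[OF h]
  show ?thesis
  proof (cases "L2_norm_sq b w h = 0")
    case True
    \<comment> \<open>Here \<open>v\<close> is constant, so the estimate holds on every \<open>[0, X]\<close>.\<close>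
    have "u 0 = 0"
    proof (rule ccontr)
      assume u0: "u 0 \<noteq> 0"
      obtain X where X: "X \<in> J" "L2_norm_sq b w u / (?e * (norm (u 0))\<^sup>2) < W X"
        using W_unbounded[OF w] by blast
      have "?e * (norm (u 0))\<^sup>2 * W X \<le> L2_norm_sq b w u"
      proof (rule initial_value_le[OF gap u X(1)])
        fix s assume s: "0 \<le> s" "s \<le> X"
        have "(norm (v s - v 0))\<^sup>2 \<le> L2_norm_sq b w h * (W s - W 0)"
          by (rule v_increment_le[OF h order_refl s(1) half_open_le[OF X(1) s]])
        then show "norm (v s - v 0) \<le> norm (v 0) / 2" using True by simp
      qed
      moreover have "?e * (norm (u 0))\<^sup>2 > 0" using e u0 by simp
      ultimately show False using X(2) by (simp add: pos_divide_less_eq mult.commute)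
    qed
    then show ?thesis using nn by simp
  next
    case False
    then have pos: "L2_norm_sq b w h > 0" using nn by simp
    define s where "s = (norm (v 0) / 2)\<^sup>2 / L2_norm_sq b w h"
    have s0: "0 \<le> s" using pos by (simp add: s_def)
    obtain x where x: "x \<in> J" "s < W x" using W_unbounded[OF w] by blast
    obtain X where X: "0 \<le> X" "X \<le> x" "W X = s" by (rule W_attains[OF x(1) s0 less_imp_le[OF x(2)]])
    have "L2_norm_sq b w h * W X = (norm (v 0) / 2)\<^sup>2" using X(3) pos by (simp add: s_def)
    then show ?thesis by (rule initial_product_le_if_attained[OF gap u h half_open_le[OF x(1) X(1,2)]])
  qed
qed

end

context weights
begin

text \<open>The total mass \<open>W(b)\<close>; meaningful only for integrable \<open>w\<close>.\<close>

definition W_end :: real where "W_end = (SUP x\<in>J. W x)"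

lemma W_le_end:
  assumes "L1 b w" "x \<in> J"
  shows "W x \<le> W_end"
proof -
  have "bdd_above (W ` J)"
    using L1_integral_le[OF b_pos assms(1) w_nonneg, of 0] primitive_eq[OF b_pos w_loc]
    by (intro bdd_aboveI2[of J W "LINT t:einterval 0 b|lebesgue. w t"]) simp
  then show ?thesis unfolding W_end_def using assms(2) by (intro cSUP_upper)
qed

lemma half_open_larger:
  assumes "x \<in> J"
  obtains y where "y \<in> J" "x < y"
proof -
  obtain c where "0 < c" "x < c" "ereal c < b" using half_open_bound[OF b_pos assms] by blast
  then show ?thesis using that[of c] by (simp add: half_open_def)
qed

lemma W_less_end:
  assumes "L1 b w" "x \<in> J"
  shows "W x < W_end"
proof -
  obtain y where y: "y \<in> J" "x < y" using half_open_larger[OF assms(2)] .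
  then show ?thesis using W_less[OF J_nonneg[OF assms(2)] y(2,1)] W_le_end[OF assms(1) y(1)] by simp
qed

lemma less_W_end:
  assumes "s < W_end"
  obtains x where "x \<in> J" "s < W x"
proof -
  have "\<exists>x\<in>J. s < W x"
  proof (rule ccontr)
    assume *: "\<not> ?thesis"
    have "W_end \<le> s"
      unfolding W_end_def
    proof (rule cSUP_least)
      show "J \<noteq> {}" using half_open_0[OF b_pos] by auto
      show "\<And>x. x \<in> J \<Longrightarrow> W x \<le> s" using * by auto
    qed
    with assms show False by simp
  qed
  then show ?thesis using that by blast
qed

end

context quasi_solution
begin

text \<open>For integrable \<open>w\<close> the quasi-derivative tends to \<open>0\<close> at \<open>b\<close> at a definite rate. If the bound failed
  at \<open>x0\<close>, then \<open>v \<bullet> v x0\<close> would stay above a positive constant on \<open>[x0, b)\<close>. This contradicts the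
  boundary condition in the limit circle case; in the limit point case \<open>u\<close> would grow at least like
  a multiple of \<open>R\<close>, and \<open>R\<close> would belong to \<open>L\<^sup>2\<^sub>w(0, b)\<close>.\<close>

lemma v_decay:
  assumes u: "L2 b w u" and h: "L2 b w h" and w: "L1 b w"
    and bc: "limit_point b w r \<or> ((\<lambda>y. v (real_of_ereal y)) \<longlongrightarrow> 0) (at_left b)"
    and x0: "x0 \<in> J"
  shows "(norm (v x0))\<^sup>2 \<le> L2_norm_sq b w h * (W_end - W x0)"
proof (rule ccontr)
  assume neg: "\<not> ?thesis"
  define \<theta> where "\<theta> = sqrt (L2_norm_sq b w h * (W_end - W x0))"
  define c where "c = norm (v x0)"
  have nh: "0 \<le> L2_norm_sq b w h" by (rule L2_norm_sq_nonneg[OF h])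
  have \<theta>0: "0 \<le> \<theta>" using nh W_le_end[OF w x0] by (simp add: \<theta>_def)
  have \<theta>2: "\<theta>\<^sup>2 = L2_norm_sq b w h * (W_end - W x0)" using nh W_le_end[OF w x0] by (simp add: \<theta>_def)
  have "\<theta>\<^sup>2 < c\<^sup>2" using neg \<theta>2 by (simp add: c_def)
  then have \<theta>c: "\<theta> < c" by (rule power2_less_imp_less) (simp add: c_def)
  define k where "k = c * (c - \<theta>)"
  have k: "k > 0" using \<theta>c \<theta>0 by (simp add: k_def)
  have x00: "0 \<le> x0" by (rule J_nonneg[OF x0])
  have vk: "k \<le> v s \<bullet> v x0" if s: "x0 \<le> s" "s \<in> J" for s
  proof -
    have "(norm (v s - v x0))\<^sup>2 \<le> L2_norm_sq b w h * (W s - W x0)"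
      by (rule v_increment_le[OF h x00 s])
    also have "\<dots> \<le> \<theta>\<^sup>2" unfolding \<theta>2 using W_le_end[OF w s(2)] nh by (intro mult_left_mono) auto
    finally have "norm (v s - v x0) \<le> \<theta>" by (rule power2_le_imp_le[OF _ \<theta>0])
    have "\<bar>(v s - v x0) \<bullet> v x0\<bar> \<le> norm (v s - v x0) * norm (v x0)" by (rule Cauchy_Schwarz_ineq2)
    also have "\<dots> \<le> \<theta> * c" unfolding c_def using \<open>norm (v s - v x0) \<le> \<theta>\<close> by (intro mult_right_mono) auto
    finally have "- (\<theta> * c) \<le> (v s - v x0) \<bullet> v x0" by (simp add: abs_le_iff)
    then show ?thesis by (simp add: inner_diff_left dot_square_norm c_def k_def power2_eq_square algebra_simps)
  qed
  show False
    using bc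
  proof
    assume "((\<lambda>y. v (real_of_ereal y)) \<longlongrightarrow> 0) (at_left b)"
    then have "((\<lambda>y. v (real_of_ereal y) \<bullet> v x0) \<longlongrightarrow> 0 \<bullet> v x0) (at_left b)"
      by (intro tendsto_inner tendsto_const)
    then have "\<forall>\<^sub>F y in at_left b. v (real_of_ereal y) \<bullet> v x0 < k"
      using k by (intro order_tendstoD(2)) auto
    moreover have "ereal x0 < b" using x0 by (simp add: half_open_def)
    ultimately obtain z where z: "z < b" "\<And>y. z < y \<Longrightarrow> y < b \<Longrightarrow> v (real_of_ereal y) \<bullet> v x0 < k"
      by (auto simp: eventually_at_left)
    obtain s where s: "max z (ereal x0) < ereal s" "ereal s < b"
      using ereal_dense2[of "max z (ereal x0)" b] z(1) \<open>ereal x0 < b\<close> by auto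
    have "v s \<bullet> v x0 < k" using z(2)[of "ereal s"] s by simp
    moreover have "k \<le> v s \<bullet> v x0" using s x00 by (intro vk) (auto simp: half_open_def)
    ultimately show False by simp
  next
    assume lp: "limit_point b w r"
    have c0: "0 < c" using \<theta>c \<theta>0 by simp
    define C where "C = R x0 + \<bar>u x0 \<bullet> v x0\<bar> / k"
    have C0: "0 \<le> C" using R_nonneg[OF x0] k by (simp add: C_def)
    have Rle: "R x \<le> c / k * norm (u x) + C" if x: "x \<in> J" for x
    proof (cases "x \<le> x0")
      case True
      have "R x \<le> R x0" by (rule R_le[OF J_nonneg[OF x] True x0])
      also have "\<dots> \<le> C" using k by (simp add: C_def)
      also have "\<dots> \<le> c / k * norm (u x) + C" using k c0 by simp
      finally show ?thesis .
    next
      case False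
      have "k * (R x - R x0) \<le> u x \<bullet> v x0 - u x0 \<bullet> v x0"
        using False x00 by (intro u_increment_ge x vk half_open_le[OF x]) auto
      also have "\<dots> \<le> norm (u x) * c + \<bar>u x0 \<bullet> v x0\<bar>"
        unfolding c_def using Cauchy_Schwarz_ineq2[of "u x" "v x0"] by linarith
      finally have "R x - R x0 \<le> (norm (u x) * c + \<bar>u x0 \<bullet> v x0\<bar>) / k"
        using k by (simp add: field_simps)
      then show ?thesis by (simp add: C_def add_divide_distrib mult.commute)
    qed
    have R_meas: "R \<in> borel_measurable (lebesgue_on (einterval 0 b))"
      using primitive_continuous_on[OF b_pos r_loc]
      by (intro continuous_imp_measurable_on_sets_lebesgue continuous_on_einterval b_pos) auto
    define A where "A = 2 * (c / k)\<^sup>2"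
    have "L1 b (\<lambda>x. (norm (R x))\<^sup>2 * w x)"
    proof (rule L1_if_bounded[OF b_pos _ weighted_nonneg[of "\<lambda>x. R x"]])
      show loc: "L1_loc b (\<lambda>x. (norm (R x))\<^sup>2 * w x)"
        unfolding L1_loc_def
      proof (intro allI impI)
        fix s :: real assume "0 < s" "ereal s < b"
        then have "s \<in> J" by (simp add: half_open_def)
        then show "(\<lambda>x. (norm (R x))\<^sup>2 * w x) absolutely_integrable_on {0..s}"
          by (intro abs_integrable_times_continuous L1_loc_imp_absolutely_integrable[OF b_pos w_loc]
              continuous_intros primitive_continuous_on[OF b_pos r_loc]) auto
      qed
      fix x assume x: "x \<in> J"
      have i1: "(\<lambda>x. (norm (u x))\<^sup>2 * w x) integrable_on {0..x}" by (rule L2_integrable[OF u order_refl x])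
      have i2: "w integrable_on {0..x}" by (rule w_int[OF order_refl x])
      have "integral {0..x} (\<lambda>x. (norm (R x))\<^sup>2 * w x)
         \<le> integral {0..x} (\<lambda>x. A * ((norm (u x))\<^sup>2 * w x) + 2 * C\<^sup>2 * w x)"
      proof (rule integral_mono_AE_interval)
        show "(\<lambda>x. (norm (R x))\<^sup>2 * w x) integrable_on {0..x}"
          by (rule L1_loc_imp_integrable[OF b_pos loc order_refl x])
        show "(\<lambda>x. A * ((norm (u x))\<^sup>2 * w x) + 2 * C\<^sup>2 * w x) integrable_on {0..x}"
          by (intro integrable_add integrable_on_mult_right i1 i2)
        show "AE s\<in>{0<..<x} in lebesgue.
           (norm (R s))\<^sup>2 * w s \<le> A * ((norm (u s))\<^sup>2 * w s) + 2 * C\<^sup>2 * w s"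
          using AE_einterval_Ioo[OF w_nonneg order_refl x]
        proof eventually_elim
          case (elim s)
          show ?case
          proof
            assume s: "s \<in> {0<..<x}"
            then have sJ: "s \<in> J" by (intro half_open_le[OF x]) auto
            have "(norm (R s))\<^sup>2 \<le> (c / k * norm (u s) + C)\<^sup>2"
              using Rle[OF sJ] R_nonneg[OF sJ] by (intro power_mono) auto
            also have "\<dots> \<le> \<dots> + (c / k * norm (u s) - C)\<^sup>2" by simp
            also have "\<dots> = A * (norm (u s))\<^sup>2 + 2 * C\<^sup>2"
              by (simp add: A_def power2_sum power2_diff power_mult_distrib power_divide)
            finally have "(norm (R s))\<^sup>2 * w s \<le> (A * (norm (u s))\<^sup>2 + 2 * C\<^sup>2) * w s"
              using elim s by (intro mult_right_mono) auto
            then show "(norm (R s))\<^sup>2 * w s \<le> A * ((norm (u s))\<^sup>2 * w s) + 2 * C\<^sup>2 * w s"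
              by (simp only: distrib_right mult.assoc)
          qed
        qed
      qed
      also have "\<dots> = A * integral {0..x} (\<lambda>x. (norm (u x))\<^sup>2 * w x) + 2 * C\<^sup>2 * integral {0..x} w"
        by (subst Henstock_Kurzweil_Integration.integral_add) (auto intro!: integrable_on_mult_right i1 i2)
      also have "\<dots> \<le> A * L2_norm_sq b w u + 2 * C\<^sup>2 * W_end"
        using L2_integral_le[OF u order_refl x] W_le_end[OF w x] primitive_eq[OF b_pos w_loc x]
        by (intro add_mono mult_left_mono) (auto simp: A_def)
      finally show "integral {0..x} (\<lambda>x. (norm (R x))\<^sup>2 * w x) \<le> A * L2_norm_sq b w u + 2 * C\<^sup>2 * W_end" .
    qed
    then have "(\<lambda>x. (norm (R x))\<^sup>2 * w x) absolutely_integrable_on einterval 0 b" by (simp add: L1_def)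
    then have "L2 b w R" using R_meas by (simp add: L2_def)
    with lp w show False by (simp add: limit_point_def)
  qed
qed

lemma initial_product_le_L1:
  assumes gap: "scale_gap t d" and u: "L2 b w u" and h: "L2 b w h" and w: "L1 b w"
    and bc: "limit_point b w r \<or> ((\<lambda>y. v (real_of_ereal y)) \<longlongrightarrow> 0) (at_left b)"
  shows "(d / 12)\<^sup>2 * t\<^sup>2 * (1 - t) * ((norm (u 0))\<^sup>2 * (norm (v 0))\<^sup>2)
     \<le> 4 * (L2_norm_sq b w u * L2_norm_sq b w h)"
proof -
  note nn = L2_norm_sq_nonneg[OF u] L2_norm_sq_nonneg[OF h]
  show ?thesis
  proof (cases "v 0 = 0")
    case True
    then show ?thesis using nn by simp
  next
    case False
    have J0: "0 \<in> J" by (rule half_open_0[OF b_pos])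
    have dec: "(norm (v 0))\<^sup>2 \<le> L2_norm_sq b w h * W_end"
      using v_decay[OF u h w bc J0] W_0 by simp
    have v0: "(norm (v 0))\<^sup>2 > 0" using False by simp
    have pos: "L2_norm_sq b w h > 0"
      using dec v0 nn by (cases "L2_norm_sq b w h = 0") auto
    define s where "s = (norm (v 0) / 2)\<^sup>2 / L2_norm_sq b w h"
    have s0: "0 \<le> s" using pos by (simp add: s_def)
    have "(norm (v 0) / 2)\<^sup>2 = (norm (v 0))\<^sup>2 / 4" by (simp add: power_divide)
    with dec v0 have "(norm (v 0) / 2)\<^sup>2 < L2_norm_sq b w h * W_end" by linarith
    then have "s < W_end" using pos by (simp add: s_def pos_divide_less_eq mult.commute)
    then obtain x where x: "x \<in> J" "s < W x" by (rule less_W_end)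
    obtain X where X: "0 \<le> X" "X \<le> x" "W X = s" by (rule W_attains[OF x(1) s0 less_imp_le[OF x(2)]])
    have "L2_norm_sq b w h * W X = (norm (v 0) / 2)\<^sup>2" using X(3) pos by (simp add: s_def)
    then show ?thesis by (rule initial_product_le_if_attained[OF gap u h half_open_le[OF x(1) X(1,2)]])
  qed
qed

text \<open>If the boundary term stayed positive near \<open>b\<close>, then \<open>\<bar>u\<bar>\<^sup>2\<close>, whose derivative is \<open>2 r (u \<bullet> v)\<close>, would
  be nondecreasing there and could not be integrable against a weight of infinite mass.\<close>

lemma boundary_term_not_L1:
  assumes u: "L2 b w u" and w: "\<not> L1 b w" and "\<epsilon> > 0" and x0: "x0 \<in> J"
  shows "\<exists>x\<in>J. x0 \<le> x \<and> u x \<bullet> v x \<le> \<epsilon>"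
proof (rule ccontr)
  assume "\<not> ?thesis"
  then have pos: "0 < u x \<bullet> v x" if "x \<in> J" "x0 \<le> x" for x using that \<open>\<epsilon> > 0\<close> by force
  have x00: "0 \<le> x0" by (rule J_nonneg[OF x0])
  have "u x0 \<noteq> 0" using pos[OF x0] by auto
  then have m: "0 < (norm (u x0))\<^sup>2" by simp
  obtain X where X: "X \<in> J" "L2_norm_sq b w u / (norm (u x0))\<^sup>2 + W x0 < W X"
    using W_unbounded[OF w] by blast
  have "W x0 < W X" using X(2) L2_norm_sq_nonneg[OF u] m by (smt (verit) divide_nonneg_pos)
  then have xX: "x0 < X" using W_less_iff[OF x0 X(1)] by simp
  have "(norm (u x0))\<^sup>2 * (W X - W x0) \<le> integral {x0..X} (\<lambda>x. (norm (u x))\<^sup>2 * w x)"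
  proof (rule L2_norm_sq_ge[OF u x00 less_imp_le[OF xX] X(1)])
    fix s assume s: "x0 \<le> s" "s \<le> X"
    have sJ: "s \<in> J" using half_open_le[OF X(1) _ s(2)] s x00 by simp
    note id = norm_u_identity[OF x00 s(1) sJ]
    have "0 \<le> integral {x0..s} (\<lambda>t. r t * (2 * (u t \<bullet> v t)))"
    proof (rule integral_nonneg_AE_interval[OF id(1)])
      show "AE t\<in>{x0<..<s} in lebesgue. 0 \<le> r t * (2 * (u t \<bullet> v t))"
        using AE_einterval_Ioo[OF r_nonneg x00 sJ]
      proof eventually_elim
        case (elim t)
        show ?case
        proof
          assume t: "t \<in> {x0<..<s}"
          then have "0 < u t \<bullet> v t" using x00 by (intro pos half_open_le[OF sJ]) auto
          then show "0 \<le> r t * (2 * (u t \<bullet> v t))" using elim t by simp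
        qed
      qed
    qed
    then show "(norm (u x0))\<^sup>2 \<le> (norm (u s))\<^sup>2" using id(2) by linarith
  qed
  also have "\<dots> \<le> L2_norm_sq b w u" by (rule L2_integral_le[OF u x00 X(1)])
  finally show False using X(2) m by (simp add: field_simps)
qed

text \<open>If the boundary term stayed above \<open>\<epsilon>\<close> near \<open>b\<close>, then the decay of \<open>v\<close> would force
  \<open>\<bar>u\<bar>\<^sup>2 \<ge> \<epsilon>\<^sup>2 / (N (W(b) - W))\<close>, and the integral of \<open>\<bar>u\<bar>\<^sup>2 w\<close> over each neighbourhood of \<open>b\<close> would be
  bounded below by a positive constant. Here \<open>N\<close> is the squared norm of \<open>h\<close>.\<close>

lemma boundary_term_L1:
  assumes u: "L2 b w u" and h: "L2 b w h" and w: "L1 b w"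
    and bc: "limit_point b w r \<or> ((\<lambda>y. v (real_of_ereal y)) \<longlongrightarrow> 0) (at_left b)"
    and \<epsilon>: "\<epsilon> > 0" and x0: "x0 \<in> J"
  shows "\<exists>x\<in>J. x0 \<le> x \<and> u x \<bullet> v x \<le> \<epsilon>"
proof (rule ccontr)
  assume "\<not> ?thesis"
  then have gt: "\<epsilon> < u x \<bullet> v x" if "x \<in> J" "x0 \<le> x" for x using that by force
  define N where "N = L2_norm_sq b w h"
  have N: "0 \<le> N" unfolding N_def by (rule L2_norm_sq_nonneg[OF h])
  have x00: "0 \<le> x0" by (rule J_nonneg[OF x0])
  define \<eta> where "\<eta> = \<epsilon>\<^sup>2 / 2 / (N + 1)"
  have \<eta>: "\<eta> > 0" using \<epsilon> N by (simp add: \<eta>_def)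
  obtain x1 where x1: "x1 \<in> J" "\<And>x y. x1 \<le> x \<Longrightarrow> x \<le> y \<Longrightarrow> y \<in> J \<Longrightarrow>
      integral {x..y} (\<lambda>x. (norm (u x))\<^sup>2 * w x) < \<eta>"
    using L1_tail[OF b_pos L2_imp_L1[OF u] weighted_nonneg \<eta>] by blast
  define x2 where "x2 = max x0 x1"
  have x2: "x2 \<in> J" "x0 \<le> x2" "x1 \<le> x2" "0 \<le> x2" using x0 x1 x00 by (auto simp: x2_def max_def)
  define l where "l = W_end - W x2"
  have l: "l > 0" using W_less_end[OF w x2(1)] by (simp add: l_def)
  have "W x2 + l / 2 < W_end" using l by (simp add: l_def field_simps)
  then obtain X where X: "X \<in> J" "W x2 + l / 2 < W X" by (rule less_W_end)
  have "W x2 < W X" using X(2) l by simp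
  then have xX: "x2 < X" using W_less_iff[OF x2(1) X(1)] by simp
  have ge: "\<epsilon>\<^sup>2 \<le> (norm (u s))\<^sup>2 * (N * l)" if s: "x2 \<le> s" "s \<le> X" for s
  proof -
    have sJ: "s \<in> J" using half_open_le[OF X(1) _ s(2)] s x2 by simp
    have "\<epsilon> < u s \<bullet> v s" using s x2 by (intro gt sJ) auto
    also have "\<dots> \<le> norm (u s) * norm (v s)" by (rule norm_cauchy_schwarz)
    finally have "\<epsilon>\<^sup>2 \<le> (norm (u s) * norm (v s))\<^sup>2" using \<epsilon> by (intro power_mono) auto
    also have "\<dots> = (norm (u s))\<^sup>2 * (norm (v s))\<^sup>2" by (simp add: power_mult_distrib)
    also have "\<dots> \<le> (norm (u s))\<^sup>2 * (N * (W_end - W s))"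
      unfolding N_def by (intro mult_left_mono v_decay[OF u h w bc sJ]) auto
    also have "\<dots> \<le> (norm (u s))\<^sup>2 * (N * l)"
      using W_le[OF x2(4) s(1) sJ] N by (intro mult_left_mono) (auto simp: l_def)
    finally show ?thesis .
  qed
  have Nl: "0 < N * l" using ge[of x2] xX \<epsilon> N l by (cases "N = 0") auto
  then have Npos: "0 < N" using l by (simp add: zero_less_mult_iff)
  have "\<epsilon>\<^sup>2 / (N * l) * (W X - W x2) \<le> integral {x2..X} (\<lambda>x. (norm (u x))\<^sup>2 * w x)"
  proof (rule L2_norm_sq_ge[OF u x2(4) less_imp_le[OF xX] X(1)])
    fix s assume "x2 \<le> s" "s \<le> X"
    from ge[OF this] show "\<epsilon>\<^sup>2 / (N * l) \<le> (norm (u s))\<^sup>2" using Nl by (simp add: pos_divide_le_eq)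
  qed
  also have "\<dots> < \<eta>" using xX by (intro x1(2) x2 X(1)) auto
  finally have 1: "\<epsilon>\<^sup>2 / (N * l) * (W X - W x2) < \<eta>" .
  have "\<epsilon>\<^sup>2 / (N * l) * (l / 2) \<le> \<epsilon>\<^sup>2 / (N * l) * (W X - W x2)"
    using X(2) Nl by (intro mult_left_mono) auto
  moreover have "\<epsilon>\<^sup>2 / (N * l) * (l / 2) = \<epsilon>\<^sup>2 / 2 / N" using l Npos by simp
  moreover have "\<eta> \<le> \<epsilon>\<^sup>2 / 2 / N" unfolding \<eta>_def using Npos by (intro divide_left_mono) auto
  ultimately show False using 1 by linarith
qed

text \<open>Integration by parts up to points at which the boundary term is at most \<open>\<epsilon>\<close>.\<close>

lemma energy_bound:
  assumes u: "L2 b w u" and h: "L2 b w h" and e: "e > 0"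
    and init: "e * ((norm (u 0))\<^sup>2 * (norm (v 0))\<^sup>2) \<le> 4 * (L2_norm_sq b w u * L2_norm_sq b w h)"
    and bdry: "\<And>\<epsilon> x0. \<epsilon> > 0 \<Longrightarrow> x0 \<in> J \<Longrightarrow> \<exists>x\<in>J. x0 \<le> x \<and> u x \<bullet> v x \<le> \<epsilon>"
    and x: "x \<in> J"
  shows "integral {0..x} (\<lambda>t. r t * (norm (v t))\<^sup>2)
     \<le> (1 + 2 / sqrt e) * sqrt (L2_norm_sq b w u * L2_norm_sq b w h)"
proof (rule field_le_epsilon)
  fix \<epsilon> :: real assume "\<epsilon> > 0"
  define Q where "Q = L2_norm_sq b w u * L2_norm_sq b w h"
  have Q: "0 \<le> Q" unfolding Q_def by (intro mult_nonneg_nonneg L2_norm_sq_nonneg u h)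
  obtain y where y: "y \<in> J" "x \<le> y" "u y \<bullet> v y \<le> \<epsilon>" using bdry[OF \<open>\<epsilon> > 0\<close> x] by blast
  have y0: "0 \<le> y" by (rule J_nonneg[OF y(1)])
  have x0: "0 \<le> x" by (rule J_nonneg[OF x])
  have "integral {0..x} (\<lambda>t. r t * (norm (v t))\<^sup>2) + integral {x..y} (\<lambda>t. r t * (norm (v t))\<^sup>2)
     = integral {0..y} (\<lambda>t. r t * (norm (v t))\<^sup>2)"
    by (intro Henstock_Kurzweil_Integration.integral_combine x0 y(2) energy_int order_refl y(1))
  moreover have "0 \<le> integral {x..y} (\<lambda>t. r t * (norm (v t))\<^sup>2)"
    by (rule integral_nonneg_AE_interval[OF energy_int[OF x0 y(1)]])
       (use AE_einterval_Ioo[OF r_nonneg x0 y(1)] in \<open>eventually_elim, simp\<close>)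
  ultimately have "integral {0..x} (\<lambda>t. r t * (norm (v t))\<^sup>2) \<le> integral {0..y} (\<lambda>t. r t * (norm (v t))\<^sup>2)"
    by simp
  also have "\<dots> = u y \<bullet> v y - u 0 \<bullet> v 0 - integral {0..y} (\<lambda>t. w t * (u t \<bullet> h t))"
    using energy_identity(2)[OF order_refl y(1) y0] by simp
  also have "\<dots> \<le> \<epsilon> + norm (u 0) * norm (v 0) + sqrt Q"
  proof -
    have "\<bar>integral {0..y} (\<lambda>t. w t * (u t \<bullet> h t))\<bar> \<le> sqrt Q"
      using cross_term_le[OF u h order_refl y(1)] unfolding Q_def by (rule real_le_rsqrt[of "\<bar>_\<bar>", unfolded power2_abs])
    then show ?thesis using y(3) Cauchy_Schwarz_ineq2[of "u 0" "v 0"] by linarith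
  qed
  also have "norm (u 0) * norm (v 0) \<le> 2 / sqrt e * sqrt Q"
  proof -
    have "(norm (u 0) * norm (v 0))\<^sup>2 \<le> 4 * Q / e"
      using init e by (simp add: Q_def power_mult_distrib field_simps)
    also have "\<dots> = (2 / sqrt e * sqrt Q)\<^sup>2" using e Q by (simp add: power_mult_distrib power_divide)
    finally show ?thesis by (rule power2_le_imp_le) (use e Q in simp)
  qed
  finally show "integral {0..x} (\<lambda>t. r t * (norm (v t))\<^sup>2) \<le>
    (1 + 2 / sqrt e) * sqrt (L2_norm_sq b w u * L2_norm_sq b w h) + \<epsilon>"
    by (simp add: Q_def algebra_simps)
qed

end

section \<open>The inequality follows from the scale gap\<close>

text \<open>The inequality for a single function \<open>f\<close> and constant \<open>K\<close>.\<close>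

definition HELP_inequality ::
  "ereal \<Rightarrow> (real \<Rightarrow> real) \<Rightarrow> (real \<Rightarrow> real) \<Rightarrow> real \<Rightarrow> (real \<Rightarrow> complex) \<Rightarrow> bool" where
  "HELP_inequality b w r K f \<longleftrightarrow>
     (\<integral>\<^sup>+x\<in>einterval 0 b. ennreal (1 / r x * (norm (vector_derivative f (at x)))\<^sup>2) \<partial>lebesgue)\<^sup>2
     \<le> ennreal (K\<^sup>2)
       * (\<integral>\<^sup>+x\<in>einterval 0 b. ennreal ((norm (f x))\<^sup>2 * w x) \<partial>lebesgue)
       * (\<integral>\<^sup>+x\<in>einterval 0 b.
            ennreal (1 / w x * (norm (vector_derivative (quasi_deriv b r f) (at x)))\<^sup>2) \<partial>lebesgue)"

lemma H_valid_alt: "H_valid b w r \<longleftrightarrow> (\<exists>K>0. \<forall>f\<in>dom_A b w r. HELP_inequality b w r K f)"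
  unfolding H_valid_def HELP_inequality_def ..

lemma power2_ennreal: "0 \<le> x \<Longrightarrow> (ennreal x)\<^sup>2 = ennreal (x\<^sup>2)"
  by (simp add: ennreal_power)

context weights
begin

lemma dom_A_quasi_system:
  assumes "f \<in> dom_A b w r"
  shows "quasi_system b w r f (quasi_deriv b r f) (\<lambda>x. vector_derivative (quasi_deriv b r f) (at x) /\<^sub>R w x)"
proof -
  let ?v = "quasi_deriv b r f"
  have q: "is_quasi_deriv b r f ?v"
    using assms unfolding quasi_deriv_def by (intro someI_ex[of "is_quasi_deriv b r f"]) (simp add: dom_A_def)
  have f: "AC_loc b f" using assms by (simp add: dom_A_def)
  have v: "AC_loc b ?v" using q by (simp add: is_quasi_deriv_def)
  have der: "AE x\<in>einterval 0 b in lebesgue. (g has_vector_derivative vector_derivative g (at x)) (at x)"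
    if "AC_loc b g" for g :: "real \<Rightarrow> complex"
  proof (rule AE_einterval_if_local[OF b_pos])
    fix c :: real assume c: "0 < c" "ereal c < b"
    then have "abs_continuous_on {0..c} g" using that by (simp add: AC_loc_def)
    then show "AE x\<in>{0<..<c} in lebesgue.
        (g has_vector_derivative vector_derivative g (at x)) (at x)"
      by (rule abs_continuous_FTC(1)[OF less_imp_le[OF c(1)]])
  qed
  have "AE x\<in>einterval 0 b in lebesgue. ?v x = vector_derivative f (at x) /\<^sub>R r x"
    using q by (simp add: is_quasi_deriv_def)
  with der[OF f] r_pos have "AE x\<in>einterval 0 b in lebesgue. (f has_vector_derivative r x *\<^sub>R ?v x) (at x)"
    by eventually_elim auto
  moreover from der[OF v] w_pos have "AE x\<in>einterval 0 b in lebesgue.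
     (?v has_vector_derivative w x *\<^sub>R (vector_derivative ?v (at x) /\<^sub>R w x)) (at x)"
    by eventually_elim auto
  ultimately show ?thesis using f v by (simp add: quasi_system_def)
qed

end

context quasi_solution
begin

lemma AE_energy_density:
  "AE x\<in>einterval 0 b in lebesgue. 1 / r x * (norm (vector_derivative u (at x)))\<^sup>2 = r x * (norm (v x))\<^sup>2"
  using u_der r_pos
  by eventually_elim (auto simp: vector_derivative_at power_mult_distrib power2_eq_square)

lemma energy_nn_integral:
  "(\<integral>\<^sup>+x\<in>einterval 0 b. ennreal (1 / r x * (norm (vector_derivative u (at x)))\<^sup>2) \<partial>lebesgue)
   = (\<integral>\<^sup>+x\<in>einterval 0 b. ennreal (r x * (norm (v x))\<^sup>2) \<partial>lebesgue)"
  by (intro nn_integral_cong_AE, use AE_energy_density in eventually_elim) (auto simp: indicator_def)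

lemma energy_L1_loc: "L1_loc b (\<lambda>t. r t * (norm (v t))\<^sup>2)"
  unfolding L1_loc_def by (auto intro!: energy_abs_int simp: half_open_def)

lemma energy_nonneg: "AE x\<in>einterval 0 b in lebesgue. 0 \<le> r x * (norm (v x))\<^sup>2"
  using r_nonneg by eventually_elim auto

end

context weights
begin

text \<open>The energy bound gives the inequality with a constant that depends on \<open>t\<close> and \<open>d\<close> alone, whether or
  not \<open>w\<close> is integrable; the two cases differ in the proofs of the initial and boundary estimates.\<close>

theorem H_valid_if_scale_gap:
  assumes gap: "scale_gap t d"
  shows "H_valid b w r"
proof -
  define e where "e = (d / 12)\<^sup>2 * t\<^sup>2 * (1 - t)"
  have e: "e > 0" using gap by (simp add: scale_gap_def e_def)
  define K where "K = 1 + 2 / sqrt e"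
  have K: "K > 0" using e by (simp add: K_def add_pos_nonneg)
  have "HELP_inequality b w r K f" if f: "f \<in> dom_A b w r" for f
  proof -
    define v where "v = quasi_deriv b r f"
    define h where "h = (\<lambda>x. vector_derivative v (at x) /\<^sub>R w x)"
    interpret quasi_solution b w r f v h
      using dom_A_quasi_system[OF f] by unfold_locales (simp add: v_def h_def)
    have u2: "L2 b w f" and h2: "L2 b w h" using f by (auto simp: dom_A_def v_def h_def)
    have bc: "limit_point b w r \<or> ((\<lambda>y. v (real_of_ereal y)) \<longlongrightarrow> 0) (at_left b)"
      using f by (auto simp: dom_A_def v_def)
    let ?Q = "L2_norm_sq b w f * L2_norm_sq b w h"
    have Q: "0 \<le> ?Q" by (intro mult_nonneg_nonneg L2_norm_sq_nonneg u2 h2)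
    have init: "e * ((norm (f 0))\<^sup>2 * (norm (v 0))\<^sup>2) \<le> 4 * ?Q"
      unfolding e_def
      using initial_product_le_L1[OF gap u2 h2 _ bc] initial_product_le_not_L1[OF gap u2 h2] by blast
    have bdry: "\<exists>x\<in>J. x0 \<le> x \<and> f x \<bullet> v x \<le> \<epsilon>" if "\<epsilon> > 0" "x0 \<in> J" for \<epsilon> x0
      using boundary_term_L1[OF u2 h2 _ bc that] boundary_term_not_L1[OF u2 _ that] by blast
    have "(\<integral>\<^sup>+x\<in>einterval 0 b. ennreal (r x * (norm (v x))\<^sup>2) \<partial>lebesgue) \<le> ennreal (K * sqrt ?Q)"
      unfolding K_def
      by (rule set_nn_integral_einterval_le[OF b_pos energy_L1_loc energy_nonneg])
         (rule energy_bound[OF u2 h2 e init bdry])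
    then have "(\<integral>\<^sup>+x\<in>einterval 0 b. ennreal (1 / r x * (norm (vector_derivative f (at x)))\<^sup>2) \<partial>lebesgue)\<^sup>2
       \<le> (ennreal (K * sqrt ?Q))\<^sup>2"
      unfolding energy_nn_integral by (intro power_mono) auto
    also have "\<dots> = ennreal (K\<^sup>2 * L2_norm_sq b w f * L2_norm_sq b w h)"
      using K Q by (simp add: power2_ennreal power_mult_distrib mult.assoc)
    also have "\<dots> = ennreal (K\<^sup>2) * ennreal (L2_norm_sq b w f) * ennreal (L2_norm_sq b w h)"
      using L2_norm_sq_nonneg[OF u2] L2_norm_sq_nonneg[OF h2] by (simp add: ennreal_mult)
    also have "ennreal (L2_norm_sq b w h) = (\<integral>\<^sup>+x\<in>einterval 0 b.
            ennreal (1 / w x * (norm (vector_derivative (quasi_deriv b r f) (at x)))\<^sup>2) \<partial>lebesgue)"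
      unfolding L2_nn_integral[OF h2, symmetric]
      by (intro nn_integral_cong_AE, use w_pos in eventually_elim)
         (auto simp: indicator_def h_def v_def power_mult_distrib power2_eq_square field_simps)
    finally show ?thesis by (simp only: HELP_inequality_def L2_nn_integral[OF u2])
  qed
  with K show ?thesis unfolding H_valid_alt by blast
qed

end

section \<open>Solutions of the system as elements of the domain\<close>

text \<open>An indefinite integral of a real function, regarded as a complex-valued function.\<close>

lemma AC_loc_from_derivative:
  assumes b: "0 < b" and g: "L1_loc b g" and f: "\<And>x. x \<in> half_open b \<Longrightarrow> f x = f 0 + integral {0..x} g"
  shows "AC_loc b (\<lambda>x. complex_of_real (f x))"
    and "AE x\<in>einterval 0 b in lebesgue.
      ((\<lambda>x. complex_of_real (f x)) has_vector_derivative complex_of_real (g x)) (at x)"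
proof -
  have ai: "g absolutely_integrable_on {0..c}" if "0 < c" "ereal c < b" for c
    using that g by (simp add: L1_loc_def)
  have f': "f x = f 0 + integral {0..x} g" if "0 < c" "ereal c < b" "x \<in> {0..c}" for c x
  proof -
    have "c \<in> half_open b" using that by (simp add: half_open_def)
    then have "x \<in> half_open b" by (rule half_open_le) (use that in auto)
    then show ?thesis by (rule f)
  qed
  show "AC_loc b (\<lambda>x. complex_of_real (f x))"
    unfolding AC_loc_def
    by (intro allI impI abs_continuous_on_complex_of_real
         abs_continuous_on_cong[OF f' abs_continuous_on_integral[OF ai]])
  show "AE x\<in>einterval 0 b in lebesgue.
      ((\<lambda>x. complex_of_real (f x)) has_vector_derivative complex_of_real (g x)) (at x)"
  proof (rule AE_einterval_if_local[OF b])
    fix c :: real assume c: "0 < c" "ereal c < b"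
    have "AE x\<in>{0<..<c} in lebesgue. (f has_vector_derivative g x) (at x)"
      by (rule has_vector_derivative_integral_AE[OF set_lebesgue_integral_eq_integral(1)[OF ai[OF c]] f'[OF c]])
    then show "AE x\<in>{0<..<c} in lebesgue.
      ((\<lambda>x. complex_of_real (f x)) has_vector_derivative complex_of_real (g x)) (at x)"
      by eventually_elim (auto intro: bounded_linear.has_vector_derivative[OF bounded_linear_of_real])
  qed
qed

lemma AE_eq_imp_eq_on_einterval:
  fixes f g :: "real \<Rightarrow> complex"
  assumes b: "0 < b" and f: "AC_loc b f" and g: "AC_loc b g"
    and eq: "AE x\<in>einterval 0 b in lebesgue. f x = g x" and x: "x \<in> einterval 0 b"
  shows "f x = g x"
proof (rule ccontr)
  assume ne: "f x \<noteq> g x"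
  have cont: "continuous_on (einterval 0 b) (\<lambda>x. f x - g x)"
    using AC_loc_continuous_on[OF b f] AC_loc_continuous_on[OF b g]
    by (intro continuous_on_einterval[OF b] continuous_intros)
  define S where "S = einterval 0 b \<inter> (\<lambda>x. f x - g x) -` (- {0})"
  have "open S" unfolding S_def by (rule continuous_open_preimage[OF cont]) auto
  moreover have "negligible S"
  proof -
    obtain N where N: "negligible N" "{x. \<not> (x \<in> einterval 0 b \<longrightarrow> f x = g x)} \<subseteq> N"
      using eq unfolding eventually_ae_filter_negligible by blast
    show ?thesis by (rule negligible_subset[OF N(1)]) (use N(2) in \<open>auto simp: S_def\<close>)
  qed
  moreover have "S \<noteq> {}" using x ne by (auto simp: S_def)
  ultimately show False using open_not_negligible by blast
qed

lemma measurable_AE_lebesgue_on: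
  fixes f g :: "real \<Rightarrow> complex"
  assumes "f \<in> borel_measurable (lebesgue_on S)" "S \<in> sets lebesgue"
    and "AE x\<in>S in lebesgue. g x = f x"
  shows "g \<in> borel_measurable (lebesgue_on S)"
proof -
  obtain N where N: "negligible N" "{x. \<not> (x \<in> S \<longrightarrow> g x = f x)} \<subseteq> N"
    using assms(3) unfolding eventually_ae_filter_negligible by blast
  have "f measurable_on S" using assms(1,2) by (simp add: measurable_on_iff_borel_measurable)
  then have "g measurable_on S" by (rule measurable_on_spike[OF _ N(1)]) (use N(2) in auto)
  then show ?thesis using assms(2) by (simp add: measurable_on_iff_borel_measurable)
qed

context quasi_solution
begin

lemma is_quasi_deriv_v: "is_quasi_deriv b r u v"
  unfolding is_quasi_deriv_def
  using v_AC u_der r_pos by (auto elim!: eventually_elim2 simp: vector_derivative_at)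

text \<open>The chosen quasi-derivative equals \<open>v\<close> almost everywhere, hence everywhere on \<open>(0, b)\<close> by continuity.\<close>

lemma quasi_deriv_eq_v:
  assumes "x \<in> einterval 0 b"
  shows "quasi_deriv b r u x = v x"
proof -
  have q: "is_quasi_deriv b r u (quasi_deriv b r u)"
    unfolding quasi_deriv_def by (rule someI[of _ v]) (rule is_quasi_deriv_v)
  show ?thesis
  proof (rule AE_eq_imp_eq_on_einterval[OF b_pos _ v_AC _ assms])
    show "AC_loc b (quasi_deriv b r u)" using q by (simp add: is_quasi_deriv_def)
    from q is_quasi_deriv_v
    have "AE x\<in>einterval 0 b in lebesgue. quasi_deriv b r u x = vector_derivative u (at x) /\<^sub>R r x"
      "AE x\<in>einterval 0 b in lebesgue. v x = vector_derivative u (at x) /\<^sub>R r x"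
      by (simp_all add: is_quasi_deriv_def)
    then show "AE x\<in>einterval 0 b in lebesgue. quasi_deriv b r u x = v x"
      by eventually_elim auto
  qed
qed

lemma vector_derivative_quasi_deriv:
  "AE x\<in>einterval 0 b in lebesgue. vector_derivative (quasi_deriv b r u) (at x) = w x *\<^sub>R h x"
  using v_der
proof eventually_elim
  case (elim x)
  show ?case
  proof
    assume x: "x \<in> einterval 0 b"
    have "(quasi_deriv b r u has_vector_derivative w x *\<^sub>R h x) (at x)"
      by (rule has_vector_derivative_transform_within_open[of v _ _ "einterval 0 b"])
         (use elim x quasi_deriv_eq_v in auto)
    then show "vector_derivative (quasi_deriv b r u) (at x) = w x *\<^sub>R h x" by (rule vector_derivative_at)
  qed
qed

text \<open>A solution of the system with a quasi-derivative that vanishes near the right endpoint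
  belongs to the domain.\<close>

lemma in_dom_A:
  assumes u: "L2 b w u" and h: "L2 b w h" and x: "x \<in> J" and v0: "\<And>y. y \<in> J \<Longrightarrow> x \<le> y \<Longrightarrow> v y = 0"
  shows "u \<in> dom_A b w r"
proof -
  let ?h = "\<lambda>x. vector_derivative (quasi_deriv b r u) (at x) /\<^sub>R w x"
  have eq: "AE x\<in>einterval 0 b in lebesgue. ?h x = h x"
    using vector_derivative_quasi_deriv w_pos by eventually_elim auto
  have "L2 b w ?h"
    unfolding L2_def
  proof
    show "?h \<in> borel_measurable (lebesgue_on (einterval 0 b))"
      by (rule measurable_AE_lebesgue_on[OF _ _ eq]) (use h in \<open>auto simp: L2_def\<close>)
    obtain N where N: "negligible N" "{x. \<not> (x \<in> einterval 0 b \<longrightarrow> ?h x = h x)} \<subseteq> N"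
      using eq unfolding eventually_ae_filter_negligible by blast
    have "(\<lambda>x. (norm (h x))\<^sup>2 * w x) absolutely_integrable_on einterval 0 b" using h by (simp add: L2_def)
    then show "(\<lambda>x. (norm (?h x))\<^sup>2 * w x) absolutely_integrable_on einterval 0 b"
    proof (rule absolutely_integrable_spike[OF _ N(1)])
      fix x assume "x \<in> einterval 0 b - N"
      then have "?h x = h x" using N(2) by blast
      then show "(norm (?h x))\<^sup>2 * w x = (norm (h x))\<^sup>2 * w x" by (simp only:)
    qed
  qed
  moreover have "((\<lambda>y. quasi_deriv b r u (real_of_ereal y)) \<longlongrightarrow> 0) (at_left b)"
  proof (rule tendsto_eventually)
    have "ereal x < b" using x by (simp add: half_open_def)
    moreover have "quasi_deriv b r u (real_of_ereal y) = 0" if y: "ereal x < y" "y < b" for y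
    proof -
      obtain z where z: "y = ereal z" using y by (cases y) auto
      then have "z \<in> einterval 0 b" "z \<in> J" "x \<le> z"
        using y J_nonneg[OF x] by (auto simp: einterval_iff half_open_def)
      then show ?thesis using z quasi_deriv_eq_v[of z] v0[of z] by simp
    qed
    ultimately show "\<forall>\<^sub>F y in at_left b. quasi_deriv b r u (real_of_ereal y) = 0"
      by (auto simp: eventually_at_left)
  qed
  ultimately show ?thesis
    using u u_AC is_quasi_deriv_v by (auto simp: dom_A_def)
qed

lemma quasi_deriv_nn_integral:
  "(\<integral>\<^sup>+x\<in>einterval 0 b. ennreal (1 / w x * (norm (vector_derivative (quasi_deriv b r u) (at x)))\<^sup>2) \<partial>lebesgue)
   = (\<integral>\<^sup>+x\<in>einterval 0 b. ennreal ((norm (h x))\<^sup>2 * w x) \<partial>lebesgue)"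
proof (intro nn_integral_cong_AE, use vector_derivative_quasi_deriv w_pos in eventually_elim)
  case (elim x)
  then show ?case
    by (auto simp: indicator_def power_mult_distrib power2_eq_square field_simps)
qed

end

lemma set_nn_integral_einterval_ge:
  fixes \<phi> :: "real \<Rightarrow> real"
  assumes b: "0 < b" and loc: "L1_loc b \<phi>"
    and nn: "AE x\<in>einterval 0 b in lebesgue. 0 \<le> \<phi> x" and y: "y \<in> half_open b"
  shows "ennreal (integral {0..y} \<phi>) \<le> (\<integral>\<^sup>+x\<in>einterval 0 b. ennreal (\<phi> x) \<partial>lebesgue)"
proof -
  have xy: "AE t in lebesgue. t \<noteq> 0 \<and> t \<noteq> y"
    by (auto simp: eventually_ae_filter_negligible intro!: exI[of _ "{0, y}"])
  have "ennreal (integral {0..y} \<phi>) = (\<integral>\<^sup>+t\<in>{0..y}. ennreal (\<phi> t) \<partial>lebesgue)"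
    by (rule set_nn_integral_Icc[symmetric, OF L1_loc_imp_absolutely_integrable[OF b loc order_refl y]
         AE_einterval_Ioo[OF nn order_refl y]])
  also have "\<dots> \<le> (\<integral>\<^sup>+x\<in>einterval 0 b. ennreal (\<phi> x) \<partial>lebesgue)"
    by (intro nn_integral_mono_AE, use xy in eventually_elim)
       (use subsetD[OF Ioo_subset_einterval[OF order_refl y]] in \<open>auto simp: indicator_def\<close>)
  finally show ?thesis .
qed

section \<open>The inequality implies the scale gap\<close>

lemma L1_loc_cmult: "L1_loc b f \<Longrightarrow> L1_loc b (\<lambda>s. c * f s)"
  unfolding L1_loc_def by (intro allI impI set_integrable_mult_right) simp

context weights
begin

lemma weighted_integral_le:
  fixes f :: "real \<Rightarrow> complex"
  assumes i: "(\<lambda>x. (norm (f x))\<^sup>2 * w x) integrable_on {p..q}" and pq: "0 \<le> p" "p \<le> q" "q \<in> J"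
    and m: "\<And>s. s \<in> {p<..<q} \<Longrightarrow> (norm (f s))\<^sup>2 \<le> m"
  shows "integral {p..q} (\<lambda>x. (norm (f x))\<^sup>2 * w x) \<le> m * (W q - W p)"
proof -
  have "integral {p..q} (\<lambda>x. (norm (f x))\<^sup>2 * w x) \<le> integral {p..q} (\<lambda>s. m * w s)"
  proof (rule integral_mono_AE_interval[OF i])
    show "(\<lambda>s. m * w s) integrable_on {p..q}" by (intro integrable_on_mult_right w_int pq)
    show "AE s\<in>{p<..<q} in lebesgue. (norm (f s))\<^sup>2 * w s \<le> m * w s"
      using AE_einterval_Ioo[OF w_nonneg pq(1,3)] by eventually_elim (auto intro!: mult_right_mono m)
  qed
  also have "\<dots> = m * (W q - W p)" using W_diff[OF pq] by simp
  finally show ?thesis .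
qed

text \<open>Truncation of the weight \<open>w\<close> at \<open>x\<close>.\<close>

lemma truncated_weight:
  assumes x: "x \<in> J"
  shows "L1_loc b (\<lambda>s. if s \<le> x then w s else 0)"
    and "\<And>y. y \<in> J \<Longrightarrow> integral {0..y} (\<lambda>s. if s \<le> x then w s else 0) = W (min y x)"
proof -
  let ?f = "\<lambda>s. if s \<le> x then w s else 0"
  have eq: "(\<lambda>s. indicat_real {0..y} s *\<^sub>R ?f s) = (\<lambda>s. indicat_real {0..min y x} s *\<^sub>R w s)" for y
    by (auto simp: indicator_def)
  have mJ: "min y x \<in> J" if "y \<in> J" for y using that x by (simp add: min_def)
  have ai: "w absolutely_integrable_on {0..min y x}" if "y \<in> J" for y
    by (rule L1_loc_imp_absolutely_integrable[OF b_pos w_loc order_refl mJ[OF that]])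
  have ai': "?f absolutely_integrable_on {0..y}" if "y \<in> J" for y
    using ai[OF that] unfolding set_integrable_def eq .
  show "L1_loc b ?f" unfolding L1_loc_def by (auto intro!: ai' simp: half_open_def)
  fix y assume y: "y \<in> J"
  have "integral {0..y} ?f = set_lebesgue_integral lebesgue {0..y} ?f"
    by (rule set_lebesgue_integral_eq_integral(2)[OF ai'[OF y], symmetric])
  also have "\<dots> = W (min y x)"
    unfolding primitive_def set_lebesgue_integral_def eq ..
  finally show "integral {0..y} ?f = W (min y x)" .
qed

text \<open>The test functions: the quasi-derivative decreases linearly in \<open>W\<close> from \<open>1\<close> at \<open>0\<close> to
  \<open>0\<close> at \<open>x\<close> and vanishes from there on.\<close>

lemma energy_inequality_test_function:
  assumes K: "K > 0" and H: "\<And>f. f \<in> dom_A b w r \<Longrightarrow> HELP_inequality b w r K f"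
    and x: "x \<in> J" "0 < x" and y: "0 \<le> y" "y \<le> x"
  shows "((1 - W y / W x)\<^sup>2 * R y)\<^sup>2
    \<le> K\<^sup>2 * ((R x)\<^sup>2 * W y + (R x - R y)\<^sup>2 * (W x - W y)) / W x"
proof -
  have Wx: "0 < W x" by (rule W_pos[OF x(2,1)])
  have x0: "0 \<le> x" using x(2) by simp
  have yJ: "y \<in> J" by (rule half_open_le[OF x(1) y])
  define wx where "wx s = (if s \<le> x then w s else 0)" for s
  note wx_loc = truncated_weight(1)[OF x(1), folded wx_def]
  note wx_int = truncated_weight(2)[OF x(1), folded wx_def]
  define hR where "hR s = (if s \<le> x then - 1 / W x else 0)" for s
  define vR where "vR s = 1 - W (min s x) / W x" for s
  have vR0: "vR 0 = 1" using W_0 x by (simp add: vR_def)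
  have whR: "(\<lambda>s. w s * hR s) = (\<lambda>s. (- 1 / W x) * wx s)" by (auto simp: hR_def wx_def)
  have wh_loc: "L1_loc b (\<lambda>s. w s * hR s)"
    unfolding whR by (rule L1_loc_cmult[OF wx_loc])
  have vR_eq: "vR s = vR 0 + integral {0..s} (\<lambda>s. w s * hR s)" if "s \<in> J" for s
    unfolding whR vR0 using wx_int[OF that] by (simp add: vR_def)
  note v = AC_loc_from_derivative[OF b_pos wh_loc vR_eq]
  have vR_cont: "continuous_on {0..c} vR" if "c \<in> J" for c
  proof -
    have "continuous_on {0..c} (\<lambda>s. complex_of_real (vR s))" by (rule AC_loc_continuous_on[OF b_pos v(1) that])
    then have "continuous_on {0..c} (\<lambda>s. Re (complex_of_real (vR s)))" by (rule continuous_on_Re)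
    then show ?thesis by simp
  qed
  have rv_loc: "L1_loc b (\<lambda>s. r s * vR s)"
    unfolding L1_loc_def
  proof (intro allI impI)
    fix c :: real assume "0 < c" "ereal c < b"
    then have c: "c \<in> J" by (simp add: half_open_def)
    have "(\<lambda>s. vR s * r s) absolutely_integrable_on {0..c}"
      by (rule abs_integrable_times_continuous[OF vR_cont[OF c]
           L1_loc_imp_absolutely_integrable[OF b_pos r_loc order_refl c]])
    then show "(\<lambda>s. r s * vR s) absolutely_integrable_on {0..c}" by (simp add: mult.commute)
  qed
  define uR where "uR s = integral {0..s} (\<lambda>s. r s * vR s) - integral {0..x} (\<lambda>s. r s * vR s)" for s
  have uR_eq: "uR s = uR 0 + integral {0..s} (\<lambda>s. r s * vR s)" for s by (simp add: uR_def)
  note u = AC_loc_from_derivative[OF b_pos rv_loc uR_eq]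
  define U where "U s = complex_of_real (uR s)" for s
  define V where "V s = complex_of_real (vR s)" for s
  define h where "h s = complex_of_real (hR s)" for s
  have sys: "quasi_system b w r U V h"
    unfolding quasi_system_def U_def V_def h_def
    using u v by (simp add: scaleR_conv_of_real)
  interpret quasi_solution b w r U V h by unfold_locales (rule sys)
  have V0: "V s = 0" if "x \<le> s" for s using that Wx by (simp add: V_def vR_def min_def)
  have V_range: "0 \<le> vR s" "vR s \<le> 1" if "s \<in> J" for s
  proof -
    have m: "min s x \<in> J" "0 \<le> min s x" using that x J_nonneg[OF that] by (auto simp: min_def)
    show "0 \<le> vR s" using W_le[OF m(2) _ x(1)] Wx by (simp add: vR_def)
    show "vR s \<le> 1" using W_nonneg[OF m(1)] Wx by (simp add: vR_def)
  qed
  have Ux: "U x = 0" by (simp add: U_def uR_def)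
  have U0: "U s = 0" if "x \<le> s" "s \<in> J" for s
  proof -
    have "norm (U s - U x) \<le> 0 * (R s - R x)"
      using V0 by (intro u_increment_le x0 that) auto
    then show ?thesis using Ux by simp
  qed
  have U_le: "norm (U s) \<le> R x - R s" if s: "0 \<le> s" "s \<le> x" for s
  proof -
    have "norm (U x - U s) \<le> 1 * (R x - R s)"
      using s x V_range half_open_le[OF x(1)] by (intro u_increment_le) (auto simp: V_def)
    then show ?thesis using Ux by simp
  qed
  \<comment> \<open>\<open>\<bar>U\<bar>\<close> is at most \<open>R x\<close> on \<open>[0, y]\<close> and at most \<open>R x - R y\<close> on \<open>[y, x]\<close>.\<close>
  define M where "M = (R x)\<^sup>2 * W y + (R x - R y)\<^sup>2 * (W x - W y)"
  have M0: "0 \<le> M"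
    unfolding M_def using W_nonneg[OF yJ] W_le[OF y x(1)] by (intro add_nonneg_nonneg mult_nonneg_nonneg) auto
  have Uw_loc: "L1_loc b (\<lambda>s. (norm (U s))\<^sup>2 * w s)"
    unfolding L1_loc_def
  proof (intro allI impI)
    fix c :: real assume "0 < c" "ereal c < b"
    then have "c \<in> J" by (simp add: half_open_def)
    then show "(\<lambda>s. (norm (U s))\<^sup>2 * w s) absolutely_integrable_on {0..c}"
      by (intro abs_integrable_times_continuous L1_loc_imp_absolutely_integrable[OF b_pos w_loc]
          continuous_intros u_continuous) auto
  qed
  have Uw_int: "(\<lambda>s. (norm (U s))\<^sup>2 * w s) integrable_on {p..q}" if "0 \<le> p" "q \<in> J" for p q
    by (rule L1_loc_imp_integrable[OF b_pos Uw_loc that])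
  have Uw_le: "integral {0..X} (\<lambda>s. (norm (U s))\<^sup>2 * w s) \<le> M" if X: "X \<in> J" for X
  proof -
    let ?f = "\<lambda>s. (norm (U s))\<^sup>2 * w s"
    define X' where "X' = max X x"
    have X': "X' \<in> J" "X \<le> X'" "x \<le> X'" "0 \<le> X" using X x J_nonneg[OF X] by (auto simp: X'_def max_def)
    have "integral {0..X} ?f + integral {X..X'} ?f = integral {0..X'} ?f"
      using X' by (intro Henstock_Kurzweil_Integration.integral_combine Uw_int) auto
    moreover have "0 \<le> integral {X..X'} ?f"
      by (rule integral_nonneg_AE_interval[OF Uw_int[OF X'(4,1)] AE_einterval_Ioo[OF weighted_nonneg X'(4,1)]])
    moreover have "integral {0..x} ?f + integral {x..X'} ?f = integral {0..X'} ?f"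
      using X' x0 by (intro Henstock_Kurzweil_Integration.integral_combine Uw_int) auto
    moreover have "integral {0..y} ?f + integral {y..x} ?f = integral {0..x} ?f"
      using y x by (intro Henstock_Kurzweil_Integration.integral_combine Uw_int) auto
    moreover have "integral {x..X'} ?f \<le> 0 * (W X' - W x)"
    proof (rule weighted_integral_le[OF Uw_int[OF x0 X'(1)] x0 X'(3,1)])
      fix s assume s: "s \<in> {x<..<X'}"
      then have "s \<in> J" using x0 by (intro half_open_le[OF X'(1)]) auto
      then show "(norm (U s))\<^sup>2 \<le> 0" using U0[of s] s by simp
    qed
    moreover have "integral {0..y} ?f \<le> (R x)\<^sup>2 * (W y - W 0)"
    proof (rule weighted_integral_le[OF Uw_int[OF order_refl yJ] order_refl y(1) yJ])
      fix s assume s: "s \<in> {0<..<y}"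
      then have "norm (U s) \<le> R x - R s" using y by (intro U_le) auto
      moreover have "0 \<le> R s" using s by (intro R_nonneg half_open_le[OF yJ]) auto
      ultimately show "(norm (U s))\<^sup>2 \<le> (R x)\<^sup>2" by (intro power_mono) auto
    qed
    moreover have "integral {y..x} ?f \<le> (R x - R y)\<^sup>2 * (W x - W y)"
    proof (rule weighted_integral_le[OF Uw_int[OF y(1) x(1)] y x(1)])
      fix s assume s: "s \<in> {y<..<x}"
      then have "norm (U s) \<le> R x - R s" using y by (intro U_le) auto
      moreover have "R y \<le> R s" using s y by (intro R_le half_open_le[OF x(1)]) auto
      ultimately show "(norm (U s))\<^sup>2 \<le> (R x - R y)\<^sup>2" by (intro power_mono) auto
    qed
    ultimately show ?thesis using W_0 by (simp add: M_def)
  qed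
  have U2: "L2 b w U"
    unfolding L2_def
  proof
    show "U \<in> borel_measurable (lebesgue_on (einterval 0 b))"
      using AC_loc_continuous_on[OF b_pos u_AC]
      by (intro continuous_imp_measurable_on_sets_lebesgue continuous_on_einterval b_pos) auto
    show "(\<lambda>s. (norm (U s))\<^sup>2 * w s) absolutely_integrable_on einterval 0 b"
      using L1_if_bounded[OF b_pos Uw_loc weighted_nonneg Uw_le] by (simp add: L1_def)
  qed
  have hw_eq: "(\<lambda>s. (norm (h s))\<^sup>2 * w s) = (\<lambda>s. (1 / W x)\<^sup>2 * wx s)"
    by (auto simp: h_def hR_def wx_def power_divide)
  have hw_loc: "L1_loc b (\<lambda>s. (norm (h s))\<^sup>2 * w s)"
    unfolding hw_eq by (rule L1_loc_cmult[OF wx_loc])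
  have hw_le: "integral {0..X} (\<lambda>s. (norm (h s))\<^sup>2 * w s) \<le> 1 / W x" if X: "X \<in> J" for X
  proof -
    have "integral {0..X} (\<lambda>s. (norm (h s))\<^sup>2 * w s) = (1 / W x)\<^sup>2 * W (min X x)"
      unfolding hw_eq using wx_int[OF X] by simp
    also have "\<dots> \<le> (1 / W x)\<^sup>2 * W x"
      using J_nonneg[OF X] x by (intro mult_left_mono W_le) auto
    also have "\<dots> = 1 / W x" using Wx by (simp add: power2_eq_square)
    finally show ?thesis .
  qed
  have h2: "L2 b w h"
    unfolding L2_def
  proof
    have "h \<in> borel_measurable borel" unfolding h_def hR_def by measurable
    then show "h \<in> borel_measurable (lebesgue_on (einterval 0 b))"
      by (intro measurable_restrict_space1 measurable_completion) simp
    show "(\<lambda>s. (norm (h s))\<^sup>2 * w s) absolutely_integrable_on einterval 0 b"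
      using L1_if_bounded[OF b_pos hw_loc weighted_nonneg hw_le] by (simp add: L1_def)
  qed
  have dom: "U \<in> dom_A b w r" by (rule in_dom_A[OF U2 h2 x(1)]) (rule V0)
  have lhs: "(1 - W y / W x)\<^sup>2 * R y \<le> integral {0..y} (\<lambda>s. r s * (norm (V s))\<^sup>2)"
  proof -
    have "(1 - W y / W x)\<^sup>2 * R y = integral {0..y} (\<lambda>s. (1 - W y / W x)\<^sup>2 * r s)"
      using primitive_eq[OF b_pos r_loc yJ] by simp
    also have "\<dots> \<le> integral {0..y} (\<lambda>s. r s * (norm (V s))\<^sup>2)"
    proof (rule integral_mono_AE_interval)
      show "(\<lambda>s. (1 - W y / W x)\<^sup>2 * r s) integrable_on {0..y}"
        by (intro integrable_on_mult_right r_int order_refl yJ)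
      show "(\<lambda>s. r s * (norm (V s))\<^sup>2) integrable_on {0..y}" by (rule energy_int[OF order_refl yJ])
      show "AE s\<in>{0<..<y} in lebesgue. (1 - W y / W x)\<^sup>2 * r s \<le> r s * (norm (V s))\<^sup>2"
        using AE_einterval_Ioo[OF r_nonneg order_refl yJ]
      proof eventually_elim
        case (elim s)
        show ?case
        proof
          assume s: "s \<in> {0<..<y}"
          have "W s \<le> W y" using s by (intro W_le yJ) auto
          then have "1 - W y / W x \<le> vR s" using s y Wx by (simp add: vR_def min_def divide_right_mono)
          moreover have "0 \<le> 1 - W y / W x" using W_le[OF y x(1)] Wx by simp
          ultimately have "(1 - W y / W x)\<^sup>2 \<le> (norm (V s))\<^sup>2"
            by (intro power_mono) (auto simp: V_def)
          then show "(1 - W y / W x)\<^sup>2 * r s \<le> r s * (norm (V s))\<^sup>2"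
            using elim s by (simp add: mult.commute[of "r s"] mult_right_mono)
        qed
      qed
    qed
    finally show ?thesis .
  qed
  have lhs0: "0 \<le> (1 - W y / W x)\<^sup>2 * R y" using R_nonneg[OF yJ] by simp
  have "ennreal ((1 - W y / W x)\<^sup>2 * R y) \<le> ennreal (integral {0..y} (\<lambda>s. r s * (norm (V s))\<^sup>2))"
    using lhs by (rule ennreal_leI)
  also have "\<dots> \<le> (\<integral>\<^sup>+x\<in>einterval 0 b. ennreal (1 / r x * (norm (vector_derivative U (at x)))\<^sup>2) \<partial>lebesgue)"
    unfolding energy_nn_integral by (rule set_nn_integral_einterval_ge[OF b_pos energy_L1_loc energy_nonneg yJ])
  finally have "(ennreal ((1 - W y / W x)\<^sup>2 * R y))\<^sup>2
     \<le> (\<integral>\<^sup>+x\<in>einterval 0 b. ennreal (1 / r x * (norm (vector_derivative U (at x)))\<^sup>2) \<partial>lebesgue)\<^sup>2"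
    by (rule power_mono) simp
  also have "\<dots> \<le> ennreal (K\<^sup>2) * (\<integral>\<^sup>+x\<in>einterval 0 b. ennreal ((norm (U x))\<^sup>2 * w x) \<partial>lebesgue)
       * (\<integral>\<^sup>+x\<in>einterval 0 b. ennreal ((norm (h x))\<^sup>2 * w x) \<partial>lebesgue)"
    using H[OF dom] unfolding quasi_deriv_nn_integral[symmetric] HELP_inequality_def .
  also have "\<dots> \<le> ennreal (K\<^sup>2) * ennreal M * ennreal (1 / W x)"
    by (intro mult_mono order_refl set_nn_integral_einterval_le[OF b_pos Uw_loc weighted_nonneg Uw_le]
        set_nn_integral_einterval_le[OF b_pos hw_loc weighted_nonneg hw_le]) auto
  also have "\<dots> = ennreal (K\<^sup>2 * M * (1 / W x))"
    using M0 Wx by (simp only: ennreal_mult' zero_le_power2 mult_nonneg_nonneg)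
  finally have "((1 - W y / W x)\<^sup>2 * R y)\<^sup>2 \<le> K\<^sup>2 * M * (1 / W x)"
    using M0 Wx lhs0 by (simp add: power2_ennreal)
  then show ?thesis by (simp add: M_def)
qed

text \<open>If \<open>W y = t W x\<close> and \<open>R y > (1 - d) R x\<close>, then the test function at \<open>x\<close> gives
  \<open>((1 - t)\<^sup>2 R y)\<^sup>2 \<le> K\<^sup>2 (t + d\<^sup>2) (R x)\<^sup>2\<close>, which is impossible for \<open>t = d\<^sup>2\<close> and \<open>K d \<le> 1/6\<close>, \<open>d \<le> 1/2\<close>.\<close>

theorem scale_gap_if_H_valid:
  assumes "H_valid b w r"
  obtains t d where "scale_gap t d"
proof -
  obtain K where K: "K > 0" and H: "\<And>f. f \<in> dom_A b w r \<Longrightarrow> HELP_inequality b w r K f"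
    using assms unfolding H_valid_alt by blast
  define d where "d = min (1 / 2) (1 / (6 * (K + 1)))"
  define t where "t = d\<^sup>2"
  have d: "0 < d" "d \<le> 1 / 2" using K by (auto simp: d_def)
  have t: "0 < t" "t \<le> 1 / 4"
    using d power_mono[of d "1/2" 2] by (auto simp: t_def power_divide)
  have Kd: "K * d \<le> 1 / 6"
  proof -
    have "K * d \<le> K * (1 / (6 * (K + 1)))" using K by (intro mult_left_mono) (auto simp: d_def)
    also have "\<dots> \<le> 1 / 6" using K by (simp add: field_simps)
    finally show ?thesis .
  qed
  have "R y \<le> (1 - d) * R x" if x: "x \<in> J" and y: "y \<in> J" and Wy: "W y = t * W x" for x y
  proof (rule ccontr)
    assume neg: "\<not> R y \<le> (1 - d) * R x"
    have x0: "x \<noteq> 0"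
    proof
      assume "x = 0"
      then have "W y = W 0" using Wy W_0 by simp
      then have "y = 0" using W_eq_iff[OF y half_open_0[OF b_pos]] by simp
      with neg \<open>x = 0\<close> R_0 show False by simp
    qed
    then have xp: "0 < x" using J_nonneg[OF x] by simp
    have Wx: "0 < W x" by (rule W_pos[OF xp x])
    have "W y < W x" using Wy t Wx by simp
    then have yx: "y \<le> x" using W_less_iff[OF y x] by simp
    have Rx: "0 < R x" by (rule R_pos[OF xp x])
    have "((1 - W y / W x)\<^sup>2 * R y)\<^sup>2 \<le> K\<^sup>2 * ((R x)\<^sup>2 * W y + (R x - R y)\<^sup>2 * (W x - W y)) / W x"
      by (rule energy_inequality_test_function[OF K H x xp J_nonneg[OF y] yx])
    also have "1 - W y / W x = 1 - t" using Wy Wx by simp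
    also have "K\<^sup>2 * ((R x)\<^sup>2 * W y + (R x - R y)\<^sup>2 * (W x - W y)) / W x
       = K\<^sup>2 * ((R x)\<^sup>2 * t + (R x - R y)\<^sup>2 * (1 - t))"
      using Wx Wy by (simp add: field_simps)
    also have "\<dots> \<le> K\<^sup>2 * ((R x)\<^sup>2 * t + (d * R x)\<^sup>2 * 1)"
    proof (intro mult_left_mono add_left_mono mult_mono power_mono)
      show "R x - R y \<le> d * R x" using neg by (simp add: algebra_simps)
      show "0 \<le> R x - R y" using R_le[OF J_nonneg[OF y] yx x] by simp
    qed (use t in auto)
    also have "\<dots> = 2 * (K * d)\<^sup>2 * (R x)\<^sup>2" by (simp add: t_def power2_eq_square algebra_simps)
    also have "\<dots> \<le> 2 * (1 / 6)\<^sup>2 * (R x)\<^sup>2"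
      using Kd K d by (intro mult_right_mono mult_left_mono power_mono) auto
    finally have up: "((1 - t)\<^sup>2 * R y)\<^sup>2 \<le> 2 * (1 / 6)\<^sup>2 * (R x)\<^sup>2" .
    have "(3 / 4)\<^sup>2 * (1 / 2 * R x) \<le> (1 - t)\<^sup>2 * R y"
    proof (intro mult_mono power_mono)
      have "1 / 2 * R x \<le> (1 - d) * R x" using d Rx by (intro mult_right_mono) auto
      then show "1 / 2 * R x \<le> R y" using neg by simp
    qed (use t Rx in auto)
    then have "((3 / 4)\<^sup>2 * (1 / 2 * R x))\<^sup>2 \<le> ((1 - t)\<^sup>2 * R y)\<^sup>2"
      using Rx by (intro power_mono) auto
    with up have "((3 / 4)\<^sup>2 * (1 / 2 * R x))\<^sup>2 \<le> 2 * (1 / 6)\<^sup>2 * (R x)\<^sup>2" by simp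
    then have "81 / 1024 * (R x)\<^sup>2 \<le> 1 / 18 * (R x)\<^sup>2" by (simp add: power_mult_distrib power_divide)
    then show False using Rx by (simp add: mult_le_cancel_right)
  qed
  then have "scale_gap t d" using d t by (auto simp: scale_gap_def)
  then show ?thesis by (rule that)
qed

end

section \<open>The scale gap and positive increase\<close>

context weights
begin

text \<open>The function \<open>R \<circ> W\<^sup>-\<^sup>1\<close>, used on the range \<open>W ` J = [0, W(b))\<close>.\<close>

abbreviation "P \<equiv> R_comp_W_inv b w r"

lemma J_def': "{x. 0 \<le> x \<and> ereal x < b} = J" by (simp add: half_open_def)

lemma inj_on_W: "inj_on W J"
  by (rule inj_onI) (simp add: W_eq_iff)

lemma W_inv_W: "x \<in> J \<Longrightarrow> the_inv_into J W (W x) = x"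
  by (rule the_inv_into_f_f[OF inj_on_W])

lemma P_W: "x \<in> J \<Longrightarrow> P (W x) = R x"
  by (simp add: R_comp_W_inv_def J_def' W_inv_W)

lemma W_range_down:
  assumes "s \<in> W ` J" "0 \<le> s'" "s' \<le> s"
  shows "s' \<in> W ` J"
proof -
  obtain x where x: "x \<in> J" "s = W x" using assms(1) by blast
  obtain y where y: "0 \<le> y" "y \<le> x" "W y = s'" using W_attains[OF x(1) assms(2)] assms(3) x(2) by blast
  then show ?thesis using half_open_le[OF x(1) y(1,2)] by auto
qed

lemma P_less:
  assumes "s \<in> W ` J" "s' \<in> W ` J" "s < s'"
  shows "P s < P s'"
proof -
  obtain x y where xy: "x \<in> J" "s = W x" "y \<in> J" "s' = W y" using assms by blast
  then have "x < y" using assms(3) W_less_iff by simp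
  then show ?thesis using xy R_less[OF J_nonneg[OF xy(1)] _ xy(3)] by (simp add: P_W)
qed

lemma P_le: "s \<in> W ` J \<Longrightarrow> s' \<in> W ` J \<Longrightarrow> s \<le> s' \<Longrightarrow> P s \<le> P s'"
  using P_less[of s s'] by (cases "s = s'") auto

lemma zero_in_W_range: "0 \<in> W ` J"
  using half_open_0[OF b_pos] W_0 by (metis imageI)

lemma P_0: "P 0 = 0"
  using P_W[OF half_open_0[OF b_pos]] W_0 R_0 by simp

lemma P_pos: "s \<in> W ` J \<Longrightarrow> 0 < s \<Longrightarrow> 0 < P s"
  using P_less[OF zero_in_W_range, of s] P_0 by simp

lemma P_continuous_on:
  assumes "s \<in> W ` J"
  shows "continuous_on {0..s} P"
proof -
  obtain x where x: "x \<in> J" "s = W x" using assms by blast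
  have sub: "{0..x} \<subseteq> J" using half_open_le[OF x(1)] by auto
  have im: "W ` {0..x} = {0..s}"
  proof
    show "W ` {0..x} \<subseteq> {0..s}" using sub W_nonneg W_le[OF _ _ x(1)] x(2) by auto
    show "{0..s} \<subseteq> W ` {0..x}"
    proof
      fix s' assume "s' \<in> {0..s}"
      then obtain y where "0 \<le> y" "y \<le> x" "W y = s'" using W_attains[OF x(1), of s'] x(2) by auto
      then show "s' \<in> W ` {0..x}" by auto
    qed
  qed
  have inv: "continuous_on {0..s} (the_inv_into J W)"
    unfolding im[symmetric]
    by (rule continuous_on_inv[OF primitive_continuous_on[OF b_pos w_loc x(1)]])
       (use sub W_inv_W in auto)
  have "the_inv_into J W ` {0..s} = {0..x}"
    unfolding im[symmetric] image_image using sub W_inv_W by (auto simp: subset_iff image_def)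
  then have "continuous_on {0..s} (R \<circ> the_inv_into J W)"
    using primitive_continuous_on[OF b_pos r_loc x(1)] by (intro continuous_on_compose[OF inv]) simp
  then show ?thesis by (simp add: R_comp_W_inv_def J_def')
qed

lemma scale_gap_iff:
  "scale_gap t d \<longleftrightarrow> 0 < t \<and> t < 1 \<and> 0 < d \<and> d < 1 \<and> (\<forall>s\<in>W ` J. 0 < s \<longrightarrow> P (s * t) \<le> (1 - d) * P s)"
proof -
  have "(\<forall>x\<in>J. \<forall>y\<in>J. W y = t * W x \<longrightarrow> R y \<le> (1 - d) * R x) \<longleftrightarrow>
     (\<forall>s\<in>W ` J. 0 < s \<longrightarrow> P (s * t) \<le> (1 - d) * P s)" if t: "0 < t" "t < 1"
  proof (intro iffI ballI impI)
    fix s assume *: "\<forall>x\<in>J. \<forall>y\<in>J. W y = t * W x \<longrightarrow> R y \<le> (1 - d) * R x" and s: "s \<in> W ` J" "0 < s"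
    obtain x where x: "x \<in> J" "s = W x" using s by blast
    have "s * t \<in> W ` J" by (rule W_range_down[OF s(1)]) (use s t in auto)
    then obtain y where y: "y \<in> J" "s * t = W y" by blast
    have "R y \<le> (1 - d) * R x" using * x y by (simp add: mult.commute)
    then show "P (s * t) \<le> (1 - d) * P s" using x y P_W by simp
  next
    fix x y assume *: "\<forall>s\<in>W ` J. 0 < s \<longrightarrow> P (s * t) \<le> (1 - d) * P s"
      and xy: "x \<in> J" "y \<in> J" "W y = t * W x"
    show "R y \<le> (1 - d) * R x"
    proof (cases "x = 0")
      case True
      then have "W y = W 0" using xy(3) W_0 by simp
      then have "y = 0" using W_eq_iff[OF xy(2) half_open_0[OF b_pos]] by simp
      then show ?thesis using True R_0 by simp
    next
      case False
      then have "0 < W x" using W_pos J_nonneg[OF xy(1)] xy(1) by simp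
      then have "P (W x * t) \<le> (1 - d) * P (W x)" using * xy(1) by simp
      then show ?thesis using xy P_W by (metis mult.commute)
    qed
  qed
  then show ?thesis unfolding scale_gap_def by blast
qed

lemma eventually_W_range_at_right: "\<forall>\<^sub>F s in at_right 0. s \<in> W ` J \<and> 0 < s"
proof -
  obtain x where x: "x \<in> J" "0 < x" using half_open_larger[OF half_open_0[OF b_pos]] .
  then have "W x > 0" by (simp add: W_pos)
  moreover have "s \<in> W ` J \<and> 0 < s" if "0 < s" "s < W x" for s
    using W_range_down[of "W x" s] x that by auto
  ultimately show ?thesis by (auto simp: eventually_at_right[of 0 1])
qed

lemma W_range_unbounded:
  assumes "\<not> L1 b w" "0 \<le> s"
  shows "s \<in> W ` J"
proof -
  obtain x where "x \<in> J" "s < W x" using W_unbounded[OF assms(1)] .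
  then show ?thesis using W_range_down[of "W x" s] assms(2) by auto
qed

lemma eventually_W_range_at_top:
  assumes "\<not> L1 b w"
  shows "\<forall>\<^sub>F s in at_top. s \<in> W ` J \<and> 0 < s"
  using eventually_gt_at_top[of 0] by eventually_elim (auto intro: W_range_unbounded[OF assms])

lemma positively_increasing_if_scale_gap:
  assumes gap: "scale_gap t d" and ev: "\<forall>\<^sub>F s in F. s \<in> W ` J \<and> 0 < s"
  shows "positively_increasing F P"
proof -
  have t: "0 < t" "t < 1" and d: "0 < d" and g: "\<And>s. s \<in> W ` J \<Longrightarrow> 0 < s \<Longrightarrow> P (s * t) \<le> (1 - d) * P s"
    using gap unfolding scale_gap_iff by auto
  have "\<forall>\<^sub>F s in F. ereal (P (s * t) / P s) \<le> ereal (1 - d)"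
    using ev
  proof eventually_elim
    case (elim s)
    then show ?case using g[of s] P_pos[of s] by (simp add: pos_divide_le_eq)
  qed
  then have "Limsup F (\<lambda>s. ereal (P (s * t) / P s)) \<le> ereal (1 - d)" by (rule Limsup_bounded)
  also have "\<dots> < 1" using d by (simp add: one_ereal_def)
  finally show ?thesis unfolding positively_increasing_def using t by (intro exI[of _ t]) auto
qed

text \<open>The ratio never exceeds \<open>1\<close>, so a limit superior other than \<open>1\<close> is less than \<open>1\<close>.\<close>

lemma positively_increasingD:
  assumes pi: "positively_increasing F P" and ev: "\<forall>\<^sub>F s in F. s \<in> W ` J \<and> 0 < s"
  obtains t c where "0 < t" "t < 1" "c < 1" "\<forall>\<^sub>F s in F. P (s * t) \<le> c * P s"
proof -
  obtain t where t: "0 < t" "t < 1" "Limsup F (\<lambda>s. ereal (P (s * t) / P s)) \<noteq> 1"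
    using pi unfolding positively_increasing_def by blast
  have "\<forall>\<^sub>F s in F. ereal (P (s * t) / P s) \<le> 1"
    using ev
  proof eventually_elim
    case (elim s)
    then have s: "s \<in> W ` J" by simp
    have "s * t \<in> W ` J" using elim t by (intro W_range_down[OF s]) auto
    then have "P (s * t) \<le> P s" using elim t by (intro P_le[OF _ s]) auto
    then show ?case using P_pos[of s] elim by (simp add: one_ereal_def)
  qed
  then have "Limsup F (\<lambda>s. ereal (P (s * t) / P s)) \<le> 1" by (rule Limsup_bounded)
  with t(3) have "Limsup F (\<lambda>s. ereal (P (s * t) / P s)) < 1" by simp
  then obtain c where c: "Limsup F (\<lambda>s. ereal (P (s * t) / P s)) < ereal c" "ereal c < 1"
    using ereal_dense2 by blast
  have "\<forall>\<^sub>F s in F. ereal (P (s * t) / P s) < ereal c" by (rule Limsup_lessD[OF c(1)])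
  with ev have "\<forall>\<^sub>F s in F. P (s * t) \<le> c * P s"
  proof eventually_elim
    case (elim s)
    then show ?case using P_pos[of s] by (simp add: pos_divide_less_eq)
  qed
  then show ?thesis using that[OF t(1,2) _] c(2) by (simp add: one_ereal_def)
qed

text \<open>On a compact interval away from \<open>0\<close> the ratio is bounded away from \<open>1\<close> by continuity.\<close>

lemma ratio_bound_compact:
  assumes s0: "0 < s0" and s1: "s1 \<in> W ` J" and t: "0 < t" "t < 1"
  obtains c where "c < 1" "\<And>s. s0 \<le> s \<Longrightarrow> s \<le> s1 \<Longrightarrow> P (s * t) \<le> c * P s"
proof (cases "s0 \<le> s1")
  case False
  then show ?thesis using that[of 0] by auto
next
  case True
  have S: "s \<in> W ` J" "s * t \<in> W ` J" "0 < s" "s * t < s" "s * t \<in> {0..s1}" "0 < P s" if "s \<in> {s0..s1}" for s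
  proof -
    show s: "s \<in> W ` J" using that s0 by (intro W_range_down[OF s1]) auto
    show s0': "0 < s" using that s0 by simp
    show st: "s * t < s" using s0' t by simp
    show "s * t \<in> W ` J" using s0' st t by (intro W_range_down[OF s]) auto
    have "s \<le> s1" using that by simp
    then have "s * t \<le> s1" using st by linarith
    then show "s * t \<in> {0..s1}" using s0' t(1) by simp
    show "0 < P s" using P_pos[OF s s0'] .
  qed
  have "continuous_on {s0..s1} (\<lambda>s. P (s * t) / P s)"
  proof (intro continuous_on_divide)
    show "continuous_on {s0..s1} P"
      by (rule continuous_on_subset[OF P_continuous_on[OF s1]]) (use s0 in auto)
    show "continuous_on {s0..s1} (\<lambda>s. P (s * t))"
      by (rule continuous_on_compose2[OF P_continuous_on[OF s1]]) (use S(5) in \<open>auto intro!: continuous_intros\<close>)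
    show "\<forall>s\<in>{s0..s1}. P s \<noteq> 0" using S(6) by fastforce
  qed
  then have "\<exists>z\<in>{s0..s1}. \<forall>s\<in>{s0..s1}. P (s * t) / P s \<le> P (z * t) / P z"
    using True by (intro continuous_attains_sup) auto
  then obtain z where z: "z \<in> {s0..s1}" "\<And>s. s \<in> {s0..s1} \<Longrightarrow> P (s * t) / P s \<le> P (z * t) / P z" by blast
  show ?thesis
  proof (rule that[of "P (z * t) / P z"])
    show "P (z * t) / P z < 1" using P_less[of "z * t" z] S[OF z(1)] by simp
    fix s assume "s0 \<le> s" "s \<le> s1"
    then have s: "s \<in> {s0..s1}" by simp
    show "P (s * t) \<le> P (z * t) / P z * P s" using z(2)[OF s] S(6)[OF s] by (simp add: pos_divide_le_eq)
  qed
qed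

lemma scale_gapI:
  assumes t: "0 < t" "t < 1" and c: "c < 1" and le: "\<And>s. s \<in> W ` J \<Longrightarrow> 0 < s \<Longrightarrow> P (s * t) \<le> c * P s"
  shows "\<exists>t d. scale_gap t d"
proof -
  \<comment> \<open>The maximum keeps \<open>d\<close> below \<open>1\<close>.\<close>
  define d where "d = 1 - max c (1 / 2)"
  have "P (s * t) \<le> (1 - d) * P s" if "s \<in> W ` J" "0 < s" for s
  proof -
    have "c * P s \<le> (1 - d) * P s" using P_pos[OF that] by (intro mult_right_mono) (auto simp: d_def)
    then show ?thesis using le[OF that] by simp
  qed
  then have "scale_gap t d" unfolding scale_gap_iff using t c by (auto simp: d_def)
  then show ?thesis by blast
qed

text \<open>For integrable \<open>w\<close> positive increase at \<open>0\<close> suffices: near the right end of the range of \<open>W\<close> the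
  ratio is at most \<open>P(t W(b)) / P(s1)\<close> for any \<open>s1\<close> between \<open>t W(b)\<close> and \<open>W(b)\<close>.\<close>

lemma scale_gap_if_L1:
  assumes w: "L1 b w" and pi: "positively_increasing (at_right 0) P"
  shows "\<exists>t d. scale_gap t d"
proof -
  obtain t c0 where t: "0 < t" "t < 1" and c0: "c0 < 1" "\<forall>\<^sub>F s in at_right 0. P (s * t) \<le> c0 * P s"
    by (rule positively_increasingD[OF pi eventually_W_range_at_right])
  then obtain s0 where s0: "s0 > 0" "\<And>s. 0 < s \<Longrightarrow> s < s0 \<Longrightarrow> P (s * t) \<le> c0 * P s"
    by (auto simp: eventually_at_right[of 0 1])
  have L: "0 < W_end" using W_less_end[OF w half_open_0[OF b_pos]] W_0 by simp
  have range: "s \<in> W ` J" if s: "0 \<le> s" "s < W_end" for s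
  proof -
    obtain x where x: "x \<in> J" "s < W x" using less_W_end[OF s(2)] .
    show ?thesis by (rule W_range_down[of "W x"]) (use x s in auto)
  qed
  define s1 where "s1 = (t * W_end + W_end) / 2"
  have s1: "t * W_end < s1" "s1 < W_end" "0 < s1"
    using L t by (auto simp: s1_def field_simps add_pos_pos)
  have tL: "t * W_end \<in> W ` J" using L t by (intro range) auto
  have s1r: "s1 \<in> W ` J" using s1 by (intro range) auto
  obtain c1 where c1: "c1 < 1" "\<And>s. s0 \<le> s \<Longrightarrow> s \<le> s1 \<Longrightarrow> P (s * t) \<le> c1 * P s"
    using ratio_bound_compact[OF s0(1) s1r t] by blast
  define c2 where "c2 = P (t * W_end) / P s1"
  have Ps1: "0 < P s1" by (rule P_pos[OF s1r s1(3)])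
  have c2: "c2 < 1" using P_less[OF tL s1r s1(1)] Ps1 by (simp add: c2_def)
  have c20: "0 \<le> c2" using Ps1 P_pos[OF tL] L t by (simp add: c2_def)
  show ?thesis
  proof (rule scale_gapI[OF t, of "max c0 (max c1 c2)"])
    show "max c0 (max c1 c2) < 1" using c0 c1 c2 by simp
    fix s assume s: "s \<in> W ` J" "0 < s"
    have Ps: "0 < P s" by (rule P_pos[OF s])
    have "P (s * t) \<le> c0 * P s \<or> P (s * t) \<le> c1 * P s \<or> P (s * t) \<le> c2 * P s"
    proof (cases "s < s0 \<or> s \<le> s1")
      case True
      then show ?thesis using s0(2)[of s] c1(2)[of s] s(2) by linarith
    next
      case False
      have sL: "s < W_end" using s(1) W_less_end[OF w] by auto
      have "s * t \<in> W ` J" using s t by (intro W_range_down[OF s(1)]) auto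
      then have "P (s * t) \<le> P (t * W_end)" using sL t by (intro P_le tL) (auto simp: mult.commute)
      also have "\<dots> = c2 * P s1" using Ps1 by (simp add: c2_def)
      also have "\<dots> \<le> c2 * P s" using False by (intro mult_left_mono P_le s1r s c20) auto
      finally show ?thesis by simp
    qed
    moreover have "c0 * P s \<le> max c0 (max c1 c2) * P s" "c1 * P s \<le> max c0 (max c1 c2) * P s"
      "c2 * P s \<le> max c0 (max c1 c2) * P s" using Ps by (auto intro!: mult_right_mono)
    ultimately show "P (s * t) \<le> max c0 (max c1 c2) * P s" by linarith
  qed
qed

lemma scale_gap_if_not_L1:
  assumes w: "\<not> L1 b w" and pi: "positively_increasing (at_right 0) P" "positively_increasing at_top P"
  shows "\<exists>t d. scale_gap t d"
proof -
  obtain t0 c0 where t0: "0 < t0" "t0 < 1" and c0: "c0 < 1" "\<forall>\<^sub>F s in at_right 0. P (s * t0) \<le> c0 * P s"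
    using positively_increasingD[OF pi(1) eventually_W_range_at_right] .
  then obtain s0 where s0: "s0 > 0" "\<And>s. 0 < s \<Longrightarrow> s < s0 \<Longrightarrow> P (s * t0) \<le> c0 * P s"
    by (auto simp: eventually_at_right[of 0 1])
  obtain t1 c2 where t1: "0 < t1" "t1 < 1" and c2: "c2 < 1" "\<forall>\<^sub>F s in at_top. P (s * t1) \<le> c2 * P s"
    using positively_increasingD[OF pi(2) eventually_W_range_at_top[OF w]] .
  then obtain s1 where s1: "\<And>s. s1 \<le> s \<Longrightarrow> P (s * t1) \<le> c2 * P s"
    by (auto simp: eventually_at_top_linorder)
  \<comment> \<open>Decreasing \<open>t\<close> only decreases the values \<open>P(s t)\<close>.\<close>
  define t where "t = min t0 t1"
  have t: "0 < t" "t < 1" "t \<le> t0" "t \<le> t1" using t0 t1 by (auto simp: t_def)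
  have mono: "P (s * t) \<le> P (s * t')" if "0 < s" "t \<le> t'" for s t'
    using that t by (intro P_le W_range_unbounded[OF w]) auto
  have s1r: "max s1 0 \<in> W ` J" by (rule W_range_unbounded[OF w]) simp
  obtain c1 where c1: "c1 < 1" "\<And>s. s0 \<le> s \<Longrightarrow> s \<le> max s1 0 \<Longrightarrow> P (s * t) \<le> c1 * P s"
    using ratio_bound_compact[OF s0(1) s1r t(1,2)] by blast
  show ?thesis
  proof (rule scale_gapI[OF t(1,2), of "max c0 (max c1 c2)"])
    show "max c0 (max c1 c2) < 1" using c0 c1 c2 by simp
    fix s assume s: "s \<in> W ` J" "0 < s"
    have Ps: "0 < P s" by (rule P_pos[OF s])
    have "P (s * t) \<le> c0 * P s \<or> P (s * t) \<le> c1 * P s \<or> P (s * t) \<le> c2 * P s"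
      using s0(2)[OF s(2)] s1[of s] c1(2)[of s] mono[OF s(2) t(3)] mono[OF s(2) t(4)] by linarith
    moreover have "c0 * P s \<le> max c0 (max c1 c2) * P s" "c1 * P s \<le> max c0 (max c1 c2) * P s"
      "c2 * P s \<le> max c0 (max c1 c2) * P s" using Ps by (auto intro!: mult_right_mono)
    ultimately show "P (s * t) \<le> max c0 (max c1 c2) * P s" by linarith
  qed
qed

text \<open>If \<open>r\<close> is integrable and \<open>w\<close> is not, then \<open>P\<close> is bounded on an unbounded interval, and a value
  close to its supremum violates the scale gap.\<close>

lemma no_scale_gap:
  assumes r: "L1 b r" and w: "\<not> L1 b w"
  shows "\<not> scale_gap t d"
proof
  assume "scale_gap t d"
  then have t: "0 < t" "t < 1" and d: "0 < d" "d < 1"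
    and g: "\<And>s. s \<in> W ` J \<Longrightarrow> 0 < s \<Longrightarrow> P (s * t) \<le> (1 - d) * P s"
    unfolding scale_gap_iff by auto
  define L where "L = (SUP x\<in>J. R x)"
  have bdd: "bdd_above (R ` J)"
    using L1_integral_le[OF b_pos r r_nonneg, of 0] primitive_eq[OF b_pos r_loc]
    by (intro bdd_aboveI2[of J R "LINT t:einterval 0 b|lebesgue. r t"]) simp
  have RL: "R x \<le> L" if "x \<in> J" for x unfolding L_def using bdd that by (intro cSUP_upper)
  obtain x1 where x1: "x1 \<in> J" "0 < x1" using half_open_larger[OF half_open_0[OF b_pos]] .
  have L: "0 < L" using R_pos[OF x1(2,1)] RL[OF x1(1)] by simp
  have "\<exists>x\<in>J. (1 - d) * L < R x"
    using less_cSUP_iff[of J R "(1 - d) * L"] bdd x1(1) L d by (force simp: L_def)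
  then obtain x where x: "x \<in> J" "(1 - d) * L < R x" by blast
  have "x \<noteq> 0" using x(2) L d R_0 by (auto simp: mult_less_0_iff)
  then have Wx: "0 < W x" using W_pos J_nonneg[OF x(1)] x(1) by simp
  have "0 < W x / t" using Wx t by simp
  then have "W x / t \<in> W ` J" by (intro W_range_unbounded[OF w]) simp
  then obtain X where X: "X \<in> J" "W x / t = W X" by blast
  have "P (W X * t) \<le> (1 - d) * P (W X)" using X \<open>0 < W x / t\<close> by (intro g) auto
  moreover have "W X * t = W x" using t by (simp flip: X(2))
  ultimately have "R x \<le> (1 - d) * R X" using P_W x(1) X(1) by simp
  also have "\<dots> \<le> (1 - d) * L" using RL[OF X(1)] d by (intro mult_left_mono) auto
  finally show False using x(2) by simp
qed

text \<open>The characterization from which the three cases of the theorem are read off.\<close>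

lemma H_valid_iff: "H_valid b w r \<longleftrightarrow> (\<exists>t d. scale_gap t d)"
proof
  assume "H_valid b w r"
  then show "\<exists>t d. scale_gap t d" by (rule scale_gap_if_H_valid) blast
next
  assume "\<exists>t d. scale_gap t d"
  then show "H_valid b w r" using H_valid_if_scale_gap by blast
qed

end

theorem theorem3p7:
  fixes b :: ereal and w r :: "real \<Rightarrow> real"
  assumes "0 < b"
    and "L1_loc b w" and "L1_loc b r"
    and "AE x in lebesgue. x \<in> einterval 0 b \<longrightarrow> 0 < w x"
    and "AE x in lebesgue. x \<in> einterval 0 b \<longrightarrow> 0 < r x"
    and "\<not> regular_endpoint b w r"
  shows "(L1 b w \<longrightarrow>
            (H_valid b w r \<longleftrightarrow> positively_increasing (at_right 0) (R_comp_W_inv b w r)))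
       \<and> (L1 b r \<and> \<not> L1 b w \<longrightarrow> \<not> H_valid b w r)
       \<and> (\<not> L1 b w \<and> \<not> L1 b r \<longrightarrow>
            (H_valid b w r \<longleftrightarrow> positively_increasing (at_right 0) (R_comp_W_inv b w r)
               \<and> positively_increasing at_top (R_comp_W_inv b w r)))"
proof -
  interpret weights b w r by unfold_locales (use assms in auto)
  have at_0: "positively_increasing (at_right 0) P" if "H_valid b w r"
    using that positively_increasing_if_scale_gap[OF _ eventually_W_range_at_right]
    by (auto simp: H_valid_iff)
  have at_inf: "positively_increasing at_top P" if "H_valid b w r" "\<not> L1 b w"
    using that positively_increasing_if_scale_gap[OF _ eventually_W_range_at_top[OF that(2)]]
    by (auto simp: H_valid_iff)
  show ?thesis
    using at_0 at_inf scale_gap_if_L1 scale_gap_if_not_L1 no_scale_gap H_valid_iff by blast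
qed

end
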